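(* Let $Q$ be a symmetric quiver with vertex set $I$. The Poincaré series $Z(\mathfrak L_-,x,q)$ and $Z(\mathfrak L_+^\vee,x,q)$ belong to the subring $$\mathbb Q(q^{\frac12})[[x_i:i\in I]]\subset\mathbb Q((q^{\frac12}))[[x_i:i\in I]].$$ In that subring, we have the equality $$Z(\mathfrak L_-,x,q^{-1})=-Z(\mathfrak L_+^\vee,x,q).$$
   Context: The ground field is $\mathbb Q$. $Q$ is a finite quiver with vertex set $I$ which is symmetric (as many arrows $i\to j$ as $j\to i$). $L=\mathbb Z^I$ has standard basis $(e_i)$ and Euler form $\chi(\mathbf d,\mathbf e)=\sum_i\mathbf d_i\mathbf e_i-\sum_{a:i\to j}\mathbf d_i\mathbf e_j$. $L$-graded vector spaces have braiding $a\otimes b\mapsto(-1)^{\chi(\alpha,\beta)}b\otimes a$ for $a,b$ of $L$-degrees $\alpha,\beta$; Lie algebras are taken in this symmetric monoidal category. $\mathcal N_+(i,j)=\max(-\chi(e_i,e_j),0)$. $\mathfrak L$ is the Lie algebra generated by symbols $i(n)$ ($i\in I$, $n\in\mathbb Z$) of $L$-degree $e_i$ and weight $\frac12\chi(e_i,e_i)-n-1$, with relations $\sum_{k=0}^N(-1)^k\binom Nk[i(m-k),j(n+k)]=0$, $N=\mathcal N_+(i,j)$, for all $i,j\in I$, $m,n\in\mathbb Z$. The cohomological degree is $-2$ times the weight, making $\mathfrak L$ an $L\times\mathbb Z$-graded space. $\mathfrak L_+\subset\mathfrak L$ is the Lie subalgebra generated by $\{i(n):i\in I,n\ge0\}$.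 Let $\mathbf i(z)=\sum_{n}i(n)z^{-n-1}\in\mathfrak L[[z^{\pm1}]]$, and let $C\subset\mathfrak L[[z^{\pm1}]]$ be the smallest subspace containing all $\mathbf i(z)$, $i\in I$, and closed under $\partial_z$ and under the products $\mathbf a\circ_n\mathbf b\,(z)=\mathrm{Res}_w(w-z)^n[\mathbf a(w),\mathbf b(z)]$, $n\ge0$ (where $\mathrm{Res}_w$ takes the coefficient of $w^{-1}$). Then $\mathfrak L_-=\{\mathrm{Res}_z z^{-1}\mathbf a(z):\mathbf a\in C\}$; it is a Lie subalgebra and $\mathfrak L=\mathfrak L_+\oplus\mathfrak L_-$ as vector spaces. Graded dual: $(M^\vee)_{\mathbf d}^n=(M_{\mathbf d}^{-n})^\vee$. For an $L\times\mathbb Z$-graded space $M$ with finite-dimensional components, $Z(M,x,q)=\sum_{\mathbf d\in L}\sum_{k\in\mathbb Z}(-1)^{\chi(\mathbf d,\mathbf d)}\dim M_{\mathbf d}^k\,q^{-k/2}x^{\mathbf d}$. For a series with coefficients in $\mathbb Q(q^{1/2})$, replacing $q$ by $q^{-1}$ means applying the field automorphism $q^{1/2}\mapsto q^{-1/2}$ to the coefficients. *)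

theory Defs
  imports
    "HOL-Library.Poly_Mapping"
    "HOL-Library.Function_Algebras"
    "HOL-Computational_Algebra.Computational_Algebra"
    "HOL-Computational_Algebra.Field_as_Ring"
    "Graph_Theory.Digraph"
begin

section \<open>Symmetric quivers and the Euler form\<close>

text \<open>
  A finite quiver is a \<^locale>\<open>fin_digraph\<close>: loops and multiple arrows are allowed. The
  library's \<^const>\<open>symmetric\<close> only says that the set of pairs joined by an arrow is
  symmetric; here the numbers of arrows have to agree.
\<close>

definition symmetric_quiver :: "('i, 'a) pre_digraph \<Rightarrow> bool" where
  "symmetric_quiver Q \<longleftrightarrow>
     (\<forall>i\<in>verts Q. \<forall>j\<in>verts Q.
        card {a \<in> arcs Q. tail Q a = i \<and> head Q a = j} =
        card {a \<in> arcs Q. tail Q a = j \<and> head Q a = i})"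

text \<open>The lattice \<open>\<int>\<^sup>I\<close>, where \<open>I\<close> is \<^term>\<open>verts Q\<close>: functions vanishing off \<open>I\<close>.\<close>

definition lattice :: "('i, 'a) pre_digraph \<Rightarrow> ('i \<Rightarrow> int) set" where
  "lattice Q = {d. \<forall>i. i \<notin> verts Q \<longrightarrow> d i = 0}"

definition basis_vec :: "'i \<Rightarrow> 'i \<Rightarrow> int" where
  "basis_vec i = (\<lambda>j. if j = i then 1 else 0)"

definition euler :: "('i, 'a) pre_digraph \<Rightarrow> ('i \<Rightarrow> int) \<Rightarrow> ('i \<Rightarrow> int) \<Rightarrow> int" where
  "euler Q d e = (\<Sum>i\<in>verts Q. d i * e i) - (\<Sum>a\<in>arcs Q. d (tail Q a) * e (head Q a))"

definition euler_sign :: "('i, 'a) pre_digraph \<Rightarrow> ('i \<Rightarrow> int) \<Rightarrow> ('i \<Rightarrow> int) \<Rightarrow> rat" where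
  "euler_sign Q d e = (- 1) powi euler Q d e"

definition Nplus :: "('i, 'a) pre_digraph \<Rightarrow> 'i \<Rightarrow> 'i \<Rightarrow> nat" where
  "Nplus Q i j = nat (max (- euler Q (basis_vec i) (basis_vec j)) 0)"


section \<open>The free non-associative algebra on the symbols \<open>i(n)\<close>\<close>

datatype (leaves: 'x) magma = Gen 'x | Br "'x magma" "'x magma"

type_synonym 'i word = "('i \<times> int) magma"
type_synonym 'i free = "'i word \<Rightarrow>\<^sub>0 rat"

definition fscale :: "rat \<Rightarrow> ('x \<Rightarrow>\<^sub>0 rat) \<Rightarrow> ('x \<Rightarrow>\<^sub>0 rat)" where
  "fscale c = Poly_Mapping.map ((*) c)"

lemma lookup_fscale [simp]: "Poly_Mapping.lookup (fscale c f) x = c * Poly_Mapping.lookup f x"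
  by (simp add: fscale_def Poly_Mapping.map.rep_eq when_def)

interpretation free: vector_space "fscale :: rat \<Rightarrow> ('x \<Rightarrow>\<^sub>0 rat) \<Rightarrow> ('x \<Rightarrow>\<^sub>0 rat)"
  by standard (simp_all add: poly_mapping_eq_iff fun_eq_iff lookup_add algebra_simps)

definition fbasis :: "'x \<Rightarrow> 'x \<Rightarrow>\<^sub>0 rat" where
  "fbasis x = Poly_Mapping.single x 1"

definition fmult :: "('x magma \<Rightarrow>\<^sub>0 rat) \<Rightarrow> ('x magma \<Rightarrow>\<^sub>0 rat) \<Rightarrow> ('x magma \<Rightarrow>\<^sub>0 rat)" where
  "fmult f g = (\<Sum>s\<in>Poly_Mapping.keys f. \<Sum>t\<in>Poly_Mapping.keys g.
     Poly_Mapping.single (Br s t) (Poly_Mapping.lookup f s * Poly_Mapping.lookup g t))"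

definition words :: "('i, 'a) pre_digraph \<Rightarrow> 'i word set" where
  "words Q = {t. fst ` leaves t \<subseteq> verts Q}"

definition free_alg :: "('i, 'a) pre_digraph \<Rightarrow> 'i free set" where
  "free_alg Q = free.span (fbasis ` words Q)"

primrec ldeg :: "'i word \<Rightarrow> 'i \<Rightarrow> int" where
  "ldeg (Gen x) = basis_vec (fst x)"
| "ldeg (Br s t) = ldeg s + ldeg t"

primrec weight :: "('i, 'a) pre_digraph \<Rightarrow> 'i word \<Rightarrow> rat" where
  "weight Q (Gen x) =
     of_int (euler Q (basis_vec (fst x)) (basis_vec (fst x))) / 2 - of_int (snd x) - 1"
| "weight Q (Br s t) = weight Q s + weight Q t"


section \<open>The Lie algebra\<close>

text \<open>
  The two-sided ideal generated by the defining relations and by the axioms of a Lie algebra in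
  the symmetric monoidal category of \<open>L\<close>-graded spaces, whose braiding is the sign
  \<^const>\<open>euler_sign\<close>: braided antisymmetry and the braided Jacobi identity. By bilinearity it
  suffices to impose the latter on non-associative monomials.
\<close>

inductive_set lie_ideal :: "('i, 'a) pre_digraph \<Rightarrow> 'i free set"
  for Q :: "('i, 'a) pre_digraph" where
  zero: "0 \<in> lie_ideal Q"
| add: "f \<in> lie_ideal Q \<Longrightarrow> g \<in> lie_ideal Q \<Longrightarrow> f + g \<in> lie_ideal Q"
| scale: "f \<in> lie_ideal Q \<Longrightarrow> fscale c f \<in> lie_ideal Q"
| mult_left: "f \<in> lie_ideal Q \<Longrightarrow> g \<in> free_alg Q \<Longrightarrow> fmult g f \<in> lie_ideal Q"
| mult_right: "f \<in> lie_ideal Q \<Longrightarrow> g \<in> free_alg Q \<Longrightarrow> fmult f g \<in> lie_ideal Q"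
| antisymmetry: "s \<in> words Q \<Longrightarrow> t \<in> words Q \<Longrightarrow>
    fbasis (Br s t) + fscale (euler_sign Q (ldeg s) (ldeg t)) (fbasis (Br t s)) \<in> lie_ideal Q"
| jacobi: "s \<in> words Q \<Longrightarrow> t \<in> words Q \<Longrightarrow> u \<in> words Q \<Longrightarrow>
    fbasis (Br s (Br t u)) - fbasis (Br (Br s t) u)
      - fscale (euler_sign Q (ldeg s) (ldeg t)) (fbasis (Br t (Br s u))) \<in> lie_ideal Q"
| locality: "i \<in> verts Q \<Longrightarrow> j \<in> verts Q \<Longrightarrow>
    (\<Sum>k = 0..Nplus Q i j. fscale ((- 1) ^ k * of_nat (Nplus Q i j choose k))
       (fbasis (Br (Gen (i, m - int k)) (Gen (j, n + int k))))) \<in> lie_ideal Q"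

lemma subspace_lie_ideal: "free.subspace (lie_ideal Q)"
  unfolding free.subspace_def by (auto intro: lie_ideal.intros)

text \<open>
  The quotient by \<^const>\<open>lie_ideal\<close> depends on \<open>Q\<close> and so is not a type. It is realised as a linear
  complement of the ideal inside the free algebra, with a linear projection along the
  ideal as quotient map; the choice of the complement is immaterial up to isomorphism. The lemma
  below says that such a projection exists.
\<close>

definition is_quotient_map :: "('i, 'a) pre_digraph \<Rightarrow> ('i free \<Rightarrow> 'i free) \<Rightarrow> bool" where
  "is_quotient_map Q p \<longleftrightarrow>
     Vector_Spaces.linear fscale fscale p \<and> p \<circ> p = p \<and> {f. p f = 0} = lie_ideal Q"

definition quotient_map :: "('i, 'a) pre_digraph \<Rightarrow> 'i free \<Rightarrow> 'i free" where
  "quotient_map Q = (SOME p. is_quotient_map Q p)"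

lemma is_quotient_map_quotient_map: "is_quotient_map Q (quotient_map Q)"
proof -
  interpret vector_space_pair "fscale :: rat \<Rightarrow> 'a free \<Rightarrow> 'a free"
    "fscale :: rat \<Rightarrow> 'a free \<Rightarrow> 'a free" ..
  have "\<exists>g. g ` UNIV \<subseteq> lie_ideal Q \<and> Vector_Spaces.linear fscale fscale g
            \<and> (\<forall>v\<in>lie_ideal Q. g (id v) = v)"
    by (rule linear_exists_left_inverse_on[OF free.linear_id subspace_lie_ideal]) simp
  then obtain g where g: "\<And>v. g v \<in> lie_ideal Q" "Vector_Spaces.linear fscale fscale g"
      "\<And>v. v \<in> lie_ideal Q \<Longrightarrow> g v = v"
    by auto
  define p where "p = (\<lambda>v. v - g v)"
  have lin: "Vector_Spaces.linear fscale fscale p"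
    unfolding p_def using linear_compose_sub[OF free.linear_id g(2)] by simp
  have add: "g (u - v) = g u - g v" for u v
    using g(2) by (simp add: linear_diff)
  have "p \<circ> p = p"
    by (auto simp: p_def add g fun_eq_iff)
  moreover have "{f. p f = 0} = lie_ideal Q"
    using g by (auto simp: p_def) (metis)
  ultimately have "is_quotient_map Q p"
    using lin by (simp add: is_quotient_map_def)
  then show ?thesis
    unfolding quotient_map_def by (rule someI[of "is_quotient_map Q"])
qed

definition Lie :: "('i, 'a) pre_digraph \<Rightarrow> 'i free set" where
  "Lie Q = quotient_map Q ` free_alg Q"

definition bracket :: "('i, 'a) pre_digraph \<Rightarrow> 'i free \<Rightarrow> 'i free \<Rightarrow> 'i free" where
  "bracket Q a b = quotient_map Q (fmult a b)"

definition gen :: "('i, 'a) pre_digraph \<Rightarrow> 'i \<Rightarrow> int \<Rightarrow> 'i free" where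
  "gen Q i n = quotient_map Q (fbasis (Gen (i, n)))"

text \<open>The component of \<open>L\<close>-degree \<open>d\<close> and cohomological degree \<open>k\<close>, that is, of weight \<open>- k / 2\<close>.\<close>

definition Lie_component :: "('i, 'a) pre_digraph \<Rightarrow> ('i \<Rightarrow> int) \<Rightarrow> int \<Rightarrow> 'i free set" where
  "Lie_component Q d k =
     quotient_map Q ` free.span (fbasis ` {t \<in> words Q. ldeg t = d \<and> of_int k = - 2 * weight Q t})"

inductive_set lie_generated :: "('i, 'a) pre_digraph \<Rightarrow> 'i free set \<Rightarrow> 'i free set"
  for Q :: "('i, 'a) pre_digraph" and S :: "'i free set" where
  base: "a \<in> S \<Longrightarrow> a \<in> lie_generated Q S"
| zero: "0 \<in> lie_generated Q S"
| add: "a \<in> lie_generated Q S \<Longrightarrow> b \<in> lie_generated Q S \<Longrightarrow> a + b \<in> lie_generated Q S"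
| scale: "a \<in> lie_generated Q S \<Longrightarrow> fscale c a \<in> lie_generated Q S"
| bracket: "a \<in> lie_generated Q S \<Longrightarrow> b \<in> lie_generated Q S \<Longrightarrow> bracket Q a b \<in> lie_generated Q S"

definition Lie_plus :: "('i, 'a) pre_digraph \<Rightarrow> 'i free set" where
  "Lie_plus Q = lie_generated Q {gen Q i n | i n. i \<in> verts Q \<and> n \<ge> 0}"


section \<open>Formal distributions\<close>

text \<open>
  A formal distribution \<open>a(z)\<close> is the function sending \<open>p\<close> to the coefficient of \<open>z\<^sup>p\<close>; one in
  \<open>w\<close> and \<open>z\<close> sends \<open>p\<close> and \<open>q\<close> to the coefficient of \<open>w\<^sup>p z\<^sup>q\<close>.
\<close>

definition fd_gen :: "('i, 'a) pre_digraph \<Rightarrow> 'i \<Rightarrow> int \<Rightarrow> 'i free" where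
  "fd_gen Q i = (\<lambda>p. gen Q i (- p - 1))"

definition fd_deriv :: "(int \<Rightarrow> 'i free) \<Rightarrow> int \<Rightarrow> 'i free" where
  "fd_deriv a = (\<lambda>p. fscale (of_int (p + 1)) (a (p + 1)))"

definition fd_res :: "(int \<Rightarrow> 'b) \<Rightarrow> 'b" where
  "fd_res a = a (- 1)"

text \<open>Multiplication by \<open>z\<^sup>-\<^sup>1\<close>, and multiplication by \<open>w - z\<close>.\<close>

definition fd_div_z :: "(int \<Rightarrow> 'b) \<Rightarrow> int \<Rightarrow> 'b" where
  "fd_div_z a = (\<lambda>p. a (p + 1))"

definition fd_mult_w_minus_z :: "(int \<Rightarrow> int \<Rightarrow> 'b::minus) \<Rightarrow> int \<Rightarrow> int \<Rightarrow> 'b" where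
  "fd_mult_w_minus_z D = (\<lambda>p q. D (p - 1) q - D p (q - 1))"

definition fd_prod ::
    "('i, 'a) pre_digraph \<Rightarrow> nat \<Rightarrow> (int \<Rightarrow> 'i free) \<Rightarrow> (int \<Rightarrow> 'i free) \<Rightarrow> int \<Rightarrow> 'i free" where
  "fd_prod Q n a b = fd_res ((fd_mult_w_minus_z ^^ n) (\<lambda>p q. bracket Q (a p) (b q)))"

inductive_set conformal :: "('i, 'a) pre_digraph \<Rightarrow> (int \<Rightarrow> 'i free) set"
  for Q :: "('i, 'a) pre_digraph" where
  base: "i \<in> verts Q \<Longrightarrow> fd_gen Q i \<in> conformal Q"
| zero: "(\<lambda>p. 0) \<in> conformal Q"
| add: "a \<in> conformal Q \<Longrightarrow> b \<in> conformal Q \<Longrightarrow> (\<lambda>p. a p + b p) \<in> conformal Q"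
| scale: "a \<in> conformal Q \<Longrightarrow> (\<lambda>p. fscale c (a p)) \<in> conformal Q"
| deriv: "a \<in> conformal Q \<Longrightarrow> fd_deriv a \<in> conformal Q"
| prod: "a \<in> conformal Q \<Longrightarrow> b \<in> conformal Q \<Longrightarrow> fd_prod Q n a b \<in> conformal Q"

definition Lie_minus :: "('i, 'a) pre_digraph \<Rightarrow> 'i free set" where
  "Lie_minus Q = (\<lambda>a. fd_res (fd_div_z a)) ` conformal Q"


section \<open>Graded spaces and their Poincare series\<close>

text \<open>
  A graded space is given by its components \<open>M d k\<close>, subspaces of a rational vector space with
  scalar multiplication \<open>scl\<close>.
\<close>

type_synonym ('i, 'v) graded_space = "('i \<Rightarrow> int) \<Rightarrow> int \<Rightarrow> 'v set"

definition Lie_minus_graded :: "('i, 'a) pre_digraph \<Rightarrow> ('i, 'i free) graded_space" where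
  "Lie_minus_graded Q d k = Lie_minus Q \<inter> Lie_component Q d k"

definition Lie_plus_graded :: "('i, 'a) pre_digraph \<Rightarrow> ('i, 'i free) graded_space" where
  "Lie_plus_graded Q d k = Lie_plus Q \<inter> Lie_component Q d k"

definition dscale :: "rat \<Rightarrow> ('v \<Rightarrow> rat) \<Rightarrow> ('v \<Rightarrow> rat)" where
  "dscale c f = (\<lambda>v. c * f v)"

interpretation dual: vector_space "dscale :: rat \<Rightarrow> ('v \<Rightarrow> rat) \<Rightarrow> ('v \<Rightarrow> rat)"
  by standard (simp_all add: dscale_def fun_eq_iff algebra_simps)

text \<open>A linear form on the subspace \<open>V\<close> is extended by zero off \<open>V\<close> (not linearly).\<close>

definition dual_space :: "(rat \<Rightarrow> 'v::ab_group_add \<Rightarrow> 'v) \<Rightarrow> 'v set \<Rightarrow> ('v \<Rightarrow> rat) set" where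
  "dual_space scl V = {f. (\<forall>u\<in>V. \<forall>v\<in>V. f (u + v) = f u + f v) \<and>
     (\<forall>c. \<forall>v\<in>V. f (scl c v) = c * f v) \<and> (\<forall>v. v \<notin> V \<longrightarrow> f v = 0)}"

definition graded_dual ::
    "(rat \<Rightarrow> 'v::ab_group_add \<Rightarrow> 'v) \<Rightarrow> ('i, 'v) graded_space \<Rightarrow> ('i, 'v \<Rightarrow> rat) graded_space" where
  "graded_dual scl M d n = dual_space scl (M d (- n))"

definition fin_dim_components ::
    "(rat \<Rightarrow> 'v::ab_group_add \<Rightarrow> 'v) \<Rightarrow> ('i, 'v) graded_space \<Rightarrow> bool" where
  "fin_dim_components scl M \<longleftrightarrow> (\<forall>d k. \<exists>B. finite B \<and> M d k \<subseteq> module.span scl B)"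

text \<open>
  The coefficient of \<open>x\<^sup>d q\<^sup>n\<^sup>/\<^sup>2\<close> in \<open>Z(M,x,q)\<close>, which comes from cohomological degree
  \<open>- n\<close>.
\<close>

definition poincare ::
    "('i, 'a) pre_digraph \<Rightarrow> (rat \<Rightarrow> 'v::ab_group_add \<Rightarrow> 'v) \<Rightarrow> ('i, 'v) graded_space
      \<Rightarrow> ('i \<Rightarrow> int) \<Rightarrow> int \<Rightarrow> rat" where
  "poincare Q scl M d n =
     (if d \<in> lattice Q then euler_sign Q d d * of_nat (vector_space.dim scl (M d (- n))) else 0)"


section \<open>Power series over the rational functions in \<open>q\<^sup>1\<^sup>/\<^sup>2\<close>\<close>

text \<open>
  \<^typ>\<open>rat poly fract\<close> is the field of rational functions in \<open>q\<^sup>1\<^sup>/\<^sup>2\<close>, and \<^typ>\<open>rat fls\<close> that of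
  Laurent series in \<open>q\<^sup>1\<^sup>/\<^sup>2\<close>; the variable of both is \<open>q\<^sup>1\<^sup>/\<^sup>2\<close>, not \<open>q\<close>.
\<close>

definition q_half :: "rat poly fract" where
  "q_half = to_fract [:0, 1:]"

text \<open>The inclusion of the first field in the second.\<close>

definition laurent :: "rat poly fract \<Rightarrow> rat fls" where
  "laurent f = (case quot_of_fract f of (p, r) \<Rightarrow>
     fps_to_fls (fps_of_poly p) / fps_to_fls (fps_of_poly r))"

lemma quot_of_fract_Fract:
  fixes p r :: "rat poly"
  assumes "r \<noteq> 0"
  obtains p' r' d where "quot_of_fract (Fract p r) = (p', r')" "p = p' * d" "r = r' * d"
    "d \<noteq> 0" "r' \<noteq> 0"
proof -
  obtain d where "p = fst (normalize_quot (p, r)) * d" "r = snd (normalize_quot (p, r)) * d" "d \<noteq> 0"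
    using normalize_quotE[OF assms, of p] by blast
  moreover have "quot_of_fract (Fract p r) = normalize_quot (p, r)"
    using quot_of_fract_quot_to_fract[of "(p, r)"] by (simp add: quot_to_fract_def)
  ultimately show ?thesis
    using that[of "fst (normalize_quot (p, r))" "snd (normalize_quot (p, r))" d] by simp
qed

lemma laurent_Fract:
  assumes "r \<noteq> 0"
  shows "laurent (Fract p r) = fps_to_fls (fps_of_poly p) / fps_to_fls (fps_of_poly r)"
  by (rule quot_of_fract_Fract[OF assms, of p])
    (simp add: laurent_def fps_of_poly_mult fls_times_fps_to_fls)

text \<open>The automorphism \<open>q\<^sup>1\<^sup>/\<^sup>2 \<mapsto> q\<^sup>-\<^sup>1\<^sup>/\<^sup>2\<close>.\<close>

definition eval_inv_q_half :: "rat poly \<Rightarrow> rat poly fract" where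
  "eval_inv_q_half p = poly (map_poly (\<lambda>c. to_fract [:c:]) p) (inverse q_half)"

definition invert_q :: "rat poly fract \<Rightarrow> rat poly fract" where
  "invert_q f = (case quot_of_fract f of (p, r) \<Rightarrow> eval_inv_q_half p / eval_inv_q_half r)"

lemma eval_inv_q_half_mult: "eval_inv_q_half (p * r) = eval_inv_q_half p * eval_inv_q_half r"
proof -
  have "map_poly (\<lambda>c. to_fract [:c:]) (p * r) =
      map_poly (\<lambda>c. to_fract [:c:]) p * map_poly (\<lambda>c::rat. to_fract [:c:]) r"
  proof (rule poly_eqI)
    have ad: "to_fract [:a + b:] = to_fract [:a:] + to_fract [:b:]" for a b :: rat
      unfolding to_fract_add[symmetric] by simp
    have mu: "to_fract [:a * b:] = to_fract [:a:] * to_fract [:b:]" for a b :: rat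
      unfolding to_fract_mult[symmetric] by simp
    have *: "to_fract [:sum f A:] = (\<Sum>i\<in>A. to_fract [:f i:])" for f :: "nat \<Rightarrow> rat" and A
      by (induction A rule: infinite_finite_induct)
        (simp_all add: ad)
    show "coeff (map_poly (\<lambda>c. to_fract [:c:]) (p * r)) n =
      coeff (map_poly (\<lambda>c. to_fract [:c:]) p * map_poly (\<lambda>c::rat. to_fract [:c:]) r) n" for n
      by (simp add: coeff_mult coeff_map_poly * mu)
  qed
  then show ?thesis
    by (simp add: eval_inv_q_half_def)
qed

lemma eval_inv_q_half_reflect:
  "q_half ^ degree p * eval_inv_q_half p = to_fract (reflect_poly p)"
proof -
  have q: "q_half \<noteq> 0"
    by (simp add: q_half_def)
  have pw: "to_fract x ^ n = to_fract (x ^ n)" for x :: "rat poly" and n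
    by (induction n) simp_all
  have sm: "to_fract (sum f A) = (\<Sum>i\<in>A. to_fract (f i))" for f :: "nat \<Rightarrow> rat poly" and A
    by (induction A rule: infinite_finite_induct) simp_all
  have "degree (map_poly (\<lambda>c. to_fract [:c:]) p) = degree p"
    by (rule degree_map_poly) simp
  then have "q_half ^ degree p * eval_inv_q_half p =
      (\<Sum>i\<le>degree p. q_half ^ degree p * (to_fract [:coeff p i:] * inverse q_half ^ i))"
    by (simp add: eval_inv_q_half_def poly_altdef coeff_map_poly sum_distrib_left)
  also have "\<dots> = (\<Sum>i\<le>degree p. to_fract (monom (coeff p i) (degree p - i)))"
  proof (rule sum.cong)
    fix i assume "i \<in> {..degree p}"
    then have "q_half ^ degree p * inverse q_half ^ i = q_half ^ (degree p - i)"
      using q by (simp add: power_diff power_inverse field_simps)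
    then have "q_half ^ degree p * (to_fract [:coeff p i:] * inverse q_half ^ i) =
        to_fract [:coeff p i:] * q_half ^ (degree p - i)"
      by (metis mult.left_commute)
    also have "\<dots> = to_fract ([:coeff p i:] * [:0, 1:] ^ (degree p - i))"
      by (simp only: q_half_def pw to_fract_mult)
    also have "[:coeff p i:] * [:0, 1:] ^ (degree p - i) = monom (coeff p i) (degree p - i)"
      by (simp add: monom_altdef)
    finally show "q_half ^ degree p * (to_fract [:coeff p i:] * inverse q_half ^ i) =
        to_fract (monom (coeff p i) (degree p - i))" .
  qed simp
  also have "\<dots> = to_fract (\<Sum>i\<le>degree p. monom (coeff p i) (degree p - i))"
    by (simp add: sm)
  also have "(\<Sum>i\<le>degree p. monom (coeff p i) (degree p - i)) = reflect_poly p"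
  proof (rule poly_eqI)
    fix n
    have "(\<Sum>i\<le>degree p. coeff (monom (coeff p i) (degree p - i)) n) =
        (\<Sum>i\<le>degree p. if n \<le> degree p \<and> i = degree p - n then coeff p i else 0)"
      by (rule sum.cong) auto
    also have "\<dots> = (if n \<le> degree p then coeff p (degree p - n) else 0)"
      by auto
    finally show "coeff (\<Sum>i\<le>degree p. monom (coeff p i) (degree p - i)) n =
        coeff (reflect_poly p) n"
      by (simp add: coeff_sum coeff_reflect_poly)
  qed
  finally show ?thesis .
qed

lemma invert_q_Fract:
  assumes "r \<noteq> 0"
  shows "invert_q (Fract p r) = eval_inv_q_half p / eval_inv_q_half r"
proof -
  have nz: "eval_inv_q_half d \<noteq> 0" if "d \<noteq> 0" for d
    using eval_inv_q_half_reflect[of d] that by auto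
  show ?thesis
    by (rule quot_of_fract_Fract[OF assms, of p]) (simp add: invert_q_def eval_inv_q_half_mult nz)
qed

text \<open>
  A power series in the \<open>x\<^sub>i\<close> is given by its coefficients, which are indexed by \<open>\<int>\<^sup>I\<close> and
  supported on \<open>\<nat>\<^sup>I\<close>.
\<close>

definition power_series :: "('i, 'a) pre_digraph \<Rightarrow> (('i \<Rightarrow> int) \<Rightarrow> 'r::zero) set" where
  "power_series Q = {F. \<forall>d. F d \<noteq> 0 \<longrightarrow> d \<in> lattice Q \<and> (\<forall>i. d i \<ge> 0)}"

text \<open>
  \<open>Z\<close>, a family of coefficients of the \<open>x\<^sup>d q\<^sup>n\<^sup>/\<^sup>2\<close>, belongs to the ring of power series over the
  rational functions and equals \<open>F\<close> there.
\<close>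

definition is_series ::
    "('i, 'a) pre_digraph \<Rightarrow> (('i \<Rightarrow> int) \<Rightarrow> int \<Rightarrow> rat) \<Rightarrow> (('i \<Rightarrow> int) \<Rightarrow> rat poly fract) \<Rightarrow> bool"
  where
  "is_series Q Z F \<longleftrightarrow> F \<in> power_series Q \<and> (\<forall>d n. Z d n = fls_nth (laurent (F d)) n)"

end

theory Submission
  imports Defs
begin

text \<open>
  In degree \<open>d \<noteq> 0\<close> let \<open>h(w)\<close>, \<open>e(w)\<close>, \<open>f(w)\<close> be the dimensions of the components of weight \<open>w\<close> of
  \<open>\<LL>\<close>, \<open>\<LL>\<^sub>-\<close>, \<open>\<LL>\<^sub>+\<close>. The functional equation follows if \<open>h = e + f\<close> with \<open>h(w)\<close> invariant under
  \<open>w \<mapsto> w + 1\<close>, with \<open>e(w) = 0\<close> for \<open>w\<close> small and \<open>f(w) = 0\<close> for \<open>w\<close> large, because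
  \<open>\<Sum>\<^sub>w\<^sub>\<ge>\<^sub>0 q\<^sup>w\<close> and \<open>- \<Sum>\<^sub>w\<^sub><\<^sub>0 q\<^sup>w\<close> expand the same rational function.

  By Dong's lemma and the Jacobi identity, the coefficients of finitely many right-normed products
  \<open>i\<^sub>1 \<circ> (i\<^sub>2 \<circ> (\<dots> \<circ> i\<^sub>k))\<close> span \<open>\<LL>\<close> in degree \<open>d\<close>; those at nonnegative powers of \<open>z\<close> lie in
  \<open>\<LL>\<^sub>-\<close>, those at negative powers in \<open>\<LL>\<^sub>+\<close>. This gives \<open>\<LL> = \<LL>\<^sub>+ + \<LL>\<^sub>-\<close>, finiteness and the bounds.

  The maps \<open>P: i(n) \<mapsto> i(n + 1)\<close> and \<open>T: i(n) \<mapsto> - n i(n - 1)\<close> extend to derivations of \<open>\<LL>\<close>. On a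
  distribution \<open>a(z)\<close> of \<open>C\<close> of degree \<open>d\<close>, with \<open>|d| = \<Sum>\<^sub>i d\<^sub>i\<close>, \<open>T\<close> acts as \<open>\<partial>\<close>, and
  \<open>P a(z) - |d| z a(z)\<close> is an element of \<open>C\<close> of lower weight. Hence \<open>P\<close> is surjective, so
  \<open>h(w) \<le> h(w + 1)\<close>; since the automorphism \<open>i(n) \<mapsto> i(n - 1)\<close> gives \<open>h(w + |d|) = h(w)\<close>, equality
  holds. If \<open>a(z) \<in> C\<close> has its constant coefficient in \<open>\<LL>\<^sub>+\<close>, where \<open>T\<close> is locally nilpotent, then its
  coefficients at high powers of \<open>z\<close> vanish, and comparing \<open>P a(z)\<close> with \<open>|d| z a(z)\<close> shows that all
  those at nonnegative powers do; so \<open>\<LL>\<^sub>+ \<inter> \<LL>\<^sub>- = 0\<close>.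
\<close>

section \<open>Dimensions and dual spaces\<close>

context vector_space
begin

text \<open>The elements of \<open>B\<close> are added one at a time. If \<open>b\<close> lay in
  \<open>span (A \<union> B)\<close>, subtracting its part in \<open>span B\<close> would give an
  element of \<open>span A\<close> inside \<open>span (insert b B)\<close>, hence zero, against the
  independence of \<open>insert b B\<close>.\<close>

lemma independent_Un_span:
  assumes "independent A" "finite B" "independent B" "span A \<inter> span B \<subseteq> {0}"
  shows "independent (A \<union> B)"
  using assms(2-4)
proof (induction B)
  case empty
  then show ?case using assms(1) by simp
next
  case (insert b B)
  have iB: "independent B"
    using insert.prems(1) independent_mono by blast
  have nb: "b \<notin> span B"
    using insert.prems(1) insert.hyps(2) by (simp add: independent_insert)
  have "span B \<subseteq> span (insert b B)"
    by (rule span_mono) auto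
  then have IH: "independent (A \<union> B)"
    using insert.IH[OF iB] insert.prems(2) by blast
  have "b \<notin> span (A \<union> B)"
  proof
    assume "b \<in> span (A \<union> B)"
    then obtain x y where xy: "b = x + y" "x \<in> span A" "y \<in> span B"
      unfolding span_Un by auto
    have "b - y \<in> span (insert b B)"
      using xy(3) by (intro span_diff) (auto intro: span_base span_mono[THEN subsetD, of B])
    then have "x \<in> span (insert b B)"
      using xy by simp
    then have "x = 0" using insert.prems(2) xy(2) by auto
    then show False using xy nb by simp
  qed
  then show ?case
    using IH independent_insertI by simp
qed

text \<open>The finite spanning set matters: \<open>dim\<close> is 0 on infinite-dimensional spaces,
  where additivity can fail.\<close>

lemma dim_direct_sum:
  assumes "subspace U" "subspace W" "U \<inter> W \<subseteq> {0}" "finite F" "V \<subseteq> span F"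
    and "U \<subseteq> V" "W \<subseteq> V" "\<And>v. v \<in> V \<Longrightarrow> \<exists>u\<in>U. \<exists>w\<in>W. v = u + w" "subspace V"
  shows "dim V = dim U + dim W"
proof -
  obtain A where A: "A \<subseteq> U" "independent A" "U \<subseteq> span A" "card A = dim U"
    by (rule basis_exists)
  obtain B where B: "B \<subseteq> W" "independent B" "W \<subseteq> span B" "card B = dim W"
    by (rule basis_exists)
  have fin: "finite A" "finite B"
    using A B assms independent_span_bound[OF assms(4)] by (meson order_trans)+
  have sA: "span A = U" and sB: "span B = W"
    using A B assms(1,2) by (simp_all add: span_subspace)
  have ind: "independent (A \<union> B)"
    using A(2) fin(2) B(2) assms(3) sA sB by (intro independent_Un_span) auto
  have disj: "A \<inter> B = {}"
  proof -
    have "A \<inter> B \<subseteq> {0}" using A(1) B(1) assms(3) by blast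
    moreover have "0 \<notin> A" using A(2) dependent_zero by blast
    ultimately show ?thesis by blast
  qed
  have "V \<subseteq> span (A \<union> B)"
    unfolding span_Un sA sB using assms(8) by blast
  moreover have "A \<union> B \<subseteq> V" using A(1) B(1) assms by blast
  ultimately have "dim V = card (A \<union> B)"
    using ind basis_card_eq_dim by metis
  then show ?thesis
    using disj fin A B by (simp add: card_Un_disjoint)
qed

end

lemma (in vector_space_pair) dim_image_le_finite:
  assumes "Vector_Spaces.linear s1 s2 f" "finite F" "V \<subseteq> vs1.span F" "W \<subseteq> f ` V"
  shows "vs2.dim W \<le> vs1.dim V"
proof -
  obtain B where B: "B \<subseteq> V" "vs1.independent B" "V \<subseteq> vs1.span B" "card B = vs1.dim V"
    by (rule vs1.basis_exists)
  have fin: "finite B"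
    using B(1,2) assms(2,3) vs1.independent_span_bound[OF assms(2)] by (meson order_trans)
  have "W \<subseteq> f ` vs1.span B" using assms(4) B(3) by blast
  also have "\<dots> = vs2.span (f ` B)"
    using linear_span_image[OF assms(1)] by simp
  finally have "vs2.dim W \<le> card (f ` B)"
    using fin by (intro vs2.dim_le_card) auto
  also have "\<dots> \<le> card B" using fin by (rule card_image_le)
  finally show ?thesis using B by simp
qed

section \<open>Duals of finite-dimensional spaces\<close>

lemma sum_dscale_apply: "(\<Sum>x\<in>A. dscale (r x) (g x)) v = (\<Sum>x\<in>A. r x * g x v)"
  by (induction A rule: infinite_finite_induct) (auto simp: dscale_def)

lemma dual_space_basis:
  assumes vs: "vector_space scl" and V: "module.subspace scl V"
    and B: "finite B" "B \<subseteq> V" "\<not> module.dependent scl B" "V \<subseteq> module.span scl B"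
  shows "\<exists>D. finite D \<and> card D = card B \<and> D \<subseteq> dual_space scl V
    \<and> \<not> dual.dependent D \<and> dual_space scl V \<subseteq> dual.span D"
proof -
  interpret vector_space scl by (rule vs)
  have sB: "span B = V"
    using B V by (simp add: span_subspace)
  \<comment> \<open>The dual basis: coordinate functions, cut off outside \<open>V\<close> in the
    way \<open>dual_space\<close> prescribes.\<close>
  define co where "co = (\<lambda>b v. if v \<in> V then representation B v b else 0)"
  have co_basis: "co b b' = (if b = b' then 1 else 0)" if "b \<in> B" "b' \<in> B" for b b'
    using that B by (auto simp: co_def representation_basis)
  have co_dual: "co b \<in> dual_space scl V" for b
  proof -
    have "co b (u + v) = co b u + co b v" if "u \<in> V" "v \<in> V" for u v
      using that B(3) sB subspace_add[OF V] by (simp add: co_def representation_add)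
    moreover have "co b (scl c v) = c * co b v" if "v \<in> V" for c v
      using that B(3) sB subspace_scale[OF V] by (simp add: co_def representation_scale)
    ultimately show ?thesis by (simp add: dual_space_def co_def)
  qed
  have inj: "inj_on co B"
  proof
    fix x y assume "x \<in> B" "y \<in> B" "co x = co y"
    then show "x = y"
      by (metis co_basis zero_neq_one)
  qed
  have indep: "\<not> dual.dependent (co ` B)"
  proof (rule dual.independent_if_scalars_zero)
    show "finite (co ` B)" using B by simp
    fix u f assume z: "(\<Sum>f\<in>co ` B. dscale (u f) f) = 0" and f: "f \<in> co ` B"
    then obtain b where b: "b \<in> B" "f = co b" by auto
    have "0 = (\<Sum>f\<in>co ` B. dscale (u f) f) b" using z by simp
    also have "\<dots> = (\<Sum>b'\<in>B. u (co b') * co b' b)"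
      by (simp add: sum_dscale_apply sum.reindex[OF inj])
    also have "\<dots> = (\<Sum>b'\<in>B. if b' = b then u (co b') else 0)"
      by (rule sum.cong) (auto simp: co_basis b)
    also have "\<dots> = u f" using b B by simp
    finally show "u f = 0" by simp
  qed
  have span: "f \<in> dual.span (co ` B)" if f: "f \<in> dual_space scl V" for f
  proof -
    have fadd: "f (u + v) = f u + f v" if "u \<in> V" "v \<in> V" for u v
      using f that by (auto simp: dual_space_def)
    have fsc: "f (scl c v) = c * f v" if "v \<in> V" for c v
      using f that by (auto simp: dual_space_def)
    have f0: "f 0 = 0"
      using fsc[of 0 0] subspace_0[OF V] by simp
    have fsum: "f (\<Sum>b\<in>A. scl (r b) b) = (\<Sum>b\<in>A. r b * f b)" if "finite A" "A \<subseteq> V" for A r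
      using that
    proof (induction A)
      case (insert a A)
      then have "a \<in> V" "A \<subseteq> V" by auto
      moreover from this have "(\<Sum>b\<in>A. scl (r b) b) \<in> V"
        by (intro subspace_sum[OF V] subspace_scale[OF V]) auto
      ultimately show ?case
        using insert by (simp add: fadd fsc subspace_scale[OF V])
    qed (simp add: f0)
    have "f = (\<Sum>b\<in>B. dscale (f b) (co b))"
    proof
      fix v
      show "f v = (\<Sum>b\<in>B. dscale (f b) (co b)) v"
      proof (cases "v \<in> V")
        case True
        then have "v = (\<Sum>b\<in>B. scl (representation B v b) b)"
          using sum_representation_eq[OF B(3), of v B] B(1) sB by simp
        then have "f v = (\<Sum>b\<in>B. representation B v b * f b)"
          using fsum[OF B(1,2)] by metis
        then show ?thesis using True by (simp add: sum_dscale_apply co_def mult.commute)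
      next
        case False
        then show ?thesis using f by (simp add: sum_dscale_apply co_def dual_space_def)
      qed
    qed
    then show ?thesis
      by (metis (no_types, lifting) dual.span_base dual.span_scale dual.span_sum imageI)
  qed
  show ?thesis
    using B(1) inj co_dual indep span
    by (intro exI[of _ "co ` B"]) (auto simp: card_image)
qed

lemma dual_space_dim:
  assumes vs: "vector_space scl" and V: "module.subspace scl V"
    and F: "finite F" "V \<subseteq> module.span scl F"
  shows "dual.dim (dual_space scl V) = vector_space.dim scl V"
    and "\<exists>D. finite D \<and> dual_space scl V \<subseteq> dual.span D"
proof -
  interpret vector_space scl by (rule vs)
  obtain B where B: "B \<subseteq> V" "independent B" "V \<subseteq> span B" "card B = dim V"
    by (rule basis_exists)
  have "finite B"
    using B(1,2) F independent_span_bound[OF F(1)] by (meson order_trans)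
  from dual_space_basis[OF vs V this B(1-3)] obtain D where
    D: "finite D" "card D = card B" "D \<subseteq> dual_space scl V"
      "\<not> dual.dependent D" "dual_space scl V \<subseteq> dual.span D" by blast
  show "dual.dim (dual_space scl V) = dim V"
    using dual.basis_card_eq_dim[OF D(3,5,4)] D(2) B(4) by simp
  show "\<exists>D. finite D \<and> dual_space scl V \<subseteq> dual.span D"
    using D by blast
qed

section \<open>Expansions of rational functions\<close>

lemma fract_cases:
  obtains p r :: "rat poly" where "f = Fract p r" "r \<noteq> 0"
  by (cases f rule: Fract_cases) auto

lemma laurent_add: "laurent (f + g) = laurent f + laurent g"
proof -
  obtain p r where f: "f = Fract p r" "r \<noteq> 0" by (rule fract_cases)
  obtain p' r' where g: "g = Fract p' r'" "r' \<noteq> 0" by (rule fract_cases)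
  have nz: "fps_to_fls (fps_of_poly x) \<noteq> 0" if "x \<noteq> 0" for x :: "rat poly"
    using that by simp
  show ?thesis
    using f g nz[of r] nz[of r']
    by (simp add: laurent_Fract fps_of_poly_mult fps_of_poly_add fls_times_fps_to_fls field_simps)
qed

lemma laurent_mult: "laurent (f * g) = laurent f * laurent g"
proof -
  obtain p r where f: "f = Fract p r" "r \<noteq> 0" by (rule fract_cases)
  obtain p' r' where g: "g = Fract p' r'" "r' \<noteq> 0" by (rule fract_cases)
  show ?thesis
    using f g
    by (simp add: laurent_Fract fps_of_poly_mult fls_times_fps_to_fls)
qed

lemma laurent_to_fract: "laurent (to_fract p) = fps_to_fls (fps_of_poly p)"
  by (simp add: to_fract_def laurent_Fract)

lemma laurent_inverse: "laurent (inverse f) = inverse (laurent f)"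
proof (cases "f = 0")
  case True
  then show ?thesis using laurent_to_fract[of 0] by simp
next
  case False
  have "laurent f * laurent (inverse f) = 1"
    using False laurent_to_fract[of 1] by (simp flip: laurent_mult)
  then show ?thesis by (metis inverse_unique)
qed

lemma eval_inv_q_half_eq_0_iff [simp]: "eval_inv_q_half p = 0 \<longleftrightarrow> p = 0"
  using eval_inv_q_half_reflect[of p] by (auto simp: eval_inv_q_half_def)

lemma eval_inv_q_half_const: "eval_inv_q_half [:c:] = to_fract [:c:]"
  by (simp add: eval_inv_q_half_def map_poly_pCons)

lemma eval_inv_q_half_0 [simp]: "eval_inv_q_half 0 = 0"
  by simp

lemma eval_inv_q_half_1 [simp]: "eval_inv_q_half 1 = 1"
  using eval_inv_q_half_const[of 1] by (simp flip: one_pCons)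

lemma eval_inv_q_half_add: "eval_inv_q_half (p + r) = eval_inv_q_half p + eval_inv_q_half r"
proof -
  have "map_poly (\<lambda>c. to_fract [:c:]) (p + r) =
      map_poly (\<lambda>c. to_fract [:c:]) p + map_poly (\<lambda>c::rat. to_fract [:c:]) r"
    by (rule poly_eqI) (simp add: coeff_map_poly flip: to_fract_add)
  then show ?thesis by (simp add: eval_inv_q_half_def)
qed

lemma invert_q_add: "invert_q (f + g) = invert_q f + invert_q g"
proof -
  obtain p r where f: "f = Fract p r" "r \<noteq> 0" by (rule fract_cases)
  obtain p' r' where g: "g = Fract p' r'" "r' \<noteq> 0" by (rule fract_cases)
  show ?thesis
    using f g
    by (simp add: invert_q_Fract eval_inv_q_half_mult eval_inv_q_half_add add_frac_eq)
qed

lemma invert_q_mult: "invert_q (f * g) = invert_q f * invert_q g"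
proof -
  obtain p r where f: "f = Fract p r" "r \<noteq> 0" by (rule fract_cases)
  obtain p' r' where g: "g = Fract p' r'" "r' \<noteq> 0" by (rule fract_cases)
  show ?thesis
    using f g by (simp add: invert_q_Fract eval_inv_q_half_mult)
qed

lemma invert_q_to_fract: "invert_q (to_fract p) = eval_inv_q_half p"
  by (simp add: to_fract_def invert_q_Fract)

lemma invert_q_inverse: "invert_q (inverse f) = inverse (invert_q f)"
proof (cases "f = 0")
  case True
  then show ?thesis using invert_q_to_fract[of 0] by (simp del: eval_inv_q_half_eq_0_iff)
next
  case False
  have "invert_q f * invert_q (inverse f) = 1"
    using False invert_q_to_fract[of 1] by (simp flip: invert_q_mult)
  then show ?thesis by (metis inverse_unique)
qed

section \<open>Constants and powers of \<open>q_half\<close> under expansion and inversion\<close>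

definition q_const :: "rat \<Rightarrow> rat poly fract" where
  "q_const c = to_fract [:c:]"

lemma laurent_q_const: "laurent (q_const c) = fls_const c"
  by (simp add: q_const_def laurent_to_fract fps_of_poly_const)

lemma invert_q_q_const [simp]: "invert_q (q_const c) = q_const c"
  by (simp add: q_const_def invert_q_to_fract eval_inv_q_half_const)

lemma q_half_nonzero [simp]: "q_half \<noteq> 0"
  by (simp add: q_half_def)

lemma laurent_q_half: "laurent q_half = fls_X"
  by (simp add: q_half_def laurent_to_fract fps_of_poly_pCons)

lemma invert_q_q_half [simp]: "invert_q q_half = inverse q_half"
proof -
  have "invert_q q_half = eval_inv_q_half [:0, 1:]"
    by (simp add: q_half_def invert_q_to_fract)
  also have "\<dots> = inverse q_half"
    by (simp add: eval_inv_q_half_def map_poly_pCons flip: one_pCons)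
  finally show ?thesis .
qed

lemma laurent_1 [simp]: "laurent 1 = 1"
  using laurent_to_fract[of 1] by simp

lemma laurent_0 [simp]: "laurent 0 = 0"
  using laurent_to_fract[of 0] by simp

lemma invert_q_1 [simp]: "invert_q 1 = 1"
  using invert_q_to_fract[of 1] by simp

lemma invert_q_0 [simp]: "invert_q 0 = 0"
  using invert_q_to_fract[of 0] by (simp del: eval_inv_q_half_eq_0_iff)

lemma laurent_power: "laurent (f ^ n) = laurent f ^ n"
  by (induction n) (simp_all add: laurent_mult)

lemma invert_q_power: "invert_q (f ^ n) = invert_q f ^ n"
  by (induction n) (simp_all add: invert_q_mult)

lemma laurent_powi: "laurent (f powi n) = laurent f powi n"
  by (simp add: power_int_def laurent_power laurent_inverse)

lemma invert_q_powi: "invert_q (f powi n) = invert_q f powi n"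
  by (simp add: power_int_def invert_q_power invert_q_inverse)

text \<open>The relation of the theorem in one fixed degree: \<open>e\<close> is the expansion of
  \<open>F(q)\<close> and \<open>g\<close> that of \<open>- F(1/q)\<close>, both indexed by powers
  of the square root of \<open>q\<close>. It is linear in \<open>F\<close>, so monomials and
  geometric series suffice.\<close>

definition q_pair :: "rat poly fract \<Rightarrow> (int \<Rightarrow> rat) \<Rightarrow> (int \<Rightarrow> rat) \<Rightarrow> bool" where
  "q_pair F e g \<longleftrightarrow>
     e = fls_nth (laurent F) \<and> g = fls_nth (laurent (- invert_q F))"

lemma laurent_minus: "laurent (- f) = - laurent f"
  using laurent_add[of f "- f"] by (simp add: eq_neg_iff_add_eq_0 add.commute)

lemma laurent_diff: "laurent (f - g) = laurent f - laurent g"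
  using laurent_add[of f "- g"] by (simp add: laurent_minus)

lemma q_pair_0: "q_pair 0 (\<lambda>_. 0) (\<lambda>_. 0)"
  by (simp add: q_pair_def fun_eq_iff)

lemma q_pair_add:
  "q_pair F e g \<Longrightarrow> q_pair F' e' g' \<Longrightarrow> q_pair (F + F') (\<lambda>n. e n + e' n) (\<lambda>n. g n + g' n)"
  by (simp add: q_pair_def fun_eq_iff laurent_add laurent_diff laurent_minus invert_q_add)

lemma q_pair_scale:
  "q_pair F e g \<Longrightarrow> q_pair (q_const c * F) (\<lambda>n. c * e n) (\<lambda>n. c * g n)"
  by (simp add: q_pair_def fun_eq_iff laurent_mult laurent_minus invert_q_mult laurent_q_const)

lemma q_pair_sum:
  assumes "\<And>i. i \<in> A \<Longrightarrow> q_pair (F i) (e i) (g i)" "finite A"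
  shows "q_pair (\<Sum>i\<in>A. F i) (\<lambda>n. \<Sum>i\<in>A. e i n) (\<lambda>n. \<Sum>i\<in>A. g i n)"
  using assms(2,1) by (induction A) (auto simp: q_pair_0 intro!: q_pair_add)

lemma fls_X_powi: "(fls_X :: rat fls) powi n = fls_X_intpow n"
  by (simp add: power_int_def fls_X_power_conv_shift_1 fls_inverse_X fls_X_inv_power_conv_shift_1)

lemma q_pair_monomial:
  "q_pair (q_half powi m) (\<lambda>n. if n = m then 1 else 0) (\<lambda>n. if n = - m then - 1 else 0)"
  unfolding q_pair_def
  by (simp add: fun_eq_iff laurent_powi laurent_minus invert_q_powi laurent_q_half laurent_inverse
      fls_X_powi power_int_inverse flip: power_int_minus)

lemma fls_nth_geometric:
  "fls_nth (inverse (1 - fls_X ^ 2) :: rat fls) n = (if n \<ge> 0 \<and> even n then 1 else 0)"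
proof -
  define E :: "rat fps" where "E = Abs_fps (\<lambda>n. if even n then 1 else 0)"
  have "(1 - fps_X ^ 2) * E = 1"
  proof (rule fps_ext)
    fix n :: nat
    have "n = 0 \<or> n = 1 \<or> n \<ge> 2" by linarith
    then show "((1 - fps_X ^ 2) * E) $ n = 1 $ n"
      by (elim disjE) (simp_all add: E_def left_diff_distrib fps_X_power_mult_nth)
  qed
  then have "fps_to_fls (1 - fps_X ^ 2) * fps_to_fls E = 1"
    by (metis fls_times_fps_to_fls fps_one_to_fls)
  moreover have "fps_to_fls (1 - fps_X ^ 2) = (1 - fls_X ^ 2 :: rat fls)"
    by (simp add: fps_to_fls_power)
  ultimately have "(1 - fls_X ^ 2) * fps_to_fls E = 1"
    by simp
  then have "inverse (1 - fls_X ^ 2) = fps_to_fls E"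
    by (metis inverse_unique)
  then show ?thesis
    by (auto simp: E_def even_nat_iff)
qed

text \<open>The series runs over one parity class because \<open>q\<close> is
  \<open>q_half ^ 2\<close>. The bound \<open>2 - m\<close>, rather than \<open>- m\<close>, comes
  from \<open>- 1 / (1 - 1/q) = q / (1 - q)\<close>.\<close>

lemma q_pair_geometric:
  "q_pair (q_half powi m * inverse (1 - q_half ^ 2))
     (\<lambda>n. if n \<ge> m \<and> even (n - m) then 1 else 0)
     (\<lambda>n. if n \<ge> 2 - m \<and> even (n - m) then 1 else 0)"
proof -
  have lm: "laurent (1 - f) = 1 - laurent f" for f
    using laurent_add[of 1 "- f"] by (simp add: laurent_minus)
  have im: "invert_q (1 - f) = 1 - invert_q f" for f
    using invert_q_add[of "1 - f" f] by (simp add: algebra_simps)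
  have nz: "1 - q_half ^ 2 \<noteq> 0"
  proof
    assume "1 - q_half ^ 2 = 0"
    then have "laurent (1 - q_half ^ 2) = 0" by simp
    then have "inverse (1 - fls_X ^ 2 :: rat fls) = 0"
      by (simp add: lm laurent_power laurent_q_half)
    then show False using fls_nth_geometric[of 0] by simp
  qed
  have sh: "fls_nth (fls_X_intpow m * f) n = fls_nth f (n - m)" for m n and f :: "rat fls"
    by (simp add: fls_X_intpow_times_conv_shift)
  have "- invert_q (q_half powi m * inverse (1 - q_half ^ 2))
      = - (q_half powi (- m) * inverse (1 - inverse q_half ^ 2))"
    by (simp add: invert_q_mult invert_q_powi invert_q_inverse im invert_q_power power_int_inverse power_int_minus)
  also have "\<dots> = q_half powi (2 - m) * inverse (1 - q_half ^ 2)"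
  proof -
    have "1 - inverse q_half ^ 2 = - (1 - q_half ^ 2) / q_half ^ 2"
      by (simp add: field_simps)
    moreover have "q_half powi (2 - m) = q_half ^ 2 * q_half powi (- m)"
      using power_int_add[of q_half 2 "- m"] by simp
    ultimately show ?thesis
      using nz by (simp add: field_simps)
  qed
  finally have inv: "- invert_q (q_half powi m * inverse (1 - q_half ^ 2))
      = q_half powi (2 - m) * inverse (1 - q_half ^ 2)" .
  have la: "laurent (q_half powi m * inverse (1 - q_half ^ 2)) =
      fls_X_intpow m * inverse (1 - fls_X ^ 2)" for m
    by (simp add: laurent_mult laurent_powi laurent_q_half laurent_inverse lm laurent_power fls_X_powi)
  show ?thesis
    unfolding q_pair_def inv la fun_eq_iff sh fls_nth_geometric by auto
qed

lemma periodic_parity: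
  fixes h :: "int \<Rightarrow> 'b"
  assumes "\<And>n. h (n + 2) = h n" "even (m - n)"
  shows "h m = h n"
proof -
  have nat: "h (n + 2 * int k) = h n" for k n
    by (induction k) (use assms(1) in \<open>auto simp: algebra_simps\<close>, metis add.commute add.assoc)
  obtain k where k: "m - n = 2 * k" using assms(2) by (rule evenE)
  show ?thesis
  proof (cases "k \<ge> 0")
    case True
    then show ?thesis using nat[of n "nat k"] k by (simp add: algebra_simps)
  next
    case False
    then show ?thesis using nat[of m "nat (- k)"] k by (simp add: algebra_simps)
  qed
qed

text \<open>A sequence that vanishes far to the left and is eventually periodic expands a rational
  function. Inverting \<open>q\<close> yields what \<open>e\<close> lacks from the two-sided
  periodic sequence \<open>h\<close>, read backwards.\<close>

lemma q_pair_exists: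
  fixes e h :: "int \<Rightarrow> rat"
  assumes low: "\<And>n. n < A \<Longrightarrow> e n = 0" and high: "\<And>n. n \<ge> B \<Longrightarrow> e n = h n"
    and per: "\<And>n. h (n + 2) = h n"
  shows "\<exists>F. q_pair F e (\<lambda>n. h (- n) - e (- n))"
proof -
  \<comment> \<open>The terms below \<open>B\<close> are taken one by one; from there on
    \<open>e\<close> is periodic with period 2, so one geometric series for each parity, starting at
    \<open>B\<close> and at \<open>B + 1\<close>, gives the rest.\<close>
  define F where "F = (\<Sum>m\<in>{A..<B}. q_const (e m) * q_half powi m)
     + (q_const (h B) * (q_half powi B * inverse (1 - q_half ^ 2))
       + q_const (h (B + 1)) * (q_half powi (B + 1) * inverse (1 - q_half ^ 2)))"
  define e' where "e' = (\<lambda>n. (\<Sum>m\<in>{A..<B}. e m * (if n = m then 1 else 0))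
     + (h B * (if n \<ge> B \<and> even (n - B) then 1 else 0)
       + h (B + 1) * (if n \<ge> B + 1 \<and> even (n - (B + 1)) then 1 else 0)))"
  define g' where "g' = (\<lambda>n. (\<Sum>m\<in>{A..<B}. e m * (if n = - m then - 1 else 0))
     + (h B * (if n \<ge> 2 - B \<and> even (n - B) then 1 else 0)
       + h (B + 1) * (if n \<ge> 2 - (B + 1) \<and> even (n - (B + 1)) then 1 else 0)))"
  have "q_pair F e' g'"
    unfolding F_def e'_def g'_def
    by (intro q_pair_add q_pair_sum q_pair_scale q_pair_monomial q_pair_geometric) auto
  moreover have "e' = e"
  proof
    fix n
    have "(\<Sum>m\<in>{A..<B}. e m * (if n = m then 1 else 0)) = (\<Sum>m\<in>{A..<B}. if n = m then e n else 0)"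
      by (rule sum.cong) auto
    also have "\<dots> = (if n < B then e n else 0)"
      using low[of n] by auto
    finally have 1: "(\<Sum>m\<in>{A..<B}. e m * (if n = m then 1 else 0)) = (if n < B then e n else 0)" .
    show "e' n = e n"
    proof (cases "n < B")
      case True
      then show ?thesis unfolding e'_def 1 by simp
    next
      case False
      then have "n = B \<or> n \<ge> B + 1" by linarith
      then show ?thesis
        unfolding e'_def 1
        using high[of n] periodic_parity[of h, OF per, of n B]
          periodic_parity[of h, OF per, of n "B + 1"]
        by (cases "even (n - B)") auto
    qed
  qed
  moreover have "g' = (\<lambda>n. h (- n) - e (- n))"
  proof
    fix n
    have "(\<Sum>m\<in>{A..<B}. e m * (if n = - m then - 1 else 0)) = (\<Sum>m\<in>{A..<B}. if - n = m then - e (- n) else 0)"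
      by (rule sum.cong) auto
    also have "\<dots> = (if - n < B then - e (- n) else 0)"
      using low[of "- n"] by auto
    finally have 1: "(\<Sum>m\<in>{A..<B}. e m * (if n = - m then - 1 else 0)) = (if - n < B then - e (- n) else 0)" .
    show "g' n = h (- n) - e (- n)"
    proof (cases "even (n - B)")
      case True
      then have "h (- n) = h B" by (intro periodic_parity[of h, OF per]) auto
      \<comment> \<open>In the parity class of \<open>B\<close> the value \<open>- n = B - 1\<close>
        does not occur, so the two bounds agree.\<close>
      moreover have "n \<ge> 2 - B \<longleftrightarrow> - n < B"
        using True by presburger
      ultimately show ?thesis
        unfolding g'_def 1 using True high[of "- n"] by (auto simp: not_less)
    next
      case False
      then have "h (- n) = h (B + 1)" by (intro periodic_parity[of h, OF per]) auto
      then show ?thesis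
        unfolding g'_def 1 using False high[of "- n"] by (auto simp: not_less)
    qed
  qed
  ultimately show ?thesis by auto
qed

section \<open>Linear maps of the free algebra\<close>

interpretation fpair: vector_space_pair
  "fscale :: rat \<Rightarrow> ('x \<Rightarrow>\<^sub>0 rat) \<Rightarrow> ('x \<Rightarrow>\<^sub>0 rat)"
  "fscale :: rat \<Rightarrow> ('y \<Rightarrow>\<^sub>0 rat) \<Rightarrow> ('y \<Rightarrow>\<^sub>0 rat)" ..

abbreviation flinear :: "(('x \<Rightarrow>\<^sub>0 rat) \<Rightarrow> ('y \<Rightarrow>\<^sub>0 rat)) \<Rightarrow> bool" where
  "flinear \<equiv> Vector_Spaces.linear fscale fscale"

lemma flinearI:
  assumes "\<And>f g. F (f + g) = F f + F g" "\<And>c f. F (fscale c f) = fscale c (F f)"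
  shows "flinear F"
  using assms by unfold_locales (simp_all add: algebra_simps)

lemmas flinear_simps = fpair.linear_add fpair.linear_scale fpair.linear_0 fpair.linear_diff
  fpair.linear_neg fpair.linear_sum

definition fextend :: "('x \<Rightarrow> 'y \<Rightarrow>\<^sub>0 rat) \<Rightarrow> ('x \<Rightarrow>\<^sub>0 rat) \<Rightarrow> ('y \<Rightarrow>\<^sub>0 rat)" where
  "fextend h f = (\<Sum>x\<in>Poly_Mapping.keys f. fscale (Poly_Mapping.lookup f x) (h x))"

lemma fextend_superset:
  assumes "finite A" "Poly_Mapping.keys f \<subseteq> A"
  shows "fextend h f = (\<Sum>x\<in>A. fscale (Poly_Mapping.lookup f x) (h x))"
  unfolding fextend_def
  by (rule sum.mono_neutral_left) (use assms in \<open>auto simp: in_keys_iff\<close>)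

lemma flinear_fextend: "flinear (fextend h)"
proof (rule flinearI)
  fix f g :: "'a \<Rightarrow>\<^sub>0 rat"
  let ?A = "Poly_Mapping.keys f \<union> Poly_Mapping.keys g"
  have "fextend h (f + g) = (\<Sum>x\<in>?A. fscale (Poly_Mapping.lookup (f + g) x) (h x))"
    by (rule fextend_superset) (auto simp: keys_add)
  moreover have "fextend h f = (\<Sum>x\<in>?A. fscale (Poly_Mapping.lookup f x) (h x))"
    "fextend h g = (\<Sum>x\<in>?A. fscale (Poly_Mapping.lookup g x) (h x))"
    by (rule fextend_superset; simp)+
  ultimately show "fextend h (f + g) = fextend h f + fextend h g"
    by (simp add: lookup_add free.scale_left_distrib sum.distrib)
next
  fix c and f :: "'a \<Rightarrow>\<^sub>0 rat"
  have "fextend h (fscale c f)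
      = (\<Sum>x\<in>Poly_Mapping.keys f. fscale (Poly_Mapping.lookup (fscale c f) x) (h x))"
    by (rule fextend_superset) (auto simp: in_keys_iff)
  then show "fextend h (fscale c f) = fscale c (fextend h f)"
    by (simp add: fextend_def free.scale_sum_right)
qed

lemma fextend_fbasis [simp]: "fextend h (fbasis x) = h x"
  by (simp add: fextend_def fbasis_def)

lemma fextend_fbasis_id: "fextend fbasis f = f"
proof (rule poly_mapping_eqI)
  fix x
  have "Poly_Mapping.lookup (\<Sum>y\<in>A. fscale (Poly_Mapping.lookup f y) (fbasis y)) x =
      (\<Sum>y\<in>A. if y = x then Poly_Mapping.lookup f y else 0)" for A
    by (induction A rule: infinite_finite_induct)
      (auto simp: lookup_add fbasis_def lookup_single when_def)
  then show "Poly_Mapping.lookup (fextend fbasis f) x = Poly_Mapping.lookup f x"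
    by (simp add: fextend_def in_keys_iff)
qed

lemma span_range_fbasis: "free.span (range fbasis) = UNIV"
proof -
  have "f \<in> free.span (range fbasis)" for f :: "'a \<Rightarrow>\<^sub>0 rat"
  proof -
    have "fextend fbasis f \<in> free.span (range fbasis)"
      unfolding fextend_def by (intro free.span_sum free.span_scale free.span_base) simp
    then show ?thesis by (simp only: fextend_fbasis_id)
  qed
  then show ?thesis by auto
qed

lemma flinear_eqI:
  assumes "flinear F" "flinear G" "\<And>x. F (fbasis x) = G (fbasis x)"
  shows "F = G"
proof
  fix f
  show "F f = G f"
    by (rule fpair.linear_eq_on[OF assms(1,2), of _ "range fbasis"])
      (use assms(3) in \<open>auto simp: span_range_fbasis\<close>)
qed

text \<open>As an iterated linear extension the product is visibly bilinear and determined by its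
  values on monomials.\<close>

lemma fmult_eq: "fmult f g = fextend (\<lambda>s. fextend (\<lambda>t. fbasis (Br s t)) g) f"
proof -
  have "fscale a (fscale b (fbasis x)) = Poly_Mapping.single x (a * b)" for a b and x :: "'a magma"
    by (rule poly_mapping_eqI) (simp add: fbasis_def lookup_single when_def)
  then show ?thesis
    by (simp add: fmult_def fextend_def free.scale_sum_right)
qed

lemma flinear_fmult_left: "flinear (\<lambda>f. fmult f g)"
  unfolding fmult_eq by (rule flinear_fextend)

lemma flinear_fmult_right: "flinear (fmult f)"
proof (rule flinearI)
  note L = flinear_fextend
  show "fmult f (g + g') = fmult f g + fmult f g'" for g g'
    unfolding fmult_eq fextend_def[of _ f]
    by (simp add: fpair.linear_add[OF L] free.scale_right_distrib sum.distrib)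
  show "fmult f (fscale c g) = fscale c (fmult f g)" for c g
    unfolding fmult_eq fextend_def[of _ f]
    by (simp add: fpair.linear_scale[OF L] free.scale_sum_right mult.commute)
qed

lemma fmult_fbasis [simp]: "fmult (fbasis s) (fbasis t) = fbasis (Br s t)"
  by (simp add: fmult_eq)

lemma fbilinear_eqI:
  assumes "\<And>g. flinear (\<lambda>f. F f g)" "\<And>f. flinear (F f)"
    and "\<And>g. flinear (\<lambda>f. G f g)" "\<And>f. flinear (G f)"
    and "\<And>x y. F (fbasis x) (fbasis y) = G (fbasis x) (fbasis y)"
  shows "F f g = G f g"
proof -
  have "F (fbasis x) = G (fbasis x)" for x
    by (rule flinear_eqI) (use assms in auto)
  then have "(\<lambda>f. F f g) = (\<lambda>f. G f g)"
    by (intro flinear_eqI) (use assms in auto)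
  then show ?thesis by metis
qed

lemma flinear_compose: "flinear F \<Longrightarrow> flinear G \<Longrightarrow> flinear (\<lambda>f. F (G f))"
  by (intro flinearI) (simp_all add: fpair.linear_add fpair.linear_scale)

lemma flinear_plus: "flinear F \<Longrightarrow> flinear G \<Longrightarrow> flinear (\<lambda>f. F f + G f)"
  by (intro flinearI) (simp_all add: fpair.linear_add fpair.linear_scale algebra_simps)

lemma flinear_id: "flinear (\<lambda>f. f)"
  by (intro flinearI) simp_all

section \<open>The quotient\<close>

lemma words_Br [simp]: "Br s t \<in> words Q \<longleftrightarrow> s \<in> words Q \<and> t \<in> words Q"
  by (auto simp: words_def)

lemma words_Gen [simp]: "Gen x \<in> words Q \<longleftrightarrow> fst x \<in> verts Q"
  by (auto simp: words_def)

lemma free_alg_fbasis: "t \<in> words Q \<Longrightarrow> fbasis t \<in> free_alg Q"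
  by (simp add: free_alg_def free.span_base)

lemma subspace_free_alg: "free.subspace (free_alg Q)"
  by (simp add: free_alg_def)

lemma free_alg_induct [consumes 1, case_names base zero add scale]:
  assumes "f \<in> free_alg Q" "\<And>t. t \<in> words Q \<Longrightarrow> P (fbasis t)" "P 0"
    "\<And>f g. P f \<Longrightarrow> P g \<Longrightarrow> P (f + g)" "\<And>c f. P f \<Longrightarrow> P (fscale c f)"
  shows "P f"
  using assms(1) unfolding free_alg_def
proof (induction rule: free.span_induct)
  case base
  then show ?case
    using assms(3-5) by (auto simp: free.subspace_def)
qed (use assms(2) in auto)

lemma fmult_free_alg: "f \<in> free_alg Q \<Longrightarrow> g \<in> free_alg Q \<Longrightarrow> fmult f g \<in> free_alg Q"
proof (induction f rule: free_alg_induct)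
  case (base s)
  from base(2) show ?case
  proof (induction g rule: free_alg_induct)
    case (base t)
    then show ?case using \<open>s \<in> words Q\<close> by (simp add: free_alg_fbasis)
  qed (simp_all add: flinear_simps[OF flinear_fmult_right] free.subspace_0 free.subspace_add
      free.subspace_scale subspace_free_alg)
qed (simp_all add: flinear_simps[OF flinear_fmult_left] free.subspace_0 free.subspace_add
      free.subspace_scale subspace_free_alg)

lemma lie_ideal_free_alg: "f \<in> lie_ideal Q \<Longrightarrow> f \<in> free_alg Q"
proof (induction rule: lie_ideal.induct)
  case (locality i j m)
  then show ?case
    by (intro free.subspace_sum free.subspace_scale subspace_free_alg free_alg_fbasis) auto
qed (auto intro!: free.subspace_add free.subspace_diff free.subspace_scale free.subspace_0
    subspace_free_alg fmult_free_alg free_alg_fbasis)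

lemma
  shows flinear_quotient_map: "flinear (quotient_map Q)"
    and quotient_map_idem [simp]: "quotient_map Q (quotient_map Q f) = quotient_map Q f"
    and quotient_map_eq_0_iff: "quotient_map Q f = 0 \<longleftrightarrow> f \<in> lie_ideal Q"
  using is_quotient_map_quotient_map[of Q] unfolding is_quotient_map_def
  by (auto simp: fun_eq_iff)

lemma quotient_map_eq_iff: "quotient_map Q f = quotient_map Q g \<longleftrightarrow> f - g \<in> lie_ideal Q"
  using quotient_map_eq_0_iff[of Q "f - g"] by (simp add: flinear_simps[OF flinear_quotient_map])

lemma diff_quotient_map: "f - quotient_map Q f \<in> lie_ideal Q" "quotient_map Q f - f \<in> lie_ideal Q"
  by (simp_all flip: quotient_map_eq_iff)

text \<open>The complement behind \<open>quotient_map\<close> was chosen in the algebra on all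
  symbols of the type, not only those of vertices. Still, projecting changes an element by a member
  of the ideal, and the ideal lies in \<open>free_alg Q\<close>.\<close>

lemma quotient_map_free_alg: "f \<in> free_alg Q \<Longrightarrow> quotient_map Q f \<in> free_alg Q"
  using free.subspace_add[OF subspace_free_alg _ lie_ideal_free_alg[OF diff_quotient_map(2)], of f Q f]
  by simp

lemma quotient_map_descend:
  assumes "flinear F" "\<And>f. f \<in> lie_ideal Q \<Longrightarrow> F f \<in> lie_ideal Q"
  shows "quotient_map Q (F (quotient_map Q f)) = quotient_map Q (F f)"
  unfolding quotient_map_eq_iff using assms(2)[OF diff_quotient_map(2)]
  by (simp add: fpair.linear_diff[OF assms(1)])

section \<open>The bracket and the homogeneous pieces of the quotient\<close>

lemma bracket_quotient_map:
  assumes "f \<in> free_alg Q" "g \<in> free_alg Q"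
  shows "bracket Q (quotient_map Q f) (quotient_map Q g) = quotient_map Q (fmult f g)"
proof -
  have "quotient_map Q (fmult (quotient_map Q f) (quotient_map Q g)) =
      quotient_map Q (fmult f (quotient_map Q g))"
    unfolding quotient_map_eq_iff
    using lie_ideal.mult_right[OF diff_quotient_map(2) quotient_map_free_alg[OF assms(2)], of f]
    by (simp add: fpair.linear_diff[OF flinear_fmult_left])
  also have "\<dots> = quotient_map Q (fmult f g)"
    unfolding quotient_map_eq_iff
    using lie_ideal.mult_left[OF diff_quotient_map(2) assms(1), of g]
    by (simp add: fpair.linear_diff[OF flinear_fmult_right])
  finally show ?thesis by (simp add: bracket_def)
qed

lemma flinear_bracket_left: "flinear (\<lambda>a. bracket Q a b)"
  unfolding bracket_def by (rule flinear_compose[OF flinear_quotient_map flinear_fmult_left])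

lemma flinear_bracket_right: "flinear (bracket Q a)"
  unfolding bracket_def by (rule flinear_compose[OF flinear_quotient_map flinear_fmult_right])

lemmas bracket_left_simps = flinear_simps[OF flinear_bracket_left]
lemmas bracket_right_simps = flinear_simps[OF flinear_bracket_right]

text \<open>Serves at once for the whole Lie algebra (\<open>S = UNIV\<close>), for the part of a
  given degree, and for the part of a given degree and weight.\<close>

definition piece :: "('i, 'a) pre_digraph \<Rightarrow> 'i word set \<Rightarrow> 'i free set" where
  "piece Q S = quotient_map Q ` free.span (fbasis ` (S \<inter> words Q))"

lemma piece_eq: "piece Q S = free.span ((\<lambda>t. quotient_map Q (fbasis t)) ` (S \<inter> words Q))"
  using fpair.linear_span_image[OF flinear_quotient_map, of Q "fbasis ` (S \<inter> words Q)"]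
  by (simp add: piece_def image_image)

lemma subspace_piece: "free.subspace (piece Q S)"
  by (simp add: piece_eq)

lemma piece_induct [consumes 1, case_names base zero add scale]:
  assumes "x \<in> piece Q S" "\<And>t. t \<in> S \<Longrightarrow> t \<in> words Q \<Longrightarrow> P (quotient_map Q (fbasis t))" "P 0"
    "\<And>x y. P x \<Longrightarrow> P y \<Longrightarrow> P (x + y)" "\<And>c x. P x \<Longrightarrow> P (fscale c x)"
  shows "P x"
  using assms(1) unfolding piece_eq
proof (induction rule: free.span_induct)
  case base
  then show ?case
    using assms(3-5) by (auto simp: free.subspace_def)
qed (use assms(2) in auto)

lemma piece_base: "t \<in> S \<Longrightarrow> t \<in> words Q \<Longrightarrow> quotient_map Q (fbasis t) \<in> piece Q S"
  unfolding piece_eq by (rule free.span_base) auto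

lemma piece_mono: "S \<subseteq> S' \<Longrightarrow> piece Q S \<subseteq> piece Q S'"
  unfolding piece_eq by (rule free.span_mono) auto

lemma Lie_eq_piece: "Lie Q = piece Q UNIV"
  by (simp add: Lie_def piece_def free_alg_def)

lemma bracket_fbasis:
  "s \<in> words Q \<Longrightarrow> t \<in> words Q \<Longrightarrow>
    bracket Q (quotient_map Q (fbasis s)) (quotient_map Q (fbasis t)) = quotient_map Q (fbasis (Br s t))"
  by (simp add: bracket_quotient_map free_alg_fbasis)

lemma bracket_piece:
  assumes "x \<in> piece Q S" "y \<in> piece Q S'" "\<And>s t. s \<in> S \<Longrightarrow> t \<in> S' \<Longrightarrow> Br s t \<in> S''"
  shows "bracket Q x y \<in> piece Q S''"
  using assms(1)
proof (induction rule: piece_induct)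
  case (base s)
  from assms(2) show ?case
  proof (induction rule: piece_induct)
    case (base t)
    then show ?case using \<open>s \<in> words Q\<close> \<open>s \<in> S\<close> assms(3)
      by (simp add: bracket_fbasis piece_base)
  qed (simp_all add: bracket_right_simps free.subspace_0 free.subspace_add
      free.subspace_scale subspace_piece)
qed (simp_all add: bracket_left_simps free.subspace_0 free.subspace_add
      free.subspace_scale subspace_piece)

lemma bracket_jacobi:
  assumes "x \<in> piece Q {t. ldeg t = d}" "y \<in> piece Q {t. ldeg t = e}" "z \<in> Lie Q"
  shows "bracket Q x (bracket Q y z) =
    bracket Q (bracket Q x y) z + fscale (euler_sign Q d e) (bracket Q y (bracket Q x z))"
  using assms(1)
proof (induction rule: piece_induct)
  case (base s)
  note s = this
  from assms(2) show ?case
  proof (induction rule: piece_induct)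
    case (base t)
    note t = this
    from assms(3) show ?case
      unfolding Lie_eq_piece
    proof (induction rule: piece_induct)
      case (base u)
      have "quotient_map Q (fbasis (Br s (Br t u)) - fbasis (Br (Br s t) u)
          - fscale (euler_sign Q (ldeg s) (ldeg t)) (fbasis (Br t (Br s u)))) = 0"
        unfolding quotient_map_eq_0_iff using s t base by (intro lie_ideal.jacobi) auto
      then show ?case
        using s t base
        by (simp add: bracket_fbasis flinear_simps[OF flinear_quotient_map] algebra_simps)
    qed (simp_all add: bracket_right_simps algebra_simps)
  qed (simp_all add: bracket_right_simps bracket_left_simps algebra_simps)
qed (simp_all add: bracket_right_simps bracket_left_simps algebra_simps)

section \<open>Formal distributions and Dong's lemma\<close>

abbreviation wz :: "(int \<Rightarrow> int \<Rightarrow> 'b::ab_group_add) \<Rightarrow> int \<Rightarrow> int \<Rightarrow> 'b" where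
  "wz \<equiv> fd_mult_w_minus_z"

lemma wz_pow_Suc: "(wz ^^ Suc n) D p q = (wz ^^ n) D (p - 1) q - (wz ^^ n) D p (q - 1)"
  by (simp add: fd_mult_w_minus_z_def)

lemma funpow_commute:
  assumes "\<And>x. f (g x) = g (f x)"
  shows "(f ^^ n) ((g ^^ m) x) = (g ^^ m) ((f ^^ n) x)"
proof -
  have 1: "f ((g ^^ m) x) = (g ^^ m) (f x)" for m x
    by (induction m) (simp_all add: assms)
  show ?thesis by (induction n) (simp_all add: 1)
qed

text \<open>Each factor \<open>w - z\<close> lowers one of the two exponents by 1, so only the
  coefficients named in the second hypothesis enter. \<open>U\<close> need only be closed under
  differences.\<close>

lemma wz_pow_mem:
  assumes "\<And>x y. x \<in> U \<Longrightarrow> y \<in> U \<Longrightarrow> x - y \<in> U"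
    and "\<And>r s. r \<le> p \<Longrightarrow> s \<le> q \<Longrightarrow> r + s = p + q - int n \<Longrightarrow> D r s \<in> U"
  shows "(wz ^^ n) D p q \<in> U"
  using assms(2)
proof (induction n arbitrary: p q)
  case (Suc n)
  show ?case
    unfolding wz_pow_Suc by (intro assms(1) Suc.IH Suc.prems) auto
qed simp

lemma wz_pow_additive:
  assumes "\<And>x y. F (x - y) = F x - F y"
  shows "(wz ^^ n) (\<lambda>p q. F (D p q)) p q = F ((wz ^^ n) D p q)"
  by (induction n arbitrary: p q) (simp_all add: wz_pow_Suc assms del: funpow.simps(2))

lemma wz_pow_add: "(wz ^^ n) (\<lambda>p q. D p q + E p q) p q = (wz ^^ n) D p q + (wz ^^ n) E p q"
  by (induction n arbitrary: p q) (simp_all add: wz_pow_Suc del: funpow.simps(2))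

lemma wz_pow_shift: "(wz ^^ n) (\<lambda>p q. D (p + a) (q + b)) p q = (wz ^^ n) D (p + a) (q + b)"
proof (induction n arbitrary: p q)
  case (Suc n)
  show ?case
    unfolding wz_pow_Suc Suc.IH by (simp add: algebra_simps)
qed simp

lemma wz_pow_0: "(wz ^^ n) (\<lambda>p q. 0) p q = 0"
  by (induction n arbitrary: p q) (simp_all add: wz_pow_Suc del: funpow.simps(2))

lemma wz_pow_expand:
  fixes D :: "int \<Rightarrow> int \<Rightarrow> ('x \<Rightarrow>\<^sub>0 rat)"
  shows "(wz ^^ n) D p q =
    (\<Sum>k = 0..n. fscale ((- 1) ^ k * of_nat (n choose k)) (D (p - int n + int k) (q - int k)))"
proof (induction n arbitrary: p q)
  case (Suc n)
  let ?c = "\<lambda>n k. (- 1) ^ k * of_nat (n choose k) :: rat"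
  have pascal: "?c (Suc n) (Suc k) = ?c n (Suc k) - ?c n k" for k
    by (simp add: algebra_simps)
  let ?d = "\<lambda>k. D (p - 1 - int n + int k) (q - int k)"
  have "(\<Sum>k = 0..Suc n. fscale (?c (Suc n) k) (?d k)) =
      ?d 0 + (\<Sum>k = 0..n. fscale (?c (Suc n) (Suc k)) (?d (Suc k)))"
    by (subst sum.atLeast0_atMost_Suc_shift) simp
  also have "(\<Sum>k = 0..n. fscale (?c (Suc n) (Suc k)) (?d (Suc k))) =
      (\<Sum>k = 0..n. fscale (?c n (Suc k)) (?d (Suc k))) - (\<Sum>k = 0..n. fscale (?c n k) (?d (Suc k)))"
    by (simp only: pascal free.scale_left_diff_distrib sum_subtractf)
  also have "?d 0 + ((\<Sum>k = 0..n. fscale (?c n (Suc k)) (?d (Suc k)))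
        - (\<Sum>k = 0..n. fscale (?c n k) (?d (Suc k)))) =
      (\<Sum>k = 0..Suc n. fscale (?c n k) (?d k)) - (\<Sum>k = 0..n. fscale (?c n k) (?d (Suc k)))"
    using sum.atLeast0_atMost_Suc_shift[of "\<lambda>k. fscale (?c n k) (?d k)" n]
    by (simp del: sum.atLeast0_atMost_Suc)
  also have "(\<Sum>k = 0..Suc n. fscale (?c n k) (?d k)) = (\<Sum>k = 0..n. fscale (?c n k) (?d k))"
    by simp
  finally have "(\<Sum>k = 0..Suc n. fscale (?c (Suc n) k) (?d k)) =
      (\<Sum>k = 0..n. fscale (?c n k) (?d k)) - (\<Sum>k = 0..n. fscale (?c n k) (?d (Suc k)))" .
  then show ?case
    unfolding wz_pow_Suc Suc.IH by (simp add: algebra_simps)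
qed simp

section \<open>Locality\<close>

definition fd_local :: "(int \<Rightarrow> int \<Rightarrow> 'b::ab_group_add) \<Rightarrow> bool" where
  "fd_local D \<longleftrightarrow> (\<exists>N. \<forall>p q. (wz ^^ N) D p q = 0)"

lemma wz_pow_vanish_mono:
  assumes "\<And>p q. (wz ^^ N) D p q = 0" "N \<le> n"
  shows "(wz ^^ n) D p q = 0"
  using assms(2)
  by (induction n arbitrary: p q rule: dec_induct)
    (use assms(1) in \<open>simp_all add: wz_pow_Suc del: funpow.simps(2)\<close>)

text \<open>A local distribution is a combination of derivatives of the delta function; only the span
  of the coefficients matters here.\<close>

lemma local_coeff_span:
  fixes D :: "int \<Rightarrow> int \<Rightarrow> ('x \<Rightarrow>\<^sub>0 rat)"
  assumes "\<And>p q. (wz ^^ N) D p q = 0"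
  shows "D p q \<in> free.span {(wz ^^ k) D (- 1) (p + q + int k + 1) | k. k < N}"
  using assms
proof (induction N arbitrary: D p q)
  case 0
  then show ?case using free.span_zero by auto
next
  case (Suc N)
  define S where "S = free.span {(wz ^^ k) D (- 1) (p + q + int k + 1) | k. k < Suc N}"
  \<comment> \<open>The induction hypothesis applies to \<open>(w - z) D\<close>, which is killed by
    one power less; its coefficients of total exponent \<open>p + q + 1\<close> involve coefficients
    of \<open>D\<close> of total exponent \<open>p + q + 1 - 1\<close>.\<close>
  have step: "wz D a b \<in> S" if "a + b = p + q + 1" for a b
  proof -
    have "wz D a b \<in> free.span {(wz ^^ k) (wz D) (- 1) (a + b + int k + 1) | k. k < N}"
      using Suc.prems by (intro Suc.IH) (simp add: funpow_swap1)
    also have "\<dots> \<subseteq> S"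
      unfolding S_def
    proof (rule free.span_mono, safe)
      fix k assume "k < N"
      then show "\<exists>k'. (wz ^^ k) (wz D) (- 1) (a + b + int k + 1) =
          (wz ^^ k') D (- 1) (p + q + int k' + 1) \<and> k' < Suc N"
        using that by (intro exI[of _ "Suc k"]) (simp add: funpow_swap1 algebra_simps)
    qed
    finally show ?thesis .
  qed
  have base: "D (- 1) (p + q + 1) \<in> S"
    unfolding S_def by (rule free.span_base) (auto intro!: exI[of _ 0])
  have sub: "free.subspace S" by (simp add: S_def)
  \<comment> \<open>Neighbours on the line of constant total exponent differ by a coefficient of
    \<open>wz D\<close>. Starting from the exponent \<open>- 1\<close> of \<open>w\<close>,
    \<open>nat1\<close> moves up along the line and \<open>nat2\<close> moves down.\<close>
  have nat1: "D (- 1 + int j) (p + q + 1 - int j) \<in> S" for j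
  proof (induction j)
    case (Suc j)
    have "D (- 1 + int (Suc j)) (p + q + 1 - int (Suc j))
        = D (- 1 + int j) (p + q + 1 - int j) - wz D (int j) (p + q + 1 - int j)"
      by (simp add: fd_mult_w_minus_z_def algebra_simps)
    then show ?case
      using Suc step[of "int j"] free.subspace_diff[OF sub] by simp
  qed (use base in simp)
  have nat2: "D (- 1 - int j) (p + q + 1 + int j) \<in> S" for j
  proof (induction j)
    case (Suc j)
    have "D (- 1 - int (Suc j)) (p + q + 1 + int (Suc j))
        = D (- 1 - int j) (p + q + 1 + int j) + wz D (- 1 - int j) (p + q + 2 + int j)"
      by (simp add: fd_mult_w_minus_z_def algebra_simps)
    then show ?case
      using Suc step[of "- 1 - int j"] free.subspace_add[OF sub] by simp
  qed (use base in simp)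
  show ?case
    unfolding S_def[symmetric]
    using nat1[of "nat (p + 1)"] nat2[of "nat (- p - 1)"]
    by (cases "p \<ge> - 1") (simp_all add: algebra_simps)
qed

text \<open>Multiplication by \<open>u - w\<close>, and in the next two definitions by
  \<open>u - z\<close> and \<open>w - z\<close>, of distributions in three variables. These
  operators commute, and the second is the sum of the other two.\<close>

definition uw :: "(int \<Rightarrow> int \<Rightarrow> int \<Rightarrow> 'b::ab_group_add) \<Rightarrow> int \<Rightarrow> int \<Rightarrow> int \<Rightarrow> 'b" where
  "uw D = (\<lambda>u w z. D (u - 1) w z - D u (w - 1) z)"

definition uz :: "(int \<Rightarrow> int \<Rightarrow> int \<Rightarrow> 'b::ab_group_add) \<Rightarrow> int \<Rightarrow> int \<Rightarrow> int \<Rightarrow> 'b" where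
  "uz D = (\<lambda>u w z. D (u - 1) w z - D u w (z - 1))"

definition wz3 :: "(int \<Rightarrow> int \<Rightarrow> int \<Rightarrow> 'b::ab_group_add) \<Rightarrow> int \<Rightarrow> int \<Rightarrow> int \<Rightarrow> 'b" where
  "wz3 D = (\<lambda>u. wz (D u))"

lemma uw_pow: "(uw ^^ n) D = (\<lambda>u w z. (wz ^^ n) (\<lambda>u w. D u w z) u w)"
proof (induction n)
  case (Suc n)
  show ?case
    unfolding funpow.simps o_apply Suc by (simp add: uw_def fd_mult_w_minus_z_def)
qed simp

lemma uz_pow: "(uz ^^ n) D = (\<lambda>u w z. (wz ^^ n) (\<lambda>u z. D u w z) u z)"
proof (induction n)
  case (Suc n)
  show ?case
    unfolding funpow.simps o_apply Suc by (simp add: uz_def fd_mult_w_minus_z_def)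
qed simp

lemma wz3_pow: "(wz3 ^^ n) D = (\<lambda>u. (wz ^^ n) (D u))"
  by (induction n) (simp_all add: wz3_def)

lemma uz_eq: "uz D = (\<lambda>u w z. uw D u w z + wz3 D u w z)"
  by (simp add: uz_def uw_def wz3_def fd_mult_w_minus_z_def)

lemma uw_uz: "uw (uz D) = uz (uw D)"
  by (simp add: uw_def uz_def algebra_simps)

lemma uw_wz3: "uw (wz3 D) = wz3 (uw D)"
  by (simp add: uw_def wz3_def fd_mult_w_minus_z_def algebra_simps)

lemma uz_wz3: "uz (wz3 D) = wz3 (uz D)"
  by (simp add: uz_def wz3_def fd_mult_w_minus_z_def algebra_simps)

lemmas uw_uz_pow = funpow_commute[of uw uz, OF uw_uz]
lemmas uw_wz3_pow = funpow_commute[of uw wz3, OF uw_wz3]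
lemmas uz_wz3_pow = funpow_commute[of uz wz3, OF uz_wz3]

text \<open>Multiplication by \<open>(u - w)^a (u - z)^b (w - z)^c\<close>.\<close>

definition tri :: "nat \<Rightarrow> nat \<Rightarrow> nat \<Rightarrow> (int \<Rightarrow> int \<Rightarrow> int \<Rightarrow> 'b::ab_group_add) \<Rightarrow> int \<Rightarrow> int \<Rightarrow> int \<Rightarrow> 'b"
  where "tri a b c D = (uw ^^ a) ((uz ^^ b) ((wz3 ^^ c) D))"

lemma uz_pow_add: "(uz ^^ n) (\<lambda>u w z. D u w z + E u w z) = (\<lambda>u w z. (uz ^^ n) D u w z + (uz ^^ n) E u w z)"
  by (simp add: uz_pow wz_pow_add)

lemma uw_pow_add: "(uw ^^ n) (\<lambda>u w z. D u w z + E u w z) = (\<lambda>u w z. (uw ^^ n) D u w z + (uw ^^ n) E u w z)"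
  by (simp add: uw_pow wz_pow_add)

lemma tri_uz: "tri a (Suc b) c D u w z = tri (Suc a) b c D u w z + tri a b (Suc c) D u w z"
proof -
  have "tri a (Suc b) c D = (uw ^^ a) ((uz ^^ b) (uz ((wz3 ^^ c) D)))"
    by (simp add: tri_def funpow_swap1)
  also have "\<dots> = (\<lambda>u w z. (uw ^^ a) ((uz ^^ b) (uw ((wz3 ^^ c) D))) u w z
      + (uw ^^ a) ((uz ^^ b) (wz3 ((wz3 ^^ c) D))) u w z)"
    by (simp add: uz_eq[of "(wz3 ^^ c) D"] uz_pow_add uw_pow_add)
  also have "(uz ^^ b) (uw ((wz3 ^^ c) D)) = uw ((uz ^^ b) ((wz3 ^^ c) D))"
    using uw_uz_pow[of 1 b "(wz3 ^^ c) D"] by simp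
  finally show ?thesis by (simp add: tri_def funpow_swap1)
qed

text \<open>A product \<open>(u - w)^a (w - z)^c\<close> with \<open>a + c \<ge> A + L\<close> has
  \<open>c \<ge> L\<close> or \<open>a \<ge> A\<close>; together with \<open>(u - z)^B\<close> it
  kills \<open>D\<close> in either case. The extra factor \<open>(w - z)^n\<close> is the one in the
  \<open>n\<close>-th product of the last two distributions.\<close>

lemma dong:
  fixes D :: "int \<Rightarrow> int \<Rightarrow> int \<Rightarrow> 'b::ab_group_add"
  assumes wz: "\<And>u w z. (wz3 ^^ L) D u w z = 0"
    and uwuz: "\<And>u w z. tri A B 0 D u w z = 0"
  shows "tri 0 (A + B + L) n D u w z = 0"
proof -
  have v1: "tri a b c D u w z = 0" if "c \<ge> L" for a b c u w z
  proof -
    have "(wz3 ^^ c) D = (\<lambda>u w z. 0)"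
      using wz_pow_vanish_mono[of L "D _", OF _ that] wz by (simp add: wz3_pow fun_eq_iff)
    then show ?thesis by (simp add: tri_def uz_pow uw_pow wz_pow_0)
  qed
  have v2: "tri a b c D u w z = 0" if "a \<ge> A" "b \<ge> B" for a b c u w z
  proof -
    define a' b' where "a' = a - A" and "b' = b - B"
    have a': "a = a' + A" and b': "b = b' + B"
      using that by (simp_all add: a'_def b'_def)
    have "tri a b c D = (wz3 ^^ c) (tri a b 0 D)"
      by (simp only: tri_def uw_wz3_pow uz_wz3_pow funpow_0)
    also have "tri a b 0 D = (uw ^^ a') ((uz ^^ b') (tri A B 0 D))"
      by (simp only: tri_def a' b' funpow_add o_apply uw_uz_pow funpow_0)
    also have "tri A B 0 D = (\<lambda>u w z. 0)" using uwuz by (simp add: fun_eq_iff)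
    finally show ?thesis by (simp add: wz3_pow uw_pow uz_pow wz_pow_0)
  qed
  \<comment> \<open>expand \<open>(u - z)\<^sup>A\<^sup>+\<^sup>L = ((u - w) + (w - z))\<^sup>A\<^sup>+\<^sup>L\<close>, keeping the factor \<open>(u - z)\<^sup>B\<close>\<close>
  have "tri a (B + b) c D u w z = 0" if "a + b + c \<ge> A + L" for a b c u w z
    using that
  proof (induction b arbitrary: a c)
    case 0
    then show ?case using v1[of c] v2[of a B] by (cases "c \<ge> L") auto
  next
    case (Suc b)
    then show ?case by (simp add: tri_uz)
  qed
  from this[of 0 "A + L" n] show ?thesis by (simp add: algebra_simps)
qed

text \<open>The simplifier would otherwise turn \<open>d + e\<close> into \<open>\<lambda>i. d i + e i\<close> in eta-expanded terms.\<close>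

declare plus_fun_apply [simp del] minus_apply [simp del]

section \<open>Homogeneous elements of the free algebra and the defining relations\<close>

lemmas fmult_left_simps = flinear_simps[OF flinear_fmult_left]
lemmas fmult_right_simps = flinear_simps[OF flinear_fmult_right]
lemmas lie_ideal_closed = lie_ideal.zero lie_ideal.add lie_ideal.scale
  free.subspace_diff[OF subspace_lie_ideal]

definition fdeg :: "('i, 'a) pre_digraph \<Rightarrow> ('i \<Rightarrow> int) \<Rightarrow> 'i free set" where
  "fdeg Q d = free.span (fbasis ` {t \<in> words Q. ldeg t = d})"

lemma subspace_fdeg: "free.subspace (fdeg Q d)"
  by (simp add: fdeg_def)

lemma fdeg_base: "t \<in> words Q \<Longrightarrow> fbasis t \<in> fdeg Q (ldeg t)"
  unfolding fdeg_def by (rule free.span_base) auto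

lemma fdeg_induct [consumes 1, case_names base zero add scale]:
  assumes "f \<in> fdeg Q d" "\<And>t. t \<in> words Q \<Longrightarrow> ldeg t = d \<Longrightarrow> P (fbasis t)" "P 0"
    "\<And>f g. P f \<Longrightarrow> P g \<Longrightarrow> P (f + g)" "\<And>c f. P f \<Longrightarrow> P (fscale c f)"
  shows "P f"
  using assms(1) unfolding fdeg_def
proof (induction rule: free.span_induct)
  case base
  then show ?case using assms(3-5) by (auto simp: free.subspace_def)
qed (use assms(2) in auto)

lemma fdeg_free_alg: "f \<in> fdeg Q d \<Longrightarrow> f \<in> free_alg Q"
  unfolding fdeg_def free_alg_def by (rule free.span_mono[THEN subsetD]) auto

lemma fmult_fdeg: "f \<in> fdeg Q d \<Longrightarrow> g \<in> fdeg Q e \<Longrightarrow> fmult f g \<in> fdeg Q (d + e)"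
proof (induction f rule: fdeg_induct)
  case (base s)
  from base(3) show ?case
  proof (induction g rule: fdeg_induct)
    case (base t)
    then show ?case using \<open>s \<in> words Q\<close> \<open>ldeg s = d\<close> fdeg_base[of "Br s t" Q] by simp
  qed (simp_all add: fmult_right_simps free.subspace_0 free.subspace_add
      free.subspace_scale subspace_fdeg)
qed (simp_all add: fmult_left_simps free.subspace_0 free.subspace_add
      free.subspace_scale subspace_fdeg)

text \<open>The sign depends only on the degrees, so the axiom passes from monomials to homogeneous
  elements by bilinearity. This form is needed because a derivation turns a monomial into a sum of
  monomials.\<close>

lemma antisymmetry_fdeg:
  "f \<in> fdeg Q d \<Longrightarrow> g \<in> fdeg Q e \<Longrightarrow>
    fmult f g + fscale (euler_sign Q d e) (fmult g f) \<in> lie_ideal Q"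
proof (induction f rule: fdeg_induct)
  case (base s)
  from base(3) show ?case
  proof (induction g rule: fdeg_induct)
    case (base t)
    then show ?case using \<open>s \<in> words Q\<close> \<open>ldeg s = d\<close> lie_ideal.antisymmetry[of s Q t] by simp
  next
    case (add f g)
    then show ?case using lie_ideal.add[OF add] by (simp add: fmult_right_simps fmult_left_simps algebra_simps)
  next
    case (scale c f)
    then show ?case using lie_ideal.scale[OF scale, of c] by (simp add: fmult_right_simps fmult_left_simps algebra_simps)
  qed (simp add: fmult_right_simps fmult_left_simps lie_ideal.zero)
next
  case (add f g')
  then show ?case using lie_ideal.add[OF add(1,2)[OF add(3)]] by (simp add: fmult_right_simps fmult_left_simps algebra_simps)
next
  case (scale c f)
  then show ?case using lie_ideal.scale[OF scale(1)[OF scale(2)], of c] by (simp add: fmult_right_simps fmult_left_simps algebra_simps)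
qed (simp add: fmult_right_simps fmult_left_simps lie_ideal.zero)

lemma jacobi_fdeg:
  assumes "f \<in> fdeg Q d" "g \<in> fdeg Q e" "h \<in> free_alg Q"
  shows "fmult f (fmult g h) - fmult (fmult f g) h
    - fscale (euler_sign Q d e) (fmult g (fmult f h)) \<in> lie_ideal Q"
  using assms(1)
proof (induction f rule: fdeg_induct)
  case (base s)
  note s = this
  from assms(2) show ?case
  proof (induction g rule: fdeg_induct)
    case (base t)
    note t = this
    from assms(3) show ?case
    proof (induction h rule: free_alg_induct)
      case (base u)
      then show ?case using s t lie_ideal.jacobi[of s Q t u] by simp
    next
      case (add f g)
      then show ?case using lie_ideal.add[OF add] by (simp add: fmult_right_simps fmult_left_simps algebra_simps)
    next
      case (scale c f)
      then show ?case using lie_ideal.scale[OF scale, of c] by (simp add: fmult_right_simps fmult_left_simps algebra_simps)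
    qed (simp add: fmult_right_simps fmult_left_simps lie_ideal.zero)
  next
    case (add f g)
    then show ?case using lie_ideal.add[OF add] by (simp add: fmult_right_simps fmult_left_simps algebra_simps)
  next
    case (scale c f)
    then show ?case using lie_ideal.scale[OF scale, of c] by (simp add: fmult_right_simps fmult_left_simps algebra_simps)
  qed (simp add: fmult_right_simps fmult_left_simps lie_ideal.zero)
next
  case (add f g')
  then show ?case using lie_ideal.add[OF add] by (simp add: fmult_right_simps fmult_left_simps algebra_simps)
next
  case (scale c f)
  then show ?case using lie_ideal.scale[OF scale, of c] by (simp add: fmult_right_simps fmult_left_simps algebra_simps)
qed (simp add: fmult_right_simps fmult_left_simps lie_ideal.zero)

definition locality_rel :: "('i, 'a) pre_digraph \<Rightarrow> 'i \<Rightarrow> 'i \<Rightarrow> int \<Rightarrow> int \<Rightarrow> 'i free" where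
  "locality_rel Q i j m n = (\<Sum>k = 0..Nplus Q i j. fscale ((- 1) ^ k * of_nat (Nplus Q i j choose k))
     (fbasis (Br (Gen (i, m - int k)) (Gen (j, n + int k)))))"

lemma locality_rel_lie_ideal:
  "i \<in> verts Q \<Longrightarrow> j \<in> verts Q \<Longrightarrow> locality_rel Q i j m n \<in> lie_ideal Q"
  unfolding locality_rel_def by (rule lie_ideal.locality)

section \<open>Derivations\<close>

text \<open>The common shape of \<open>P\<close> (coefficients 1, shift 1) and \<open>T\<close>
  (coefficients \<open>- n\<close>, shift \<open>- 1\<close>).\<close>

primrec word_deriv :: "(int \<Rightarrow> rat) \<Rightarrow> int \<Rightarrow> 'i word \<Rightarrow> 'i free" where
  "word_deriv c s (Gen x) = fscale (c (snd x)) (fbasis (Gen (fst x, snd x + s)))"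
| "word_deriv c s (Br t u) = fmult (word_deriv c s t) (fbasis u) + fmult (fbasis t) (word_deriv c s u)"

definition deriv :: "(int \<Rightarrow> rat) \<Rightarrow> int \<Rightarrow> 'i free \<Rightarrow> 'i free" where
  "deriv c s = fextend (word_deriv c s)"

lemma flinear_deriv: "flinear (deriv c s)"
  by (simp add: deriv_def flinear_fextend)

lemmas deriv_simps = flinear_simps[OF flinear_deriv]

lemma deriv_fbasis [simp]: "deriv c s (fbasis t) = word_deriv c s t"
  by (simp add: deriv_def)

lemma deriv_fmult: "deriv c s (fmult f g) = fmult (deriv c s f) g + fmult f (deriv c s g)"
  by (rule fbilinear_eqI[of "\<lambda>f g. deriv c s (fmult f g)" "\<lambda>f g. fmult (deriv c s f) g + fmult f (deriv c s g)"])
    (auto intro!: flinear_plus flinear_compose[OF flinear_deriv] flinear_fmult_right flinear_fmult_left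
      flinear_compose[OF flinear_fmult_right flinear_deriv]
      flinear_compose[OF flinear_fmult_left flinear_deriv])

lemma word_deriv_fdeg: "t \<in> words Q \<Longrightarrow> word_deriv c s t \<in> fdeg Q (ldeg t)"
proof (induction t)
  case (Gen x)
  then show ?case using fdeg_base[of "Gen (fst x, snd x + s)" Q]
    by (simp add: free.subspace_scale subspace_fdeg)
next
  case (Br t u)
  then show ?case
    unfolding ldeg.simps word_deriv.simps
    by (intro free.subspace_add subspace_fdeg fmult_fdeg fdeg_base) simp_all
qed

lemma deriv_free_alg: "f \<in> free_alg Q \<Longrightarrow> deriv c s f \<in> free_alg Q"
proof (induction f rule: free_alg_induct)
  case (base t)
  then show ?case using fdeg_free_alg[OF word_deriv_fdeg] by simp
qed (simp_all add: deriv_simps free.subspace_0 free.subspace_add free.subspace_scale subspace_free_alg)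

text \<open>Such a derivation preserves the degree and hence the signs, so by the Leibniz rule it
  sends each instance of antisymmetry or Jacobi to a sum of instances. Only the locality relations
  depend on \<open>c\<close> and \<open>s\<close>.\<close>

lemma deriv_lie_ideal:
  assumes loc: "\<And>i j m n. i \<in> verts Q \<Longrightarrow> j \<in> verts Q \<Longrightarrow> deriv c s (locality_rel Q i j m n) \<in> lie_ideal Q"
    and f: "f \<in> lie_ideal Q"
  shows "deriv c s f \<in> lie_ideal Q"
  using f
proof (induction rule: lie_ideal.induct)
  case (mult_left f g)
  then show ?case
    by (simp add: deriv_fmult lie_ideal.add lie_ideal.mult_left deriv_free_alg)
next
  case (mult_right f g)
  then show ?case
    by (simp add: deriv_fmult lie_ideal.add lie_ideal.mult_right deriv_free_alg)
next
  case (antisymmetry t u)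
  let ?D = "word_deriv c s" and ?e = "euler_sign Q (ldeg t) (ldeg u)"
  have "(fmult (?D t) (fbasis u) + fscale ?e (fmult (fbasis u) (?D t)))
      + (fmult (fbasis t) (?D u) + fscale ?e (fmult (?D u) (fbasis t))) \<in> lie_ideal Q"
    using antisymmetry
    by (intro lie_ideal.add antisymmetry_fdeg word_deriv_fdeg fdeg_base)
  then show ?case by (simp add: deriv_simps algebra_simps)
next
  case (jacobi t u v)
  let ?D = "word_deriv c s" and ?e = "euler_sign Q (ldeg t) (ldeg u)"
  let ?J = "\<lambda>f g h. fmult f (fmult g h) - fmult (fmult f g) h - fscale ?e (fmult g (fmult f h))"
  have "?J (?D t) (fbasis u) (fbasis v) + ?J (fbasis t) (?D u) (fbasis v)
      + ?J (fbasis t) (fbasis u) (?D v) \<in> lie_ideal Q"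
    using jacobi
    by (intro lie_ideal.add jacobi_fdeg word_deriv_fdeg fdeg_base free_alg_fbasis
        fdeg_free_alg[OF word_deriv_fdeg])
  then show ?case by (simp add: deriv_simps fmult_left_simps fmult_right_simps algebra_simps)
next
  case (locality i j m n)
  then show ?case using loc by (simp add: locality_rel_def)
qed (simp_all add: deriv_simps lie_ideal_closed)

abbreviation shift_deriv :: "'i free \<Rightarrow> 'i free" where
  "shift_deriv \<equiv> deriv (\<lambda>n. 1) 1"

abbreviation z_deriv :: "'i free \<Rightarrow> 'i free" where
  "z_deriv \<equiv> deriv (\<lambda>n. - of_int n) (- 1)"

lemma shift_deriv_lie_ideal: "f \<in> lie_ideal Q \<Longrightarrow> shift_deriv f \<in> lie_ideal Q"
proof (rule deriv_lie_ideal)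
  fix i j m n assume "i \<in> verts Q" "j \<in> verts Q"
  moreover have "shift_deriv (locality_rel Q i j m n) = locality_rel Q i j (m + 1) n + locality_rel Q i j m (n + 1)"
    by (simp add: locality_rel_def deriv_simps sum.distrib free.scale_right_distrib algebra_simps)
  ultimately show "shift_deriv (locality_rel Q i j m n) \<in> lie_ideal Q"
    by (simp add: lie_ideal.add locality_rel_lie_ideal)
qed

text \<open>The relations are the coefficients of \<open>(w - z)^N [i(w), j(z)]\<close>, and
  \<open>T\<close> acts on the bracket as \<open>\<partial>_w + \<partial>_z\<close>, which commutes
  with \<open>w - z\<close>. In coefficients this becomes the absorption identity for binomial
  coefficients.\<close>

lemma z_deriv_locality_rel:
  "z_deriv (locality_rel Q i j m n) =
    fscale (of_nat (Nplus Q i j) - of_int m) (locality_rel Q i j (m - 1) n)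
    - fscale (of_int n) (locality_rel Q i j m (n - 1))"
proof -
  define N where "N = Nplus Q i j"
  \<comment> \<open>\<open>X\<close> has the index of the first factor lowered by \<open>T\<close>,
    \<open>Y\<close> that of the second; the two families agree up to a shift of
    \<open>k\<close>.\<close>
  define X where "X k = fbasis (Br (Gen (i, m - 1 - int k)) (Gen (j, n + int k)))" for k
  define Y where "Y k = fbasis (Br (Gen (i, m - int k)) (Gen (j, n - 1 + int k)))" for k
  define c where "c k = (- 1) ^ k * rat_of_nat (N choose k)" for k
  have YX: "Y (Suc k) = X k" for k
    by (simp add: X_def Y_def diff_diff_eq)
  have rX: "locality_rel Q i j (m - 1) n = (\<Sum>k = 0..N. fscale (c k) (X k))"
    by (simp add: locality_rel_def X_def c_def N_def)
  have rY: "locality_rel Q i j m (n - 1) = (\<Sum>k = 0..N. fscale (c k) (Y k))"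
    by (simp add: locality_rel_def Y_def c_def N_def)
  \<comment> \<open>The added term vanishes since \<open>N choose Suc N\<close> is 0; the term at
    \<open>k = 0\<close> vanishes as well, which allows the shift of index from \<open>Y\<close> to
    \<open>X\<close>.\<close>
  have "(\<Sum>k = 0..N. fscale (c k * of_nat k) (Y k)) = (\<Sum>k = 0..Suc N. fscale (c k * of_nat k) (Y k))"
    by (simp add: c_def)
  also have "\<dots> = (\<Sum>k = 0..N. fscale (c (Suc k) * of_nat (Suc k)) (X k))"
    by (subst sum.atLeast0_atMost_Suc_shift) (simp add: YX)
  also have "\<dots> = (\<Sum>k = 0..N. fscale (c k * of_nat k - of_nat N * c k) (X k))"
  proof (rule sum.cong)
    fix k assume "k \<in> {0..N}"
    then have k: "k \<le> N" by simp
    have "Suc k * (N choose Suc k) = (N - k) * (N choose k)"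
      by (simp only: binomial_absorption binomial_absorb_comp)
    then have "rat_of_nat (Suc k * (N choose Suc k)) = rat_of_nat ((N - k) * (N choose k))"
      by (rule arg_cong)
    then have "rat_of_nat (Suc k) * rat_of_nat (N choose Suc k)
        = (rat_of_nat N - rat_of_nat k) * rat_of_nat (N choose k)"
      by (simp only: of_nat_mult of_nat_diff[OF k])
    then have "c (Suc k) * of_nat (Suc k) = c k * of_nat k - of_nat N * c k"
      unfolding c_def power_Suc mult_minus1 mult.assoc
      by (simp only: mult.commute[of "rat_of_nat (N choose Suc k)" "rat_of_nat (Suc k)"]) (simp add: algebra_simps)
    then show "fscale (c (Suc k) * of_nat (Suc k)) (X k) = fscale (c k * of_nat k - of_nat N * c k) (X k)"
      by simp
  qed simp
  finally have key: "(\<Sum>k = 0..N. fscale (c k * of_nat k) (Y k)) =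
      (\<Sum>k = 0..N. fscale (c k * of_nat k - of_nat N * c k) (X k))" .
  have "z_deriv (locality_rel Q i j m n) =
      (\<Sum>k = 0..N. fscale (c k) (fscale (of_nat k - of_int m) (X k) - fscale (of_int n + of_nat k) (Y k)))"
    unfolding locality_rel_def N_def[symmetric] c_def[symmetric]
    by (simp add: deriv_simps X_def Y_def fmult_left_simps fmult_right_simps
      free.scale_left_diff_distrib free.scale_left_distrib algebra_simps)
  also have "\<dots> = (\<Sum>k = 0..N. fscale (c k * of_nat k) (X k)) - fscale (of_int m) (\<Sum>k = 0..N. fscale (c k) (X k))
      - fscale (of_int n) (\<Sum>k = 0..N. fscale (c k) (Y k)) - (\<Sum>k = 0..N. fscale (c k * of_nat k) (Y k))"
    by (simp add: free.scale_sum_right free.scale_right_diff_distrib free.scale_left_diff_distrib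
        free.scale_left_distrib sum_subtractf sum.distrib algebra_simps)
  also have "\<dots> = fscale (of_nat N - of_int m) (\<Sum>k = 0..N. fscale (c k) (X k))
      - fscale (of_int n) (\<Sum>k = 0..N. fscale (c k) (Y k))"
    unfolding key
    by (simp add: free.scale_sum_right free.scale_right_diff_distrib free.scale_left_diff_distrib
        free.scale_left_distrib sum_subtractf sum.distrib algebra_simps)
  finally show ?thesis unfolding rX rY N_def .
qed

lemma z_deriv_lie_ideal: "f \<in> lie_ideal Q \<Longrightarrow> z_deriv f \<in> lie_ideal Q"
  by (rule deriv_lie_ideal) (auto simp: z_deriv_locality_rel intro!: lie_ideal_closed locality_rel_lie_ideal)

section \<open>The shift automorphism\<close>

abbreviation word_shift :: "'i word \<Rightarrow> 'i word" where
  "word_shift \<equiv> map_magma (\<lambda>x. (fst x, snd x - 1))"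

definition shift :: "'i free \<Rightarrow> 'i free" where
  "shift = fextend (\<lambda>t. fbasis (word_shift t))"

lemma flinear_shift: "flinear shift"
  by (simp add: shift_def flinear_fextend)

lemmas shift_simps = flinear_simps[OF flinear_shift]

lemma shift_fbasis [simp]: "shift (fbasis t) = fbasis (word_shift t)"
  by (simp add: shift_def)

lemma shift_fmult: "shift (fmult f g) = fmult (shift f) (shift g)"
  by (rule fbilinear_eqI[of "\<lambda>f g. shift (fmult f g)" "\<lambda>f g. fmult (shift f) (shift g)"])
    (auto intro!: flinear_compose[OF flinear_shift] flinear_fmult_right flinear_fmult_left
      flinear_compose[OF flinear_fmult_right flinear_shift]
      flinear_compose[OF flinear_fmult_left flinear_shift])

lemma word_shift_words [simp]: "word_shift t \<in> words Q \<longleftrightarrow> t \<in> words Q"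
  by (auto simp: words_def magma.set_map image_image)

lemma ldeg_word_shift [simp]: "ldeg (word_shift t) = ldeg t"
  by (induction t) auto

lemma shift_free_alg: "f \<in> free_alg Q \<Longrightarrow> shift f \<in> free_alg Q"
  by (induction f rule: free_alg_induct)
    (simp_all add: free_alg_fbasis shift_simps free.subspace_0 free.subspace_add free.subspace_scale
      subspace_free_alg)

lemma shift_lie_ideal: "f \<in> lie_ideal Q \<Longrightarrow> shift f \<in> lie_ideal Q"
proof (induction rule: lie_ideal.induct)
  case (mult_left f g)
  then show ?case by (simp add: shift_fmult lie_ideal.mult_left shift_free_alg)
next
  case (mult_right f g)
  then show ?case by (simp add: shift_fmult lie_ideal.mult_right shift_free_alg)
next
  case (antisymmetry t u)
  then show ?case using lie_ideal.antisymmetry[of "word_shift t" Q "word_shift u"]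
    by (simp add: shift_simps)
next
  case (jacobi t u v)
  then show ?case using lie_ideal.jacobi[of "word_shift t" Q "word_shift u" "word_shift v"]
    by (simp add: shift_simps)
next
  case (locality i j m n)
  then show ?case using locality_rel_lie_ideal[of i Q j "m - 1" "n - 1"]
    by (simp add: shift_simps locality_rel_def algebra_simps)
qed (simp_all add: shift_simps lie_ideal_closed)

section \<open>The grading\<close>

definition grade :: "('i, 'a) pre_digraph \<Rightarrow> ('i \<Rightarrow> int) \<Rightarrow> rat \<Rightarrow> 'i word set" where
  "grade Q d w = {t. ldeg t = d \<and> weight Q t = w}"

definition proj :: "('i, 'a) pre_digraph \<Rightarrow> ('i \<Rightarrow> int) \<Rightarrow> rat \<Rightarrow> 'i free \<Rightarrow> 'i free" where
  "proj Q d w = fextend (\<lambda>t. if t \<in> grade Q d w then fbasis t else 0)"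

lemma flinear_proj: "flinear (proj Q d w)"
  by (simp add: proj_def flinear_fextend)

lemmas proj_simps = flinear_simps[OF flinear_proj]

lemma proj_fbasis [simp]: "proj Q d w (fbasis t) = (if t \<in> grade Q d w then fbasis t else 0)"
  by (simp add: proj_def)

lemma proj_fmult_left:
  "proj Q d w (fmult (fbasis s) f) = fmult (fbasis s) (proj Q (d - ldeg s) (w - weight Q s) f)"
  by (rule fun_cong[of _ _ f], rule flinear_eqI)
    (auto intro!: flinear_compose[OF flinear_proj flinear_fmult_right]
      flinear_compose[OF flinear_fmult_right flinear_proj] simp: grade_def fmult_right_simps)

lemma proj_fmult_right:
  "proj Q d w (fmult f (fbasis s)) = fmult (proj Q (d - ldeg s) (w - weight Q s) f) (fbasis s)"
  by (rule fun_cong[of _ _ f], rule flinear_eqI)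
    (auto intro!: flinear_compose[OF flinear_proj flinear_fmult_left]
      flinear_compose[OF flinear_fmult_left flinear_proj] simp: grade_def fmult_left_simps)

text \<open>All generators of the ideal are homogeneous in degree and weight. In the ideal steps the
  other factor is reduced to a monomial, past which the projection moves with degree and weight
  lowered accordingly. Thus the quotient inherits both gradings.\<close>

lemma proj_lie_ideal: "f \<in> lie_ideal Q \<Longrightarrow> proj Q d w f \<in> lie_ideal Q"
proof (induction arbitrary: d w rule: lie_ideal.induct)
  case (mult_left f g)
  from mult_left(2) show ?case
  proof (induction g rule: free_alg_induct)
    case (base t)
    then show ?case by (simp add: proj_fmult_left lie_ideal.mult_left free_alg_fbasis mult_left.IH)
  qed (simp_all add: fmult_left_simps proj_simps lie_ideal_closed)
next
  case (mult_right f g)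
  from mult_right(2) show ?case
  proof (induction g rule: free_alg_induct)
    case (base t)
    then show ?case by (simp add: proj_fmult_right lie_ideal.mult_right free_alg_fbasis mult_right.IH)
  qed (simp_all add: fmult_right_simps proj_simps lie_ideal_closed)
next
  case (antisymmetry t u)
  have "Br u t \<in> grade Q d w \<longleftrightarrow> Br t u \<in> grade Q d w"
    by (simp add: grade_def add.commute)
  then show ?case using lie_ideal.antisymmetry[OF antisymmetry]
    by (simp add: proj_simps lie_ideal.zero)
next
  case (jacobi t u v)
  have "Br (Br t u) v \<in> grade Q d w \<longleftrightarrow> Br t (Br u v) \<in> grade Q d w"
    "Br u (Br t v) \<in> grade Q d w \<longleftrightarrow> Br t (Br u v) \<in> grade Q d w"
    by (simp_all add: grade_def algebra_simps)
  then show ?case using lie_ideal.jacobi[OF jacobi]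
    by (simp add: proj_simps lie_ideal.zero)
next
  case (locality i j m n)
  have "Br (Gen (i, m - int k)) (Gen (j, n + int k)) \<in> grade Q d w \<longleftrightarrow> Br (Gen (i, m)) (Gen (j, n)) \<in> grade Q d w" for k
    by (simp add: grade_def algebra_simps)
  then show ?case using locality_rel_lie_ideal[OF locality, of m n]
    by (cases "Br (Gen (i, m)) (Gen (j, n)) \<in> grade Q d w")
      (simp_all add: proj_simps lie_ideal.zero locality_rel_def)
qed (simp_all add: proj_simps lie_ideal_closed)

section \<open>Right-normed products\<close>

definition lie_map :: "('i, 'a) pre_digraph \<Rightarrow> ('i free \<Rightarrow> 'i free) \<Rightarrow> 'i free \<Rightarrow> 'i free" where
  "lie_map Q F x = quotient_map Q (F x)"

abbreviation gpiece :: "('i, 'a) pre_digraph \<Rightarrow> ('i \<Rightarrow> int) \<Rightarrow> rat \<Rightarrow> 'i free set" where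
  "gpiece Q d w \<equiv> piece Q (grade Q d w)"

lemma gpiece_subset_deg: "gpiece Q d w \<subseteq> piece Q {t. ldeg t = d}"
  by (rule piece_mono) (auto simp: grade_def)

lemma piece_subset_Lie: "piece Q S \<subseteq> Lie Q"
  unfolding Lie_eq_piece by (rule piece_mono) auto

lemma subspace_Lie: "free.subspace (Lie Q)"
  by (simp add: Lie_eq_piece subspace_piece)

lemma bracket_Lie: "x \<in> Lie Q \<Longrightarrow> y \<in> Lie Q \<Longrightarrow> bracket Q x y \<in> Lie Q"
  unfolding Lie_eq_piece by (rule bracket_piece) auto

lemma bracket_gpiece:
  "x \<in> gpiece Q d w \<Longrightarrow> y \<in> gpiece Q e v \<Longrightarrow> bracket Q x y \<in> gpiece Q (d + e) (w + v)"
  by (erule bracket_piece) (auto simp: grade_def)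

text \<open>The weight of \<open>i(- 1)\<close>, the constant coefficient of the distribution of
  \<open>i\<close>.\<close>

definition gen_weight :: "('i, 'a) pre_digraph \<Rightarrow> 'i \<Rightarrow> rat" where
  "gen_weight Q i = of_int (euler Q (basis_vec i) (basis_vec i)) / 2"

lemma fd_gen_gpiece: "i \<in> verts Q \<Longrightarrow> fd_gen Q i p \<in> gpiece Q (basis_vec i) (gen_weight Q i + of_int p)"
  unfolding fd_gen_def gen_def
  by (rule piece_base) (auto simp: grade_def gen_weight_def)

lemma fd_prod_eq: "fd_prod Q n a b q = (wz ^^ n) (\<lambda>p q. bracket Q (a p) (b q)) (- 1) q"
  by (simp add: fd_prod_def fd_res_def)

text \<open>The factor \<open>(w - z)^n\<close> lowers the total exponent by \<open>n\<close>, and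
  the residue fixes the exponent \<open>- 1\<close> of \<open>w\<close>; hence the shift by
  \<open>- n - 1\<close>.\<close>

lemma fd_prod_gpiece:
  assumes "\<And>p. a p \<in> gpiece Q d (w + of_int p)" "\<And>p. b p \<in> gpiece Q e (v + of_int p)"
  shows "fd_prod Q n a b q \<in> gpiece Q (d + e) (w + v - of_nat n - 1 + of_int q)"
  unfolding fd_prod_eq
proof (rule wz_pow_mem)
  fix r s :: int assume "r + s = - 1 + q - int n"
  then have "(of_int s :: rat) = of_int (- 1 + q - int n - r)" by simp
  then have e: "w + of_int r + (v + of_int s) = w + v - of_nat n - 1 + of_int q"
    by simp
  show "bracket Q (a r) (b s) \<in> gpiece Q (d + e) (w + v - of_nat n - 1 + of_int q)"
    using bracket_gpiece[OF assms, of r s] unfolding e .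
qed (rule free.subspace_diff[OF subspace_piece])

text \<open>Right-normed products of the generating distributions; \<open>w\<close> is the weight of the coefficient
  of \<open>z\<^sup>0\<close>, so that the coefficient of \<open>z\<^sup>p\<close> has weight \<open>w + p\<close>.\<close>

inductive right_normed :: "('i, 'a) pre_digraph \<Rightarrow> ('i \<Rightarrow> int) \<Rightarrow> rat \<Rightarrow> (int \<Rightarrow> 'i free) \<Rightarrow> bool"
  for Q :: "('i, 'a) pre_digraph" where
  base: "i \<in> verts Q \<Longrightarrow> right_normed Q (basis_vec i) (gen_weight Q i) (fd_gen Q i)"
| step: "i \<in> verts Q \<Longrightarrow> right_normed Q d w a \<Longrightarrow>
    right_normed Q (basis_vec i + d) (gen_weight Q i + w - of_nat n - 1) (fd_prod Q n (fd_gen Q i) a)"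

lemma right_normed_gpiece: "right_normed Q d w a \<Longrightarrow> a p \<in> gpiece Q d (w + of_int p)"
proof (induction arbitrary: p rule: right_normed.induct)
  case (step i d w a n)
  then show ?case by (intro fd_prod_gpiece fd_gen_gpiece)
qed (rule fd_gen_gpiece)

lemma right_normed_deg: "right_normed Q d w a \<Longrightarrow> a p \<in> piece Q {t. ldeg t = d}"
  by (rule subsetD[OF gpiece_subset_deg right_normed_gpiece])

lemma right_normed_Lie: "right_normed Q d w a \<Longrightarrow> a p \<in> Lie Q"
  by (rule subsetD[OF piece_subset_Lie right_normed_gpiece])

text \<open>This is what the defining relations say: by the binomial theorem they are the
  coefficients of \<open>(w - z)^N [i(w), j(z)]\<close>, with \<open>m = N - p - 1\<close> and
  \<open>n = - q - 1\<close> at \<open>w^p z^q\<close>.\<close>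

lemma fd_local_gen_gen:
  assumes "i \<in> verts Q" "j \<in> verts Q"
  shows "fd_local (\<lambda>p q. bracket Q (fd_gen Q i p) (fd_gen Q j q))"
  unfolding fd_local_def
proof (intro exI allI)
  fix p q
  let ?N = "Nplus Q i j"
  have "(wz ^^ ?N) (\<lambda>p q. bracket Q (fd_gen Q i p) (fd_gen Q j q)) p q =
      quotient_map Q (locality_rel Q i j (int ?N - p - 1) (- q - 1))"
    using assms unfolding wz_pow_expand locality_rel_def
    by (simp add: flinear_simps[OF flinear_quotient_map] fd_gen_def gen_def bracket_fbasis algebra_simps)
  also have "\<dots> = 0"
    unfolding quotient_map_eq_0_iff using assms by (rule locality_rel_lie_ideal)
  finally show "(wz ^^ ?N) (\<lambda>p q. bracket Q (fd_gen Q i p) (fd_gen Q j q)) p q = 0" .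
qed

lemmas wz_pow_bracket_right = wz_pow_additive[OF bracket_right_simps(4)]
lemmas wz_pow_bracket_left = wz_pow_additive[OF bracket_left_simps(4)]

text \<open>Jacobi splits \<open>[c(u), [a(w), b(z)]]\<close> into a term killed by
  \<open>(u - w)^A\<close> and one killed by \<open>(u - z)^B\<close>, so \<open>dong\<close>
  applies. Taking the residue in \<open>w\<close> after multiplying by \<open>(w - z)^n\<close>
  gives the bracket of \<open>c\<close> with the product.\<close>

lemma fd_local_prod:
  assumes c: "\<And>u. c u \<in> piece Q {t. ldeg t = d}" and a: "\<And>u. a u \<in> piece Q {t. ldeg t = e}"
    and b: "\<And>u. b u \<in> Lie Q"
    and ca: "fd_local (\<lambda>p q. bracket Q (c p) (a q))" and cb: "fd_local (\<lambda>p q. bracket Q (c p) (b q))"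
    and ab: "fd_local (\<lambda>p q. bracket Q (a p) (b q))"
  shows "fd_local (\<lambda>p q. bracket Q (c p) (fd_prod Q n a b q))"
proof -
  obtain A where A: "\<And>p q. (wz ^^ A) (\<lambda>p q. bracket Q (c p) (a q)) p q = 0"
    using ca unfolding fd_local_def by blast
  obtain B where B: "\<And>p q. (wz ^^ B) (\<lambda>p q. bracket Q (c p) (b q)) p q = 0"
    using cb unfolding fd_local_def by blast
  obtain L where L: "\<And>p q. (wz ^^ L) (\<lambda>p q. bracket Q (a p) (b q)) p q = 0"
    using ab unfolding fd_local_def by blast
  define D where "D u w z = bracket Q (c u) (bracket Q (a w) (b z))" for u w z
  define E1 where "E1 u w z = bracket Q (bracket Q (c u) (a w)) (b z)" for u w z
  define E2 where "E2 u w z = fscale (euler_sign Q d e) (bracket Q (a w) (bracket Q (c u) (b z)))" for u w z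
  have D: "D = (\<lambda>u w z. E1 u w z + E2 u w z)"
    using bracket_jacobi[OF c a b] by (simp add: D_def E1_def E2_def fun_eq_iff)
  have wz: "(wz3 ^^ L) D u w z = 0" for u w z
    by (simp add: wz3_pow D_def[abs_def] wz_pow_bracket_right L bracket_right_simps)
  have "(uw ^^ A) E1 = (\<lambda>u w z. 0)"
    by (simp add: uw_pow E1_def wz_pow_bracket_left A bracket_left_simps)
  then have e1: "(uw ^^ A) ((uz ^^ B) E1) = (\<lambda>u w z. 0)"
    by (simp only: uw_uz_pow) (simp add: uz_pow wz_pow_0)
  define F where "F y x = fscale (euler_sign Q d e) (bracket Q y x)" for x y
  have F: "F y (x - x') = F y x - F y x'" "F y 0 = 0" for y x x'
    by (simp_all add: F_def bracket_right_simps free.scale_right_diff_distrib)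
  have "(uz ^^ B) E2 = (\<lambda>u w z. 0)"
    unfolding uz_pow E2_def F_def[symmetric] wz_pow_additive[of "F _", OF F(1)]
    by (simp add: B F)
  then have e2: "(uw ^^ A) ((uz ^^ B) E2) = (\<lambda>u w z. 0)"
    by (simp add: uw_pow wz_pow_0)
  have t: "tri A B 0 D u w z = 0" for u w z
    by (simp add: tri_def D uz_pow_add uw_pow_add e1 e2)
  have "(wz ^^ (A + B + L)) (\<lambda>p q. bracket Q (c p) (fd_prod Q n a b q)) p q = 0" for p q
  proof -
    have "(\<lambda>p q. bracket Q (c p) (fd_prod Q n a b q)) = (\<lambda>u z. (wz3 ^^ n) D u (- 1) z)"
      by (simp add: fun_eq_iff wz3_pow D_def[abs_def] wz_pow_bracket_right fd_prod_eq)
    then have "(wz ^^ (A + B + L)) (\<lambda>p q. bracket Q (c p) (fd_prod Q n a b q)) p q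
        = tri 0 (A + B + L) n D p (- 1) q"
      by (simp add: tri_def uz_pow)
    then show ?thesis using dong[OF wz t] by simp
  qed
  then show ?thesis unfolding fd_local_def by (intro exI allI)
qed

lemma fd_gen_deg: "i \<in> verts Q \<Longrightarrow> fd_gen Q i p \<in> piece Q {t. ldeg t = basis_vec i}"
  by (rule subsetD[OF gpiece_subset_deg fd_gen_gpiece])

lemma right_normed_local:
  "right_normed Q d w a \<Longrightarrow> i \<in> verts Q \<Longrightarrow> fd_local (\<lambda>p q. bracket Q (fd_gen Q i p) (a q))"
proof (induction arbitrary: i rule: right_normed.induct)
  case (step j d w a n)
  then show ?case
    by (intro fd_local_prod[of _ Q "basis_vec i" _ "basis_vec j"] fd_gen_deg fd_local_gen_gen)
      (auto intro: right_normed_Lie)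
qed (rule fd_local_gen_gen)

section \<open>The coefficients of right-normed products span the Lie algebra\<close>

definition rn_span :: "('i, 'a) pre_digraph \<Rightarrow> ('i \<Rightarrow> int) \<Rightarrow> rat \<Rightarrow> 'i free set" where
  "rn_span Q d w = free.span {a p | a p w'. right_normed Q d w' a \<and> w' + of_int p = w}"

lemma subspace_rn_span: "free.subspace (rn_span Q d w)"
  by (simp add: rn_span_def)

lemma rn_span_base: "right_normed Q d w' a \<Longrightarrow> w' + of_int p = w \<Longrightarrow> a p \<in> rn_span Q d w"
  unfolding rn_span_def by (rule free.span_base) auto

lemma rn_span_induct [consumes 1, case_names base zero add scale]:
  assumes "x \<in> rn_span Q d w" "\<And>a p w'. right_normed Q d w' a \<Longrightarrow> w' + of_int p = w \<Longrightarrow> P (a p)" "P 0"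
    "\<And>x y. P x \<Longrightarrow> P y \<Longrightarrow> P (x + y)" "\<And>c x. P x \<Longrightarrow> P (fscale c x)"
  shows "P x"
  using assms(1) unfolding rn_span_def
proof (induction rule: free.span_induct)
  case base
  then show ?case using assms(3-5) by (auto simp: free.subspace_def)
qed (use assms(2) in auto)

lemma rn_span_gpiece: "rn_span Q d w \<subseteq> gpiece Q d w"
proof
  fix x assume "x \<in> rn_span Q d w"
  then show "x \<in> gpiece Q d w"
    by (induction rule: rn_span_induct)
      (use right_normed_gpiece in \<open>auto intro: free.subspace_0 free.subspace_add free.subspace_scale subspace_piece\<close>)
qed

text \<open>By locality each coefficient of \<open>[i(w), b(z)]\<close> is a combination of
  coefficients of the products \<open>fd_prod Q k (fd_gen Q i) b\<close>, which are again
  right-normed.\<close>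

lemma rn_span_bracket_gen:
  assumes "i \<in> verts Q" "y \<in> rn_span Q e v"
  shows "bracket Q (fd_gen Q i p) y \<in> rn_span Q (basis_vec i + e) (gen_weight Q i + of_int p + v)"
  using assms(2)
proof (induction rule: rn_span_induct)
  case (base b q w')
  let ?D = "\<lambda>p q. bracket Q (fd_gen Q i p) (b q)"
  obtain N where N: "\<And>p q. (wz ^^ N) ?D p q = 0"
    using right_normed_local[OF base(1) assms(1)] unfolding fd_local_def by blast
  have "?D p q \<in> free.span {(wz ^^ k) ?D (- 1) (p + q + int k + 1) | k. k < N}"
    by (rule local_coeff_span[OF N])
  also have "\<dots> \<subseteq> rn_span Q (basis_vec i + e) (gen_weight Q i + of_int p + v)"
  proof (rule free.span_minimal)
    show "{(wz ^^ k) ?D (- 1) (p + q + int k + 1) |k. k < N}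
        \<subseteq> rn_span Q (basis_vec i + e) (gen_weight Q i + of_int p + v)"
    proof safe
      fix k
      have "fd_prod Q k (fd_gen Q i) b (p + q + int k + 1)
          \<in> rn_span Q (basis_vec i + e) (gen_weight Q i + of_int p + v)"
        using base(2) by (intro rn_span_base[OF right_normed.step[OF assms(1) base(1), of k]]) auto
      then show "(wz ^^ k) ?D (- 1) (p + q + int k + 1)
          \<in> rn_span Q (basis_vec i + e) (gen_weight Q i + of_int p + v)"
        by (simp add: fd_prod_eq)
    qed
  qed (rule subspace_rn_span)
  finally show ?case .
qed (auto simp: bracket_right_simps intro: free.subspace_0 free.subspace_add free.subspace_scale subspace_rn_span)

text \<open>A coefficient of the product is a combination of brackets
  \<open>[i(w)_r, a(z)_s]\<close> of coefficients. Jacobi turns the bracket of such an element with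
  \<open>y\<close> into nested brackets, to which the case of a generator and the induction
  hypothesis apply in either order.\<close>

lemma rn_span_bracket_right_normed:
  assumes "right_normed Q d w a" "y \<in> rn_span Q e v"
  shows "bracket Q (a p) y \<in> rn_span Q (d + e) (w + of_int p + v)"
  using assms
proof (induction arbitrary: e v y p rule: right_normed.induct)
  case (step i d w a n)
  let ?V = "rn_span Q (basis_vec i + d + e) (gen_weight Q i + w - of_nat n - 1 + of_int p + v)"
  define U where "U = {x. bracket Q x y \<in> ?V}"
  have "fd_prod Q n (fd_gen Q i) a p \<in> U"
    unfolding fd_prod_eq
  proof (rule wz_pow_mem)
    fix r s :: int assume "r + s = - 1 + p - int n"
    then have "(of_int s :: rat) = of_int (- 1 + p - int n - r)" by simp
    then have rs: "(of_int s :: rat) = - 1 + of_int p - of_nat n - of_int r" by simp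
    let ?g = "fd_gen Q i r"
    have y: "y \<in> Lie Q"
      using step.prems rn_span_gpiece piece_subset_Lie by blast
    have "bracket Q (bracket Q ?g (a s)) y = bracket Q ?g (bracket Q (a s) y)
        - fscale (euler_sign Q (basis_vec i) d) (bracket Q (a s) (bracket Q ?g y))"
      using bracket_jacobi[OF fd_gen_deg[OF step.hyps(1)] right_normed_deg[OF step.hyps(2)] y, of r s]
      by simp
    moreover have "bracket Q ?g (bracket Q (a s) y) \<in> ?V"
      using rn_span_bracket_gen[OF step.hyps(1) step.IH[OF step.prems, of s], of r]
      by (simp add: rs algebra_simps)
    moreover have "bracket Q (a s) (bracket Q ?g y) \<in> ?V"
      using step.IH[OF rn_span_bracket_gen[OF step.hyps(1) step.prems, of r], of s]
      by (simp add: rs algebra_simps)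
    ultimately show "bracket Q ?g (a s) \<in> U"
      unfolding U_def by (simp add: free.subspace_diff free.subspace_scale subspace_rn_span)
  qed (simp add: U_def bracket_left_simps free.subspace_diff[OF subspace_rn_span])
  then show ?case by (simp add: U_def)
qed (rule rn_span_bracket_gen)

lemma rn_span_bracket:
  assumes "x \<in> rn_span Q d w" "y \<in> rn_span Q e v"
  shows "bracket Q x y \<in> rn_span Q (d + e) (w + v)"
  using assms(1)
proof (induction rule: rn_span_induct)
  case (base a p w')
  then show ?case using rn_span_bracket_right_normed[OF base(1) assms(2), of p] by simp
qed (auto simp: bracket_left_simps intro: free.subspace_0 free.subspace_add free.subspace_scale subspace_rn_span)

lemma word_rn_span: "t \<in> words Q \<Longrightarrow> quotient_map Q (fbasis t) \<in> rn_span Q (ldeg t) (weight Q t)"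
proof (induction t)
  case (Gen x)
  have "fd_gen Q (fst x) (- snd x - 1) \<in> rn_span Q (basis_vec (fst x)) (weight Q (Gen x))"
    using Gen by (intro rn_span_base[OF right_normed.base]) (auto simp: gen_weight_def)
  then show ?case by (simp add: fd_gen_def gen_def)
next
  case (Br s t)
  then show ?case
    using rn_span_bracket[of _ Q "ldeg s" "weight Q s" _ "ldeg t" "weight Q t"]
    by (simp flip: bracket_fbasis)
qed

lemma gpiece_eq_rn_span: "gpiece Q d w = rn_span Q d w"
proof
  show "gpiece Q d w \<subseteq> rn_span Q d w"
  proof
    fix x assume "x \<in> gpiece Q d w"
    then show "x \<in> rn_span Q d w"
    proof (induction rule: piece_induct)
      case (base t)
      then show ?case using word_rn_span[of t Q] by (auto simp: grade_def)
    qed (auto intro: free.subspace_0 free.subspace_add free.subspace_scale subspace_rn_span)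
  qed
qed (rule rn_span_gpiece)

section \<open>Finiteness\<close>

text \<open>The number \<open>|d|\<close>; for the degree of a monomial it counts the
  generators.\<close>

definition height :: "('i, 'a) pre_digraph \<Rightarrow> ('i \<Rightarrow> int) \<Rightarrow> int" where
  "height Q d = (\<Sum>i\<in>verts Q. d i)"

lemma height_add: "height Q (d + e) = height Q d + height Q e"
  by (simp add: height_def sum.distrib plus_fun_apply)

lemma height_basis_vec: "finite (verts Q) \<Longrightarrow> i \<in> verts Q \<Longrightarrow> height Q (basis_vec i) = 1"
  by (simp add: height_def basis_vec_def)

lemma right_normed_height: "right_normed Q d w a \<Longrightarrow> finite (verts Q) \<Longrightarrow> height Q d \<ge> 1"
  by (induction rule: right_normed.induct) (auto simp: height_add height_basis_vec)

lemma fd_prod_zero_right: "fd_prod Q n a (\<lambda>p. 0) = (\<lambda>p. 0)"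
  by (simp add: fun_eq_iff fd_prod_eq bracket_right_simps wz_pow_0)

text \<open>Induction on the number of generators: by locality only finitely many indices
  \<open>n\<close> give a nonzero product with a given distribution. Zero must be excluded because
  vanishing products occur with infinitely many weights.\<close>

lemma finite_right_normed_height:
  assumes fin: "finite (verts Q)"
  shows "finite {(d, w, a). right_normed Q d w a \<and> a \<noteq> (\<lambda>p. 0) \<and> height Q d = int m}"
proof (induction m)
  case 0
  have "{(d, w, a). right_normed Q d w a \<and> a \<noteq> (\<lambda>p. 0) \<and> height Q d = int 0} = {}"
    using right_normed_height[OF _ fin] by fastforce
  then show ?case by (simp only: finite.emptyI)
next
  case (Suc m)
  let ?R = "{(d, w, a). right_normed Q d w a \<and> a \<noteq> (\<lambda>p. 0) \<and> height Q d = int m}"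
  define K where "K i a = {n. fd_prod Q n (fd_gen Q i) a \<noteq> (\<lambda>p. 0)}" for i a
  have finK: "finite (K i a)" if ia: "i \<in> verts Q" "right_normed Q d w a" for i d w a
  proof -
    obtain N where N: "\<And>p q. (wz ^^ N) (\<lambda>p q. bracket Q (fd_gen Q i p) (a q)) p q = 0"
      using right_normed_local[OF ia(2,1)] unfolding fd_local_def by blast
    have "fd_prod Q n (fd_gen Q i) a = (\<lambda>p. 0)" if "n \<ge> N" for n
      using wz_pow_vanish_mono[OF N that] by (simp add: fun_eq_iff fd_prod_eq)
    then have "K i a \<subseteq> {..<N}"
      unfolding K_def using not_less by blast
    then show ?thesis by (rule finite_subset) simp
  qed
  define nxt where "nxt i x = (\<lambda>n. (basis_vec i + fst x, gen_weight Q i + fst (snd x) - of_nat n - 1,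
      fd_prod Q n (fd_gen Q i) (snd (snd x)))) ` K i (snd (snd x))" for i x
  have "finite (\<Union>i\<in>verts Q. \<Union>x\<in>?R. nxt i x)"
  proof (intro finite_UN_I fin Suc)
    fix i x assume "i \<in> verts Q" "x \<in> ?R"
    then show "finite (nxt i x)"
      unfolding nxt_def by (intro finite_imageI finK[of i "fst x" "fst (snd x)"]) auto
  qed
  moreover have "{(d, w, a). right_normed Q d w a \<and> a \<noteq> (\<lambda>p. 0) \<and> height Q d = int (Suc m)} \<subseteq>
      (\<lambda>i. (basis_vec i, gen_weight Q i, fd_gen Q i)) ` verts Q \<union> (\<Union>i\<in>verts Q. \<Union>x\<in>?R. nxt i x)"
  proof (intro subsetI)
    fix x assume "x \<in> {(d, w, a). right_normed Q d w a \<and> a \<noteq> (\<lambda>p. 0) \<and> height Q d = int (Suc m)}"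
    then obtain d w a where x: "x = (d, w, a)" "right_normed Q d w a" "a \<noteq> (\<lambda>p. 0)"
        "height Q d = int (Suc m)"
      by blast
    from x(2) show "x \<in> (\<lambda>i. (basis_vec i, gen_weight Q i, fd_gen Q i)) ` verts Q \<union> (\<Union>i\<in>verts Q. \<Union>x\<in>?R. nxt i x)"
    proof cases
      case (base i)
      then show ?thesis using x(1) by blast
    next
      case (step i d' w' b n)
      have "b \<noteq> (\<lambda>p. 0)"
        using x(3) step(3) fd_prod_zero_right by blast
      moreover have "height Q d' = int m"
        using x(4) step fin by (simp add: height_add height_basis_vec)
      ultimately have "(d', w', b) \<in> ?R" using step by simp
      moreover have "x \<in> nxt i (d', w', b)"
        using x(1,3) step by (auto simp: nxt_def K_def)
      ultimately show ?thesis using step by blast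
    qed
  qed
  ultimately show ?case
    using fin by (meson finite_UnI finite_imageI finite_subset)
qed

lemma finite_right_normed:
  assumes fin: "finite (verts Q)"
  shows "finite {(w, a). right_normed Q d w a \<and> a \<noteq> (\<lambda>p. 0)}"
proof (cases "\<exists>w a. right_normed Q d w a")
  case True
  then obtain m where m: "height Q d = int m"
    using right_normed_height[OF _ fin] by (metis int_nat_eq nonneg_int_cases order_trans zero_le_one)
  have "{(w, a). right_normed Q d w a \<and> a \<noteq> (\<lambda>p. 0)} \<subseteq>
      snd ` {(d, w, a). right_normed Q d w a \<and> a \<noteq> (\<lambda>p. 0) \<and> height Q d = int m}"
    using m by force
  then show ?thesis
    by (rule finite_subset) (rule finite_imageI[OF finite_right_normed_height[OF fin]])
qed simp

section \<open>Operators on the Lie algebra\<close>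

lemma flinear_lie_map: "flinear F \<Longrightarrow> flinear (lie_map Q F)"
  unfolding lie_map_def by (rule flinear_compose[OF flinear_quotient_map])

lemma lie_map_quotient_map:
  assumes "flinear F" "\<And>f. f \<in> lie_ideal Q \<Longrightarrow> F f \<in> lie_ideal Q"
  shows "lie_map Q F (quotient_map Q f) = quotient_map Q (F f)"
  unfolding lie_map_def by (rule quotient_map_descend[OF assms])

lemma lie_map_deriv_bracket:
  assumes pres: "\<And>f. f \<in> lie_ideal Q \<Longrightarrow> deriv c s f \<in> lie_ideal Q" and "x \<in> Lie Q" "y \<in> Lie Q"
  shows "lie_map Q (deriv c s) (bracket Q x y) =
    bracket Q (lie_map Q (deriv c s) x) y + bracket Q x (lie_map Q (deriv c s) y)"
proof -
  obtain f g where f: "f \<in> free_alg Q" "x = quotient_map Q f" and g: "g \<in> free_alg Q" "y = quotient_map Q g"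
    using assms(2,3) by (auto simp: Lie_def)
  note q = lie_map_quotient_map[OF flinear_deriv pres]
  show ?thesis
    by (simp add: f g q bracket_quotient_map deriv_fmult deriv_free_alg flinear_simps[OF flinear_quotient_map])
qed

definition lie_T :: "('i, 'a) pre_digraph \<Rightarrow> 'i free \<Rightarrow> 'i free" where
  "lie_T Q = lie_map Q z_deriv"

definition lie_P :: "('i, 'a) pre_digraph \<Rightarrow> 'i free \<Rightarrow> 'i free" where
  "lie_P Q = lie_map Q shift_deriv"

lemma flinear_lie_T: "flinear (lie_T Q)" and flinear_lie_P: "flinear (lie_P Q)"
  unfolding lie_T_def lie_P_def by (rule flinear_lie_map[OF flinear_deriv])+

lemmas lie_T_simps = flinear_simps[OF flinear_lie_T]
lemmas lie_P_simps = flinear_simps[OF flinear_lie_P]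

lemma lie_T_bracket:
  "x \<in> Lie Q \<Longrightarrow> y \<in> Lie Q \<Longrightarrow> lie_T Q (bracket Q x y) = bracket Q (lie_T Q x) y + bracket Q x (lie_T Q y)"
  unfolding lie_T_def by (rule lie_map_deriv_bracket[OF z_deriv_lie_ideal])

lemma lie_P_bracket:
  "x \<in> Lie Q \<Longrightarrow> y \<in> Lie Q \<Longrightarrow> lie_P Q (bracket Q x y) = bracket Q (lie_P Q x) y + bracket Q x (lie_P Q y)"
  unfolding lie_P_def by (rule lie_map_deriv_bracket[OF shift_deriv_lie_ideal])

lemma lie_T_fd_gen: "lie_T Q (fd_gen Q i p) = fscale (of_int (p + 1)) (fd_gen Q i (p + 1))"
  by (simp add: lie_T_def fd_gen_def gen_def lie_map_quotient_map[OF flinear_deriv z_deriv_lie_ideal]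
      flinear_simps[OF flinear_quotient_map] algebra_simps)

lemma lie_P_fd_gen: "lie_P Q (fd_gen Q i p) = fd_gen Q i (p - 1)"
  by (simp add: lie_P_def fd_gen_def gen_def lie_map_quotient_map[OF flinear_deriv shift_deriv_lie_ideal]
      flinear_simps[OF flinear_quotient_map] algebra_simps)

lemma lie_T_Lie: "x \<in> Lie Q \<Longrightarrow> lie_T Q x \<in> Lie Q"
  by (auto simp: Lie_def lie_T_def lie_map_quotient_map[OF flinear_deriv z_deriv_lie_ideal] deriv_free_alg)

definition lie_proj :: "('i, 'a) pre_digraph \<Rightarrow> ('i \<Rightarrow> int) \<Rightarrow> rat \<Rightarrow> 'i free \<Rightarrow> 'i free" where
  "lie_proj Q d w = lie_map Q (proj Q d w)"

lemma flinear_lie_proj: "flinear (lie_proj Q d w)"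
  unfolding lie_proj_def by (rule flinear_lie_map[OF flinear_proj])

lemmas lie_proj_simps = flinear_simps[OF flinear_lie_proj]

lemma lie_proj_gpiece:
  "x \<in> gpiece Q e v \<Longrightarrow> lie_proj Q d w x = (if e = d \<and> v = w then x else 0)"
proof (induction rule: piece_induct)
  case (base t)
  have "lie_proj Q d w (quotient_map Q (fbasis t)) = quotient_map Q (proj Q d w (fbasis t))"
    unfolding lie_proj_def by (rule lie_map_quotient_map[OF flinear_proj proj_lie_ideal])
  then show ?case
    using base by (auto simp: grade_def flinear_simps[OF flinear_quotient_map])
qed (simp_all add: lie_proj_simps)

section \<open>Homogeneous elements of the conformal algebra\<close>

text \<open>The product rule for \<open>\<partial>_w\<close> and \<open>(w - z)^n\<close>. At
  \<open>n = 0\<close> the truncated \<open>n - 1\<close> does no harm, its coefficient being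
  0.\<close>

lemma wz_pow_wderiv:
  fixes D :: "int \<Rightarrow> int \<Rightarrow> ('x \<Rightarrow>\<^sub>0 rat)"
  shows "(wz ^^ n) (\<lambda>p q. fscale (of_int (p + 1)) (D (p + 1) q)) p q =
    fscale (of_int (p + 1)) ((wz ^^ n) D (p + 1) q) - fscale (of_nat n) ((wz ^^ (n - 1)) D p q)"
proof (induction n arbitrary: p q)
  case (Suc n)
  have "fscale (of_nat n) ((wz ^^ (n - 1)) D (p - 1) q) - fscale (of_nat n) ((wz ^^ (n - 1)) D p (q - 1))
      = fscale (of_nat n) ((wz ^^ n) D p q)"
    by (cases n) (simp_all add: wz_pow_Suc free.scale_right_diff_distrib del: funpow.simps(2))
  then show ?case
    unfolding wz_pow_Suc Suc.IH
    by (simp add: algebra_simps free.scale_left_distrib free.scale_left_diff_distrib free.scale_right_diff_distrib)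
qed simp

lemma wz_pow_zderiv:
  fixes D :: "int \<Rightarrow> int \<Rightarrow> ('x \<Rightarrow>\<^sub>0 rat)"
  shows "(wz ^^ n) (\<lambda>p q. fscale (of_int (q + 1)) (D p (q + 1))) p q =
    fscale (of_int (q + 1)) ((wz ^^ n) D p (q + 1)) + fscale (of_nat n) ((wz ^^ (n - 1)) D p q)"
proof (induction n arbitrary: p q)
  case (Suc n)
  have "fscale (of_nat n) ((wz ^^ (n - 1)) D (p - 1) q) - fscale (of_nat n) ((wz ^^ (n - 1)) D p (q - 1))
      = fscale (of_nat n) ((wz ^^ n) D p q)"
    by (cases n) (simp_all add: wz_pow_Suc free.scale_right_diff_distrib del: funpow.simps(2))
  then show ?case
    unfolding wz_pow_Suc Suc.IH
    by (simp add: algebra_simps free.scale_left_distrib free.scale_left_diff_distrib free.scale_right_diff_distrib)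
qed simp

text \<open>A total derivative in \<open>w\<close> has no residue, so only the correction term of
  the product rule survives.\<close>

lemma fd_prod_deriv_left:
  "fd_prod Q n (fd_deriv a) b = (\<lambda>q. fscale (- of_nat n) (fd_prod Q (n - 1) a b q))"
  using wz_pow_wderiv[of n "\<lambda>p q. bracket Q (a p) (b q)" "- 1"]
  by (simp add: fun_eq_iff fd_prod_eq fd_deriv_def bracket_left_simps)

lemma fd_prod_deriv_right:
  "fd_prod Q n a (fd_deriv b) = (\<lambda>q. fd_deriv (fd_prod Q n a b) q + fscale (of_nat n) (fd_prod Q (n - 1) a b q))"
  using wz_pow_zderiv[of n "\<lambda>p q. bracket Q (a p) (b q)" "- 1"]
  by (simp add: fun_eq_iff fd_prod_eq fd_deriv_def bracket_right_simps)

lemma fd_prod_add_left: "fd_prod Q n (\<lambda>p. a p + a' p) b = (\<lambda>q. fd_prod Q n a b q + fd_prod Q n a' b q)"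
  by (simp add: fun_eq_iff fd_prod_eq bracket_left_simps wz_pow_add)

lemma fd_prod_add_right: "fd_prod Q n a (\<lambda>p. b p + b' p) = (\<lambda>q. fd_prod Q n a b q + fd_prod Q n a b' q)"
  by (simp add: fun_eq_iff fd_prod_eq bracket_right_simps wz_pow_add)

lemma wz_pow_fscale:
  fixes D :: "int \<Rightarrow> int \<Rightarrow> ('x \<Rightarrow>\<^sub>0 rat)"
  shows "(wz ^^ n) (\<lambda>p q. fscale c (D p q)) p q = fscale c ((wz ^^ n) D p q)"
  by (rule wz_pow_additive) (rule free.scale_right_diff_distrib)

lemma fd_prod_scale_left: "fd_prod Q n (\<lambda>p. fscale c (a p)) b = (\<lambda>q. fscale c (fd_prod Q n a b q))"
  by (simp add: fun_eq_iff fd_prod_eq bracket_left_simps wz_pow_fscale)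

lemma fd_prod_scale_right: "fd_prod Q n a (\<lambda>p. fscale c (b p)) = (\<lambda>q. fscale c (fd_prod Q n a b q))"
  by (simp add: fun_eq_iff fd_prod_eq bracket_right_simps wz_pow_fscale)

lemma fd_prod_zero_left: "fd_prod Q n (\<lambda>p. 0) b = (\<lambda>p. 0)"
  by (simp add: fun_eq_iff fd_prod_eq bracket_left_simps wz_pow_0)

text \<open>The combinations of derivatives of right-normed products, with the weight
  \<open>w\<close> of the constant coefficient. They turn out to be closed under all products, so
  every element of \<open>conformal Q\<close> is a finite sum of them.\<close>

inductive hom_conformalp :: "('i, 'a) pre_digraph \<Rightarrow> ('i \<Rightarrow> int) \<Rightarrow> rat \<Rightarrow> (int \<Rightarrow> 'i free) \<Rightarrow> bool"
  for Q :: "('i, 'a) pre_digraph" and d :: "'i \<Rightarrow> int" where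
  right_normed: "right_normed Q d w a \<Longrightarrow> hom_conformalp Q d w a"
| zero: "hom_conformalp Q d w (\<lambda>p. 0)"
| add: "hom_conformalp Q d w a \<Longrightarrow> hom_conformalp Q d w b \<Longrightarrow> hom_conformalp Q d w (\<lambda>p. a p + b p)"
| scale: "hom_conformalp Q d w a \<Longrightarrow> hom_conformalp Q d w (\<lambda>p. fscale c (a p))"
| deriv: "hom_conformalp Q d w a \<Longrightarrow> hom_conformalp Q d (w + 1) (fd_deriv a)"

definition hom_conformal :: "('i, 'a) pre_digraph \<Rightarrow> ('i \<Rightarrow> int) \<Rightarrow> rat \<Rightarrow> (int \<Rightarrow> 'i free) set" where
  "hom_conformal Q d w = Collect (hom_conformalp Q d w)"

lemma hom_conformal_iff: "hom_conformalp Q d w a \<longleftrightarrow> a \<in> hom_conformal Q d w"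
  by (simp add: hom_conformal_def)

lemmas hom_conformal_right_normed = hom_conformalp.right_normed[unfolded hom_conformal_iff]
lemmas hom_conformal_zero = hom_conformalp.zero[unfolded hom_conformal_iff]
lemmas hom_conformal_add = hom_conformalp.add[unfolded hom_conformal_iff]
lemmas hom_conformal_scale = hom_conformalp.scale[unfolded hom_conformal_iff]
lemmas hom_conformal_deriv = hom_conformalp.deriv[unfolded hom_conformal_iff]
lemmas hom_conformal_induct [consumes 1, case_names right_normed zero add scale deriv] =
  hom_conformalp.induct[unfolded hom_conformal_iff]

lemma hom_conformal_gpiece: "a \<in> hom_conformal Q d w \<Longrightarrow> a p \<in> gpiece Q d (w + of_int p)"
proof (induction arbitrary: p rule: hom_conformal_induct)
  case (deriv w a)
  have e: "w + 1 + of_int p = w + of_int (p + 1)" by simp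
  show ?case
    unfolding e fd_deriv_def by (intro free.subspace_scale subspace_piece deriv.IH)
qed (auto intro: right_normed_gpiece free.subspace_0 free.subspace_add free.subspace_scale subspace_piece)

lemma hom_conformal_Lie: "a \<in> hom_conformal Q d w \<Longrightarrow> a p \<in> Lie Q"
  by (rule subsetD[OF piece_subset_Lie hom_conformal_gpiece])

text \<open>In a fixed degree there are finitely many nonzero right-normed products, and derivatives
  only raise the weight.\<close>

lemma hom_conformal_bounded_below:
  assumes "finite (verts Q)"
  shows "\<exists>w0. \<forall>w<w0. \<forall>a\<in>hom_conformal Q d w. a = (\<lambda>p. 0)"
proof -
  let ?S = "{(w, a). right_normed Q d w a \<and> a \<noteq> (\<lambda>p. 0)}"
  obtain w0 where w0: "\<And>w. w \<in> fst ` ?S \<Longrightarrow> w0 \<le> w"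
    using finite_right_normed[OF assms, of d] Min_le[of "fst ` ?S"] by blast
  have low: "a = (\<lambda>p. 0)" if "right_normed Q d w a" "w < w0" for w a
  proof (rule ccontr)
    assume "a \<noteq> (\<lambda>p. 0)"
    then have "w \<in> fst ` ?S" using that(1) by (intro image_eqI[of _ _ "(w, a)"]) auto
    then show False using w0[of w] that(2) by simp
  qed
  have "a = (\<lambda>p. 0)" if "a \<in> hom_conformal Q d w" "w < w0" for w a
    using that
  proof (induction rule: hom_conformal_induct)
    case (right_normed w a)
    then show ?case using low by blast
  next
    case (deriv w a)
    then have "a = (\<lambda>p. 0)" by simp
    then show ?case by (simp add: fd_deriv_def)
  qed simp_all
  then show ?thesis by blast
qed

lemma hom_conformal_prod_gen:
  assumes i: "i \<in> verts Q" and a: "a \<in> hom_conformal Q d w"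
  shows "fd_prod Q n (fd_gen Q i) a \<in> hom_conformal Q (basis_vec i + d) (gen_weight Q i + w - of_nat n - 1)"
  using a
proof (induction arbitrary: n rule: hom_conformal_induct)
  case (right_normed w a)
  then show ?case by (intro hom_conformal_right_normed right_normed.step i)
next
  case (deriv w a)
  \<comment> \<open>For \<open>n = 0\<close> the truncated \<open>n - 1\<close> would give a product
    of the wrong weight, but its coefficient is 0.\<close>
  show ?case
  proof (cases n)
    case 0
    then show ?thesis using hom_conformal_deriv[OF deriv.IH[of 0]]
      by (simp add: fd_prod_deriv_right algebra_simps)
  next
    case (Suc m)
    have "fd_deriv (fd_prod Q n (fd_gen Q i) a) \<in> hom_conformal Q (basis_vec i + d) (gen_weight Q i + (w + 1) - of_nat n - 1)"
      using hom_conformal_deriv[OF deriv.IH[of n]] by (simp add: algebra_simps)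
    moreover have "fd_prod Q (n - 1) (fd_gen Q i) a \<in> hom_conformal Q (basis_vec i + d) (gen_weight Q i + (w + 1) - of_nat n - 1)"
      using deriv.IH[of m] Suc by (simp add: algebra_simps)
    ultimately show ?thesis
      unfolding fd_prod_deriv_right by (intro hom_conformal_add hom_conformal_scale)
  qed
qed (auto simp: fd_prod_zero_right fd_prod_add_right fd_prod_scale_right intro: hom_conformal_zero hom_conformal_add hom_conformal_scale)

text \<open>The Jacobi identity for \<open>[[a(u), b(w)], c(z)]\<close>, multiplied by \<open>(u - z)\<^sup>p (w - z)\<^sup>q\<close>.\<close>

lemma tri_0_bracket:
  assumes "\<And>u. a u \<in> piece Q {t. ldeg t = d}" "\<And>u. b u \<in> piece Q {t. ldeg t = e}" "\<And>u. c u \<in> Lie Q"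
  shows "tri 0 p q (\<lambda>u w z. bracket Q (bracket Q (a u) (b w)) (c z)) (- 1) (- 1) z =
    fd_prod Q p a (fd_prod Q q b c) z + fscale (- euler_sign Q d e) (fd_prod Q q b (fd_prod Q p a c) z)"
proof -
  define E1 where "E1 u w z = bracket Q (a u) (bracket Q (b w) (c z))" for u w z
  define E2 where "E2 u w z = bracket Q (b w) (bracket Q (a u) (c z))" for u w z
  have D: "(\<lambda>u w z. bracket Q (bracket Q (a u) (b w)) (c z))
      = (\<lambda>u w z. E1 u w z + fscale (- euler_sign Q d e) (E2 u w z))"
    using bracket_jacobi[OF assms] by (simp add: E1_def E2_def fun_eq_iff)
  have wz3_add: "(wz3 ^^ q) (\<lambda>u w z. E u w z + E' u w z) = (\<lambda>u w z. (wz3 ^^ q) E u w z + (wz3 ^^ q) E' u w z)"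
    for E E' :: "int \<Rightarrow> int \<Rightarrow> int \<Rightarrow> 'a free"
    by (simp add: wz3_pow wz_pow_add fun_eq_iff)
  have tri_D: "tri 0 p q (\<lambda>u w z. E u w z + fscale s (E' u w z)) u w z
      = tri 0 p q E u w z + fscale s (tri 0 p q E' u w z)" for E E' :: "int \<Rightarrow> int \<Rightarrow> int \<Rightarrow> 'a free" and s u w z
    by (simp add: tri_def wz3_add uz_pow_add) (simp add: wz3_pow uz_pow wz_pow_fscale)
  have "tri 0 p q E1 (- 1) (- 1) z = fd_prod Q p a (fd_prod Q q b c) z"
    by (simp add: tri_def wz3_pow uz_pow E1_def[abs_def] wz_pow_bracket_right fd_prod_eq)
  moreover have "tri 0 p q E2 (- 1) (- 1) z = fd_prod Q q b (fd_prod Q p a c) z"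
    by (simp add: tri_def uz_wz3_pow) (simp add: wz3_pow uz_pow E2_def[abs_def] wz_pow_bracket_right fd_prod_eq)
  ultimately show ?thesis by (simp only: D tri_D)
qed

lemma tri_fd_prod:
  "tri m 0 n (\<lambda>u w z. bracket Q (bracket Q (a u) (b w)) (c z)) (- 1) (- 1) z
    = fd_prod Q n (fd_prod Q m a b) c z"
  by (simp add: tri_def uw_wz3_pow) (simp add: wz3_pow uw_pow wz_pow_bracket_left fd_prod_eq)

text \<open>The product of a product is brought into right-normed form. Powers of
  \<open>u - w\<close> are traded for powers of \<open>u - z\<close> and \<open>w - z\<close>
  through \<open>u - w = (u - z) - (w - z)\<close>; once none is left, \<open>tri_0_bracket\<close>
  expresses the result by nested products covered by the induction hypothesis.\<close>

lemma hom_conformal_prod_right_normed: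
  assumes "right_normed Q d w a" "b \<in> hom_conformal Q e v"
  shows "fd_prod Q n a b \<in> hom_conformal Q (d + e) (w + v - of_nat n - 1)"
  using assms
proof (induction arbitrary: e v b n rule: right_normed.induct)
  case (step i d w a m)
  define D where "D = (\<lambda>u w z. bracket Q (bracket Q (fd_gen Q i u) (a w)) (b z))"
  have V: "(\<lambda>z. tri r p q D (- 1) (- 1) z) \<in>
      hom_conformal Q (basis_vec i + d + e) (gen_weight Q i + w + v - of_nat r - of_nat p - of_nat q - 2)" for r p q
  proof (induction r arbitrary: p q)
    case 0
    have 1: "fd_prod Q p (fd_gen Q i) (fd_prod Q q a b) \<in>
        hom_conformal Q (basis_vec i + d + e) (gen_weight Q i + w + v - of_nat p - of_nat q - 2)"
      using hom_conformal_prod_gen[OF step.hyps(1) step.IH[OF step.prems, of q], of p]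
      by (simp add: algebra_simps)
    have 2: "fd_prod Q q a (fd_prod Q p (fd_gen Q i) b) \<in>
        hom_conformal Q (basis_vec i + d + e) (gen_weight Q i + w + v - of_nat p - of_nat q - 2)"
      using step.IH[OF hom_conformal_prod_gen[OF step.hyps(1) step.prems, of p], of q]
      by (simp add: algebra_simps)
    have "(\<lambda>z. tri 0 p q D (- 1) (- 1) z) = (\<lambda>z. fd_prod Q p (fd_gen Q i) (fd_prod Q q a b) z +
        fscale (- euler_sign Q (basis_vec i) d) (fd_prod Q q a (fd_prod Q p (fd_gen Q i) b) z))"
      unfolding D_def
      by (rule ext, rule tri_0_bracket[OF fd_gen_deg[OF step.hyps(1)]
          right_normed_deg[OF step.hyps(2)] hom_conformal_Lie[OF step.prems]])
    then show ?case
      using hom_conformal_add[OF 1 hom_conformal_scale[OF 2]] by (simp only: of_nat_0 diff_zero)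
  next
    case (Suc r)
    have e: "(\<lambda>z. tri (Suc r) p q D (- 1) (- 1) z) =
        (\<lambda>z. tri r (Suc p) q D (- 1) (- 1) z + fscale (- 1) (tri r p (Suc q) D (- 1) (- 1) z))"
      by (simp add: tri_uz)
    show ?case
      unfolding e using Suc.IH[of "Suc p" q] Suc.IH[of p "Suc q"]
      by (intro hom_conformal_add hom_conformal_scale) (simp_all add: algebra_simps)
  qed
  show ?case using V[of m 0 n] by (simp add: D_def tri_fd_prod algebra_simps)
qed (rule hom_conformal_prod_gen)

lemma hom_conformal_prod:
  assumes "a \<in> hom_conformal Q d w" "b \<in> hom_conformal Q e v"
  shows "fd_prod Q n a b \<in> hom_conformal Q (d + e) (w + v - of_nat n - 1)"
  using assms(1)
proof (induction arbitrary: n rule: hom_conformal_induct)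
  case (right_normed w a)
  then show ?case using assms(2) by (rule hom_conformal_prod_right_normed)
next
  case (deriv w a)
  show ?case
  proof (cases n)
    case 0
    then show ?thesis by (simp add: fd_prod_deriv_left hom_conformal_zero)
  next
    case (Suc m)
    have "fd_prod Q (n - 1) a b \<in> hom_conformal Q (d + e) (w + 1 + v - of_nat n - 1)"
      using deriv.IH[of m] Suc by (simp add: algebra_simps)
    then show ?thesis
      unfolding fd_prod_deriv_left by (rule hom_conformal_scale)
  qed
qed (auto simp: fd_prod_zero_left fd_prod_add_left fd_prod_scale_left intro: hom_conformal_zero hom_conformal_add hom_conformal_scale)

text \<open>The closure defining \<open>conformal Q\<close> ignores the grading; finite sums of
  homogeneous distributions absorb it.\<close>

inductive_set sum_conformal :: "('i, 'a) pre_digraph \<Rightarrow> (int \<Rightarrow> 'i free) set"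
  for Q :: "('i, 'a) pre_digraph" where
  hom: "a \<in> hom_conformal Q d w \<Longrightarrow> a \<in> sum_conformal Q"
| add: "a \<in> sum_conformal Q \<Longrightarrow> b \<in> sum_conformal Q \<Longrightarrow> (\<lambda>p. a p + b p) \<in> sum_conformal Q"

lemma sum_conformal_prod:
  "a \<in> sum_conformal Q \<Longrightarrow> b \<in> sum_conformal Q \<Longrightarrow> fd_prod Q n a b \<in> sum_conformal Q"
proof (induction rule: sum_conformal.induct)
  case (hom a d w)
  from hom(2) show ?case
  proof (induction rule: sum_conformal.induct)
    case (hom b e v)
    show ?case
      by (rule sum_conformal.hom[OF hom_conformal_prod[OF \<open>a \<in> hom_conformal Q d w\<close> hom]])
  qed (simp add: fd_prod_add_right sum_conformal.add)
qed (simp add: fd_prod_add_left sum_conformal.add)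

lemma conformal_subset_sum_conformal: "a \<in> conformal Q \<Longrightarrow> a \<in> sum_conformal Q"
proof (induction rule: conformal.induct)
  case (base i)
  show ?case
    by (rule sum_conformal.hom[OF hom_conformal_right_normed[OF right_normed.base[OF base]]])
next
  case zero
  then show ?case by (rule sum_conformal.hom[OF hom_conformal_zero])
next
  case (scale a c)
  from scale(2) show ?case
  proof (induction rule: sum_conformal.induct)
    case (hom a d w)
    show ?case by (rule sum_conformal.hom[OF hom_conformal_scale[OF hom]])
  next
    case (add a b)
    then show ?case using sum_conformal.add by (simp add: free.scale_right_distrib)
  qed
next
  case (deriv a)
  from deriv(2) show ?case
  proof (induction rule: sum_conformal.induct)
    case (hom a d w)
    show ?case by (rule sum_conformal.hom[OF hom_conformal_deriv[OF hom]])
  next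
    case (add a b)
    then show ?case using sum_conformal.add[OF add.IH]
      by (simp add: fd_deriv_def free.scale_right_distrib)
  qed
qed (auto intro: sum_conformal.add sum_conformal_prod)

lemma sum_conformal_proj:
  "a \<in> sum_conformal Q \<Longrightarrow> \<exists>b\<in>hom_conformal Q d w. b 0 = lie_proj Q d w (a 0)"
proof (induction rule: sum_conformal.induct)
  case (hom a e v)
  then show ?case
    using lie_proj_gpiece[OF hom_conformal_gpiece[OF hom, of 0], of d w] hom_conformal_zero[of Q d w]
    by (cases "e = d \<and> v = w") auto
next
  case (add a b)
  then obtain a' b' where "a' \<in> hom_conformal Q d w" "a' 0 = lie_proj Q d w (a 0)"
    "b' \<in> hom_conformal Q d w" "b' 0 = lie_proj Q d w (b 0)"
    by blast
  then show ?case
    by (intro bexI[of _ "\<lambda>p. a' p + b' p"]) (simp_all add: lie_proj_simps hom_conformal_add)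
qed

text \<open>The distribution is a sum of homogeneous ones; projecting its constant coefficient to
  degree \<open>d\<close> and weight \<open>w\<close> keeps only the summands of that degree and
  weight.\<close>

lemma Lie_minus_gpiece:
  assumes "x \<in> Lie_minus Q" "x \<in> gpiece Q d w"
  shows "\<exists>a\<in>hom_conformal Q d w. a 0 = x"
proof -
  obtain a where a: "a \<in> conformal Q" "x = a 0"
    using assms(1) by (auto simp: Lie_minus_def fd_res_def fd_div_z_def)
  then show ?thesis
    using sum_conformal_proj[OF conformal_subset_sum_conformal[OF a(1)], of d w]
      lie_proj_gpiece[OF assms(2), of d w] by simp
qed

section \<open>The action of the derivations on the conformal algebra\<close>

text \<open>Both sides agree on generators, and being a derivation \<open>T\<close> acts on
  \<open>[a(w), b(z)]\<close> as \<open>\<partial>_w + \<partial>_z\<close>.\<close>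

lemma lie_T_hom_conformal: "a \<in> hom_conformal Q d w \<Longrightarrow> lie_T Q (a p) = fd_deriv a p"
proof (induction arbitrary: p rule: hom_conformal_induct)
  case (right_normed w a)
  then show ?case
  proof (induction arbitrary: p rule: right_normed.induct)
    case (base i)
    then show ?case by (simp add: lie_T_fd_gen fd_deriv_def)
  next
    case (step i d w a n)
    let ?D = "\<lambda>p q. bracket Q (fd_gen Q i p) (a q)"
    have Lie: "fd_gen Q i p \<in> Lie Q" "a q \<in> Lie Q" for p q
      using right_normed_Lie[OF right_normed.base[OF step.hyps(1)]] right_normed_Lie[OF step.hyps(2)] by auto
    have "lie_T Q (fd_prod Q n (fd_gen Q i) a p) = (wz ^^ n) (\<lambda>p q. lie_T Q (?D p q)) (- 1) p"
      by (simp add: fd_prod_eq wz_pow_additive[of "lie_T Q", OF lie_T_simps(4)])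
    moreover have "(\<lambda>p q. lie_T Q (?D p q)) =
        (\<lambda>p q. fscale (of_int (p + 1)) (?D (p + 1) q) + fscale (of_int (q + 1)) (?D p (q + 1)))"
      by (simp add: fun_eq_iff lie_T_bracket Lie lie_T_fd_gen step.IH fd_deriv_def
          bracket_left_simps bracket_right_simps)
    \<comment> \<open>The correction terms of the two product rules cancel, and
      \<open>\<partial>_w\<close> contributes nothing at \<open>w^(-1)\<close>.\<close>
    moreover have "(wz ^^ n) (\<lambda>p q. fscale (of_int (p + 1)) (?D (p + 1) q) + fscale (of_int (q + 1)) (?D p (q + 1))) (- 1) p
        = fscale (of_int (p + 1)) ((wz ^^ n) ?D (- 1) (p + 1))"
      using wz_pow_wderiv[of n ?D "- 1" p] wz_pow_zderiv[of n ?D "- 1" p]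
      by (simp only: wz_pow_add) simp
    ultimately show ?case by (simp add: fd_deriv_def fd_prod_eq)
  qed
qed (simp_all add: fd_deriv_def lie_T_simps free.scale_right_distrib mult.commute)

text \<open>Since \<open>P\<close> multiplies each of the \<open>height Q d\<close> generating distributions in a product by its
  variable, it acts on an element of degree \<open>d\<close> as \<open>height Q d\<close> times multiplication by \<open>z\<close>, up to
  an element of lower weight.\<close>

definition P_defect :: "('i, 'a) pre_digraph \<Rightarrow> ('i \<Rightarrow> int) \<Rightarrow> (int \<Rightarrow> 'i free) \<Rightarrow> int \<Rightarrow> 'i free" where
  "P_defect Q d a = (\<lambda>p. lie_P Q (a p) - fscale (of_int (height Q d)) (a (p - 1)))"

lemma P_defect_right_normed:
  assumes fin: "finite (verts Q)" and a: "right_normed Q d w a"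
  shows "P_defect Q d a \<in> hom_conformal Q d (w - 1)"
  using a
proof (induction rule: right_normed.induct)
  case (base i)
  then have "P_defect Q (basis_vec i) (fd_gen Q i) = (\<lambda>p. 0)"
    using fin by (simp add: P_defect_def lie_P_fd_gen height_basis_vec)
  then show ?case by (simp add: hom_conformal_zero)
next
  case (step i d w a n)
  let ?D = "\<lambda>p q. bracket Q (fd_gen Q i p) (a q)" and ?h = "of_int (height Q d) :: rat"
  have Lie: "fd_gen Q i p \<in> Lie Q" "a q \<in> Lie Q" for p q
    using right_normed_Lie[OF right_normed.base[OF step.hyps(1)]] right_normed_Lie[OF step.hyps(2)] by auto
  have P: "lie_P Q (a q) = P_defect Q d a q + fscale ?h (a (q - 1))" for q
    by (simp add: P_defect_def)
  have "P_defect Q (basis_vec i + d) (fd_prod Q n (fd_gen Q i) a) q =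
      fd_prod Q n (fd_gen Q i) (P_defect Q d a) q + fd_prod Q (Suc n) (fd_gen Q i) a q" for q
  proof -
    have "lie_P Q (fd_prod Q n (fd_gen Q i) a q) = (wz ^^ n) (\<lambda>p q. lie_P Q (?D p q)) (- 1) q"
      by (simp add: fd_prod_eq wz_pow_additive[of "lie_P Q", OF lie_P_simps(4)])
    moreover have "(\<lambda>p q. lie_P Q (?D p q)) = (\<lambda>p q. (?D (p - 1) q + fscale ?h (?D p (q - 1)))
        + bracket Q (fd_gen Q i p) (P_defect Q d a q))"
      by (simp add: fun_eq_iff lie_P_bracket Lie lie_P_fd_gen P bracket_right_simps algebra_simps)
    moreover have "(wz ^^ n) (\<lambda>p q. (?D (p - 1) q + fscale ?h (?D p (q - 1)))
        + bracket Q (fd_gen Q i p) (P_defect Q d a q)) (- 1) q = (wz ^^ n) ?D (- 1 - 1) q + fscale ?h ((wz ^^ n) ?D (- 1) (q - 1))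
        + fd_prod Q n (fd_gen Q i) (P_defect Q d a) q"
      using wz_pow_shift[of n ?D "- 1" 0 "- 1" q] wz_pow_shift[of n ?D 0 "- 1" "- 1" q]
      by (simp add: wz_pow_add wz_pow_fscale fd_prod_eq)
    ultimately have "lie_P Q (fd_prod Q n (fd_gen Q i) a q) = (wz ^^ n) ?D (- 1 - 1) q + fscale ?h ((wz ^^ n) ?D (- 1) (q - 1))
        + fd_prod Q n (fd_gen Q i) (P_defect Q d a) q"
      by (simp only:)
    moreover have "height Q (basis_vec i + d) = 1 + height Q d"
      using fin step.hyps(1) by (simp add: height_add height_basis_vec)
    \<comment> \<open>Multiplication by \<open>w\<close> is multiplication by \<open>z\<close> plus
      that by \<open>w - z\<close>: the first raises the multiple \<open>height Q d\<close> of
      \<open>z\<close> by 1, the second produces the product of index \<open>Suc n\<close>, of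
      weight one less.\<close>
    moreover have "fd_prod Q (Suc n) (fd_gen Q i) a q = (wz ^^ n) ?D (- 1 - 1) q - (wz ^^ n) ?D (- 1) (q - 1)"
      unfolding fd_prod_eq wz_pow_Suc ..
    ultimately show ?thesis
      by (simp add: P_defect_def free.scale_left_distrib fd_prod_eq[of Q n "fd_gen Q i" a])
  qed
  then have e: "P_defect Q (basis_vec i + d) (fd_prod Q n (fd_gen Q i) a) =
      (\<lambda>q. fd_prod Q n (fd_gen Q i) (P_defect Q d a) q + fd_prod Q (Suc n) (fd_gen Q i) a q)"
    by auto
  have "fd_prod Q n (fd_gen Q i) (P_defect Q d a) \<in>
      hom_conformal Q (basis_vec i + d) (gen_weight Q i + w - of_nat n - 1 - 1)"
    using hom_conformal_prod_gen[OF step.hyps(1) step.IH, of n] by (simp add: algebra_simps)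
  moreover have "fd_prod Q (Suc n) (fd_gen Q i) a \<in>
      hom_conformal Q (basis_vec i + d) (gen_weight Q i + w - of_nat n - 1 - 1)"
    using hom_conformal_prod_gen[OF step.hyps(1) hom_conformal_right_normed[OF step.hyps(2)], of "Suc n"]
    by (simp add: algebra_simps)
  ultimately show ?case unfolding e by (rule hom_conformal_add)
qed

lemma P_defect_hom_conformal:
  assumes fin: "finite (verts Q)" and a: "a \<in> hom_conformal Q d w"
  shows "P_defect Q d a \<in> hom_conformal Q d (w - 1)"
  using a
proof (induction rule: hom_conformal_induct)
  case (right_normed w a)
  then show ?case by (rule P_defect_right_normed[OF fin])
next
  case zero
  then show ?case by (simp add: P_defect_def lie_P_simps hom_conformal_zero)
next
  case (add w a b)
  have "P_defect Q d (\<lambda>p. a p + b p) = (\<lambda>p. P_defect Q d a p + P_defect Q d b p)"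
    by (simp add: P_defect_def lie_P_simps free.scale_right_distrib fun_eq_iff)
  then show ?case using hom_conformal_add[OF add.IH] by simp
next
  case (scale w a c)
  have "P_defect Q d (\<lambda>p. fscale c (a p)) = (\<lambda>p. fscale c (P_defect Q d a p))"
    by (simp add: P_defect_def lie_P_simps free.scale_right_diff_distrib mult.commute)
  then show ?case using hom_conformal_scale[OF scale.IH] by simp
next
  case (deriv w a)
  \<comment> \<open>The second summand comes from
    \<open>\<partial>(z a) = a + z \<partial>a\<close>.\<close>
  have "P_defect Q d (fd_deriv a) = (\<lambda>p. fd_deriv (P_defect Q d a) p + fscale (of_int (height Q d)) (a p))"
    by (simp add: P_defect_def fd_deriv_def lie_P_simps free.scale_right_diff_distrib
        free.scale_left_distrib fun_eq_iff algebra_simps)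
  then show ?case
    using hom_conformal_add[OF hom_conformal_deriv[OF deriv.IH]] hom_conformal_scale[OF deriv.hyps] by simp
qed

section \<open>The two halves of the Lie algebra\<close>

lemma right_normed_conformal: "right_normed Q d w a \<Longrightarrow> a \<in> conformal Q"
  by (induction rule: right_normed.induct) (auto intro: conformal.base conformal.prod)

lemma subspace_Lie_plus: "free.subspace (Lie_plus Q)"
  unfolding free.subspace_def Lie_plus_def
  by (auto intro: lie_generated.zero lie_generated.add lie_generated.scale)

lemma fd_gen_Lie_plus: "i \<in> verts Q \<Longrightarrow> p < 0 \<Longrightarrow> fd_gen Q i p \<in> Lie_plus Q"
  unfolding Lie_plus_def fd_gen_def by (rule lie_generated.base) force

text \<open>The coefficient at \<open>p < 0\<close> of a product involves only exponents at most
  \<open>- 1\<close> in \<open>w\<close> and at most \<open>p\<close> in \<open>z\<close>, so both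
  factors stay at negative powers, that is, at generators \<open>i(n)\<close> with
  \<open>n \<ge> 0\<close>.\<close>

lemma right_normed_Lie_plus: "right_normed Q d w a \<Longrightarrow> p < 0 \<Longrightarrow> a p \<in> Lie_plus Q"
proof (induction arbitrary: p rule: right_normed.induct)
  case (step i d w a n)
  show ?case
    unfolding fd_prod_eq
  proof (rule wz_pow_mem)
    fix r s :: int assume "r \<le> - 1" "s \<le> p"
    then show "bracket Q (fd_gen Q i r) (a s) \<in> Lie_plus Q"
      using fd_gen_Lie_plus[OF step.hyps(1), of r] step.IH[of s] step.prems
      by (auto simp: Lie_plus_def intro: lie_generated.bracket)
  qed (rule free.subspace_diff[OF subspace_Lie_plus])
qed (rule fd_gen_Lie_plus)

lemma Lie_minus_iff: "x \<in> Lie_minus Q \<longleftrightarrow> (\<exists>a\<in>conformal Q. x = a 0)"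
  by (auto simp: Lie_minus_def fd_res_def fd_div_z_def)

lemma subspace_Lie_minus: "free.subspace (Lie_minus Q)"
  unfolding free.subspace_def
proof (intro conjI ballI allI)
  show "0 \<in> Lie_minus Q"
    unfolding Lie_minus_iff by (rule bexI[OF _ conformal.zero]) simp
next
  fix x y assume "x \<in> Lie_minus Q" "y \<in> Lie_minus Q"
  then obtain a b where "a \<in> conformal Q" "x = a 0" "b \<in> conformal Q" "y = b 0"
    unfolding Lie_minus_iff by blast
  then show "x + y \<in> Lie_minus Q"
    unfolding Lie_minus_iff by (intro bexI[OF _ conformal.add[of a Q b]]) auto
next
  fix c x assume "x \<in> Lie_minus Q"
  then obtain a where "a \<in> conformal Q" "x = a 0"
    unfolding Lie_minus_iff by blast
  then show "fscale c x \<in> Lie_minus Q"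
    unfolding Lie_minus_iff by (intro bexI[OF _ conformal.scale[of a Q c]]) auto
qed

text \<open>The coefficient of \<open>z^j\<close> is the constant coefficient of
  \<open>\<partial>^j a / j!\<close>.\<close>

lemma conformal_Lie_minus: "a \<in> conformal Q \<Longrightarrow> a (int j) \<in> Lie_minus Q"
proof (induction j arbitrary: a)
  case 0
  then show ?case by (auto simp: Lie_minus_iff)
next
  case (Suc j)
  have "fd_deriv a (int j) \<in> Lie_minus Q"
    by (rule Suc.IH[OF conformal.deriv[OF Suc.prems]])
  then have "fscale (1 / of_nat (Suc j)) (fd_deriv a (int j)) \<in> Lie_minus Q"
    by (rule free.subspace_scale[OF subspace_Lie_minus])
  moreover have "fscale (1 / of_nat (Suc j)) (fd_deriv a (int j)) = a (int (Suc j))"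
  proof -
    have "of_int (int j + 1) = (of_nat (Suc j) :: rat)" by simp
    then have "fscale (1 / of_nat (Suc j)) (fd_deriv a (int j))
        = fscale (1 / of_nat (Suc j) * of_nat (Suc j)) (a (int j + 1))"
      unfolding fd_deriv_def by (simp only: free.scale_scale)
    also have "1 / of_nat (Suc j) * of_nat (Suc j) = (1 :: rat)"
      by (simp del: of_nat_Suc)
    finally show ?thesis by (simp add: add.commute)
  qed
  ultimately show ?case by simp
qed

lemma right_normed_Lie_minus: "right_normed Q d w a \<Longrightarrow> p \<ge> 0 \<Longrightarrow> a p \<in> Lie_minus Q"
  using conformal_Lie_minus[OF right_normed_conformal, of Q d w a "nat p"] by simp

lemma gpiece_decomp:
  assumes "x \<in> gpiece Q d w"
  shows "\<exists>u\<in>Lie_plus Q \<inter> gpiece Q d w. \<exists>v\<in>Lie_minus Q \<inter> gpiece Q d w. x = u + v"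
  using assms unfolding gpiece_eq_rn_span
proof (induction rule: rn_span_induct)
  case (base a p w')
  then have *: "a p \<in> rn_span Q d w" by (rule rn_span_base)
  note zeros = free.subspace_0[OF subspace_Lie_plus] free.subspace_0[OF subspace_Lie_minus]
    free.subspace_0[OF subspace_rn_span]
  show ?case
  proof (cases "p < 0")
    case True
    then show ?thesis
      using * right_normed_Lie_plus[OF base(1)] zeros
      by (intro bexI[of _ "a p"] bexI[of _ 0]) auto
  next
    case False
    then show ?thesis
      using * right_normed_Lie_minus[OF base(1)] zeros
      by (intro bexI[of _ 0] bexI[of _ "a p"]) auto
  qed
next
  case zero
  then show ?case
    using free.subspace_0[OF subspace_Lie_plus] free.subspace_0[OF subspace_Lie_minus]
      free.subspace_0[OF subspace_rn_span]
    by (intro bexI[of _ 0]) auto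
next
  case (add x y)
  then obtain u v u' v' where *: "u \<in> Lie_plus Q \<inter> rn_span Q d w" "v \<in> Lie_minus Q \<inter> rn_span Q d w" "x = u + v"
    "u' \<in> Lie_plus Q \<inter> rn_span Q d w" "v' \<in> Lie_minus Q \<inter> rn_span Q d w" "y = u' + v'"
    by blast
  then have "u + u' \<in> Lie_plus Q \<inter> rn_span Q d w" "v + v' \<in> Lie_minus Q \<inter> rn_span Q d w"
    by (auto intro: free.subspace_add subspace_Lie_plus subspace_Lie_minus subspace_rn_span)
  moreover have "x + y = (u + u') + (v + v')" using * by simp
  ultimately show ?case by blast
next
  case (scale c x)
  then obtain u v where *: "u \<in> Lie_plus Q \<inter> rn_span Q d w" "v \<in> Lie_minus Q \<inter> rn_span Q d w" "x = u + v"
    by blast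
  then have "fscale c u \<in> Lie_plus Q \<inter> rn_span Q d w" "fscale c v \<in> Lie_minus Q \<inter> rn_span Q d w"
    by (auto intro: free.subspace_scale subspace_Lie_plus subspace_Lie_minus subspace_rn_span)
  moreover have "fscale c x = fscale c u + fscale c v" using * by (simp add: free.scale_right_distrib)
  ultimately show ?case by blast
qed

section \<open>Local nilpotency of \<open>T\<close> on the positive half\<close>

lemma flinear_funpow:
  fixes F :: "('x \<Rightarrow>\<^sub>0 rat) \<Rightarrow> ('x \<Rightarrow>\<^sub>0 rat)"
  assumes "flinear F"
  shows "flinear (F ^^ n)"
proof (induction n)
  case 0
  then show ?case using flinear_id by (simp add: id_def)
next
  case (Suc n)
  then show ?case using flinear_compose[OF assms, of "F ^^ n"] by (simp add: o_def)
qed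

lemmas lie_T_pow_simps = flinear_simps[OF flinear_funpow[OF flinear_lie_T]]

lemma lie_T_pow_vanish:
  assumes "(lie_T Q ^^ K) x = 0" "K \<le> n"
  shows "(lie_T Q ^^ n) x = 0"
proof -
  have "(lie_T Q ^^ (n - K + K)) x = 0"
    unfolding funpow_add o_apply assms(1) by (rule lie_T_pow_simps(3))
  then show ?thesis using assms(2) by simp
qed

text \<open>\<open>T\<close> takes \<open>i(n)\<close> to a multiple of \<open>i(n - 1)\<close> and
  kills \<open>i(0)\<close>.\<close>

lemma lie_T_pow_gen: "(lie_T Q ^^ Suc n) (fd_gen Q i (- 1 - int n)) = 0"
proof (induction n)
  case 0
  then show ?case by (simp add: lie_T_fd_gen)
next
  case (Suc n)
  have "(lie_T Q ^^ Suc (Suc n)) (fd_gen Q i (- 1 - int (Suc n)))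
      = (lie_T Q ^^ Suc n) (lie_T Q (fd_gen Q i (- 1 - int (Suc n))))"
    by (simp add: funpow_swap1)
  also have "lie_T Q (fd_gen Q i (- 1 - int (Suc n)))
      = fscale (of_int (- 1 - int (Suc n) + 1)) (fd_gen Q i (- 1 - int n))"
    using lie_T_fd_gen[of Q i "- 1 - int (Suc n)"] by simp
  also have "(lie_T Q ^^ Suc n) \<dots> = 0"
    unfolding lie_T_pow_simps(2) Suc.IH by simp
  finally show ?case .
qed

text \<open>By the Leibniz rule one application of \<open>T\<close> lowers the nilpotency exponent
  of one factor, so induction on \<open>K + L\<close> works.\<close>

lemma lie_T_pow_bracket:
  assumes "x \<in> Lie Q" "y \<in> Lie Q" "(lie_T Q ^^ K) x = 0" "(lie_T Q ^^ L) y = 0"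
  shows "(lie_T Q ^^ (K + L)) (bracket Q x y) = 0"
  using assms
proof (induction "K + L" arbitrary: K L x y)
  case 0
  then show ?case by (simp add: bracket_left_simps)
next
  case (Suc m)
  show ?case
  proof (cases "K = 0 \<or> L = 0")
    case True
    then have "bracket Q x y = 0" using Suc.prems by (auto simp: bracket_left_simps bracket_right_simps)
    then show ?thesis by (simp only: lie_T_pow_simps)
  next
    case False
    then obtain K' L' where KL: "K = Suc K'" "L = Suc L'" by (meson not0_implies_Suc)
    have "(lie_T Q ^^ (K' + L)) (bracket Q (lie_T Q x) y) = 0"
      using Suc.hyps(2) Suc.prems KL
      by (intro Suc.hyps(1)) (auto simp: funpow_swap1 lie_T_Lie)
    moreover have "(lie_T Q ^^ (K + L')) (bracket Q x (lie_T Q y)) = 0"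
      using Suc.hyps(2) Suc.prems KL
      by (intro Suc.hyps(1)) (auto simp: funpow_swap1 lie_T_Lie)
    moreover have "(lie_T Q ^^ (K + L)) (bracket Q x y) = (lie_T Q ^^ (K' + L)) (lie_T Q (bracket Q x y))"
      using KL by (simp add: funpow_swap1)
    moreover have "K + L' = K' + L" using KL by simp
    ultimately show ?thesis
      using Suc.prems by (simp add: lie_T_bracket lie_T_pow_simps)
  qed
qed

lemma Lie_plus_nilpotent: "x \<in> Lie_plus Q \<Longrightarrow> x \<in> Lie Q \<and> (\<exists>K. (lie_T Q ^^ K) x = 0)"
  unfolding Lie_plus_def
proof (induction rule: lie_generated.induct)
  case (base a)
  then obtain i n where i: "i \<in> verts Q" "n \<ge> 0" "a = gen Q i n" by blast
  then have "a = fd_gen Q i (- 1 - int (nat n))" by (simp add: fd_gen_def)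
  then show ?case
    using lie_T_pow_gen[of "nat n" Q i] right_normed_Lie[OF right_normed.base[OF i(1)]] by metis
next
  case zero
  show ?case
    using free.subspace_0[OF subspace_Lie] by (auto simp: lie_T_pow_simps)
next
  case (add a b)
  then obtain K L where "(lie_T Q ^^ K) a = 0" "(lie_T Q ^^ L) b = 0" by blast
  then have "(lie_T Q ^^ (K + L)) (a + b) = 0"
    using lie_T_pow_vanish[of K Q a "K + L"] lie_T_pow_vanish[of L Q b "K + L"]
    by (simp add: lie_T_pow_simps)
  then show ?case using add free.subspace_add[OF subspace_Lie] by blast
next
  case (scale a c)
  then obtain K where "(lie_T Q ^^ K) a = 0" by blast
  then have "(lie_T Q ^^ K) (fscale c a) = 0" by (simp add: lie_T_pow_simps)
  then show ?case using scale free.subspace_scale[OF subspace_Lie] by blast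
next
  case (bracket a b)
  then obtain K L where "(lie_T Q ^^ K) a = 0" "(lie_T Q ^^ L) b = 0" by blast
  then show ?case using lie_T_pow_bracket[of a Q b K L] bracket bracket_Lie by blast
qed

lemma lie_T_pow_hom_conformal:
  "a \<in> hom_conformal Q d w \<Longrightarrow> (lie_T Q ^^ j) (a 0) = fscale (fact j) (a (int j))"
proof (induction j)
  case (Suc j)
  then have "(lie_T Q ^^ Suc j) (a 0) = fscale (fact j) (fscale (of_int (int j + 1)) (a (int j + 1)))"
    by (simp add: lie_T_simps lie_T_hom_conformal fd_deriv_def)
  then show ?case by (simp add: algebra_simps)
qed simp

text \<open>If \<open>a(z)\<close> has no coefficients in large powers of \<open>z\<close>, then by induction on the weight its
  defect has none in nonnegative powers, so that \<open>P\<close> acts there exactly as multiplication by a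
  nonzero multiple of \<open>z\<close>; now descend.\<close>

lemma hom_conformal_vanish:
  assumes fin: "finite (verts Q)" and h: "height Q d \<ge> 1"
    and a: "a \<in> hom_conformal Q d w" and K: "\<And>j. j \<ge> K \<Longrightarrow> a (int j) = 0"
  shows "a (int j) = 0"
proof -
  obtain w0 where w0: "\<And>w a. w < w0 \<Longrightarrow> a \<in> hom_conformal Q d w \<Longrightarrow> a = (\<lambda>p. 0)"
    using hom_conformal_bounded_below[OF fin, of d] by blast
  \<comment> \<open>\<open>m\<close> bounds the number of unit steps down in weight after which only
    the zero distribution remains.\<close>
  obtain m where "w - w0 < of_nat m" using reals_Archimedean2[of "w - w0"] by blast
  then have "w < w0 + of_nat m" by simp
  then show ?thesis using a K
  proof (induction m arbitrary: w a j K)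
    case 0
    then have "a = (\<lambda>p. 0)" using w0 by simp
    then show ?case by simp
  next
    case (Suc m)
    define b where "b = P_defect Q d a"
    \<comment> \<open>The bound rises to \<open>Suc K\<close> because the defect at
      \<open>z^j\<close> involves \<open>a\<close> at both \<open>j\<close> and
      \<open>j - 1\<close>.\<close>
    have bz: "b (int j) = 0" for j
    proof (rule Suc.IH[of "w - 1" b "Suc K"])
      show "w - 1 < w0 + of_nat m" using Suc.prems(1) by simp
      show "b \<in> hom_conformal Q d (w - 1)"
        unfolding b_def by (rule P_defect_hom_conformal[OF fin Suc.prems(2)])
      fix j assume "Suc K \<le> j"
      then obtain i where i: "j = Suc i" "K \<le> i" by (metis Suc_le_D Suc_le_mono)
      have "a (int (Suc i)) = 0" "a (int i) = 0"
        by (rule Suc.prems(3); use i(2) in simp)+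
      then show "b (int j) = 0"
        unfolding b_def P_defect_def i(1) by (simp add: lie_P_simps)
    qed
    have down: "a (int i) = 0" if "a (int (Suc i)) = 0" for i
    proof -
      have "fscale (of_int (height Q d)) (a (int i)) = 0"
        using bz[of "Suc i"] that unfolding b_def P_defect_def by (simp add: lie_P_simps)
      then show ?thesis using h by simp
    qed
    \<comment> \<open>Descent from \<open>K\<close> to 0; truncated subtraction makes it stop
      there.\<close>
    have "a (int (K - i)) = 0" for i
    proof (induction i)
      case 0
      then show ?case using Suc.prems(3) by simp
    next
      case (Suc i)
      then show ?case
        using down[of "K - Suc i"] by (cases "i < K") (simp_all add: Suc_diff_Suc)
    qed
    from this[of "K - j"] show ?case
      using Suc.prems(3)[of j] by (cases "j \<ge> K") auto
  qed
qed

section \<open>Degrees of monomials and the trivial intersection of the halves\<close>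

lemma word_height: "t \<in> words Q \<Longrightarrow> finite (verts Q) \<Longrightarrow> height Q (ldeg t) \<ge> 1"
  by (induction t) (auto simp: height_add height_basis_vec)

lemma ldeg_nonneg: "ldeg t i \<ge> 0"
  by (induction t) (auto simp: basis_vec_def plus_fun_apply)

lemma gpiece_trivial: "(\<And>t. t \<in> words Q \<Longrightarrow> ldeg t \<noteq> d) \<Longrightarrow> gpiece Q d w = {0}"
proof -
  assume "\<And>t. t \<in> words Q \<Longrightarrow> ldeg t \<noteq> d"
  then have "grade Q d w \<inter> words Q = {}" by (auto simp: grade_def)
  then show ?thesis by (simp add: piece_eq)
qed

lemma Lie_plus_Int_Lie_minus:
  assumes fin: "finite (verts Q)"
  shows "Lie_plus Q \<inter> Lie_minus Q \<inter> gpiece Q d w \<subseteq> {0}"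
proof
  fix x assume x: "x \<in> Lie_plus Q \<inter> Lie_minus Q \<inter> gpiece Q d w"
  show "x \<in> {0}"
  proof (cases "height Q d \<ge> 1")
    case True
    obtain a where a: "a \<in> hom_conformal Q d w" "a 0 = x"
      using Lie_minus_gpiece x by blast
    obtain K where "(lie_T Q ^^ K) x = 0"
      using Lie_plus_nilpotent x by blast
    then have "a (int j) = 0" if "j \<ge> K" for j
      using lie_T_pow_vanish[of K Q x j] that lie_T_pow_hom_conformal[OF a(1), of j] a(2) by simp
    then have "a (int 0) = 0"
      by (rule hom_conformal_vanish[OF fin True a(1)])
    then show ?thesis using a(2) by simp
  next
    case False
    then have "gpiece Q d w = {0}"
      using word_height[OF _ fin] by (intro gpiece_trivial) auto
    then show ?thesis using x by simp
  qed
qed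

section \<open>Dimensions of the graded components\<close>

lemma gpiece_subsetI:
  assumes "free.subspace V"
    and "\<And>a p w'. right_normed Q d w' a \<Longrightarrow> w = w' + of_int p \<Longrightarrow> a p \<in> V"
  shows "gpiece Q d w \<subseteq> V"
  unfolding gpiece_eq_rn_span rn_span_def
  by (rule free.span_minimal[OF _ assms(1)]) (use assms(2) in blast)

lemma gpiece_finite:
  assumes fin: "finite (verts Q)"
  obtains F where "finite F" "gpiece Q d w \<subseteq> free.span F"
proof
  \<comment> \<open>A distribution whose constant coefficient has weight \<open>w'\<close>
    contributes to weight \<open>w\<close> only through its coefficient at the power
    \<open>w - w'\<close>; \<open>floor\<close> recovers this integer.\<close>
  let ?F = "(\<lambda>x. snd x (floor (w - fst x))) ` {(w, a). right_normed Q d w a \<and> a \<noteq> (\<lambda>p. 0)}"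
  show "finite ?F" using finite_right_normed[OF fin] by (rule finite_imageI)
  show "gpiece Q d w \<subseteq> free.span ?F"
  proof (rule gpiece_subsetI)
    fix a p w' assume a: "right_normed Q d w' a" "w = w' + of_int p"
    show "a p \<in> free.span ?F"
    proof (cases "a = (\<lambda>p. 0)")
      case False
      have "a p \<in> ?F"
        by (rule image_eqI[of _ _ "(w', a)"]) (use a False in auto)
      then show ?thesis by (rule free.span_base)
    qed (simp add: free.span_zero)
  qed (rule free.subspace_span)
qed

text \<open>A coefficient of low weight at a nonnegative power would belong to a distribution of
  still lower constant weight, which is zero.\<close>

lemma gpiece_low:
  assumes fin: "finite (verts Q)"
  obtains w0 where "\<forall>w<w0. gpiece Q d w \<subseteq> Lie_plus Q"
proof -
  obtain w0 where w0: "\<And>w a. w < w0 \<Longrightarrow> a \<in> hom_conformal Q d w \<Longrightarrow> a = (\<lambda>p. 0)"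
    using hom_conformal_bounded_below[OF fin, of d] by blast
  have "gpiece Q d w \<subseteq> Lie_plus Q" if "w < w0" for w
  proof (rule gpiece_subsetI)
    fix a p w' assume a: "right_normed Q d w' a" "w = w' + of_int p"
    show "a p \<in> Lie_plus Q"
    proof (cases "p < 0")
      case False
      then have "(of_int p :: rat) \<ge> 0" by simp
      then have "w' < w0" using a(2) that by linarith
      then have "a = (\<lambda>p. 0)" using w0 hom_conformal_right_normed[OF a(1)] by blast
      then show ?thesis using free.subspace_0[OF subspace_Lie_plus] by simp
    qed (rule right_normed_Lie_plus[OF a(1)])
  qed (rule subspace_Lie_plus)
  then have "\<forall>w<w0. gpiece Q d w \<subseteq> Lie_plus Q" by (intro allI impI)
  then show ?thesis by (rule that)
qed

text \<open>The nonzero right-normed products of degree \<open>d\<close> have bounded constant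
  weight, so heavier coefficients sit at positive powers.\<close>

lemma gpiece_high:
  assumes fin: "finite (verts Q)"
  obtains w1 where "\<forall>w>w1. gpiece Q d w \<subseteq> Lie_minus Q"
proof -
  let ?S = "{(w, a). right_normed Q d w a \<and> a \<noteq> (\<lambda>p. 0)}"
  obtain w1 where w1: "\<And>w. w \<in> fst ` ?S \<Longrightarrow> w \<le> w1"
    using finite_right_normed[OF assms, of d] Max_ge[of "fst ` ?S"] by blast
  have "gpiece Q d w \<subseteq> Lie_minus Q" if "w > w1" for w
  proof (rule gpiece_subsetI)
    fix a p w' assume a: "right_normed Q d w' a" "w = w' + of_int p"
    show "a p \<in> Lie_minus Q"
    proof (cases "a = (\<lambda>p. 0)")
      case True
      then show ?thesis using free.subspace_0[OF subspace_Lie_minus] by simp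
    next
      case False
      then have "w' \<le> w1"
        using a(1) by (intro w1 image_eqI[of _ _ "(w', a)"]) auto
      then have "(of_int p :: rat) > 0" using that a(2) by simp
      then show ?thesis by (intro right_normed_Lie_minus[OF a(1)]) simp
    qed
  qed (rule subspace_Lie_minus)
  then have "\<forall>w>w1. gpiece Q d w \<subseteq> Lie_minus Q" by (intro allI impI)
  then show ?thesis by (rule that)
qed

text \<open>With \<open>b\<close> the defect of \<open>a\<close>, the coefficient \<open>a p\<close>
  is a multiple of \<open>P (a (p + 1)) - b (p + 1)\<close>. Since \<open>b\<close> has lower weight
  and weights are bounded below, induction puts \<open>b (p + 1)\<close> in the image too.\<close>

lemma lie_P_surjective:
  assumes fin: "finite (verts Q)" and h: "height Q d \<ge> 1"
  shows "gpiece Q d w \<subseteq> lie_P Q ` gpiece Q d (w + 1)"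
proof -
  obtain w0 where w0: "\<And>w a. w < w0 \<Longrightarrow> a \<in> hom_conformal Q d w \<Longrightarrow> a = (\<lambda>p. 0)"
    using hom_conformal_bounded_below[OF fin, of d] by blast
  have sub: "free.subspace (lie_P Q ` gpiece Q d v)" for v
    by (rule fpair.linear_subspace_image[OF flinear_lie_P subspace_piece])
  have *: "a p \<in> lie_P Q ` gpiece Q d (v + of_int p + 1)"
    if "v < w0 + of_nat m" "a \<in> hom_conformal Q d v" for a v p m
    using that
  proof (induction m arbitrary: a v p)
    case 0
    then have "a = (\<lambda>p. 0)" using w0 by simp
    then show ?case using free.subspace_0[OF sub] by simp
  next
    case (Suc m)
    define b where "b = P_defect Q d a"
    have b: "b \<in> hom_conformal Q d (v - 1)"
      unfolding b_def by (rule P_defect_hom_conformal[OF fin Suc.prems(2)])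
    have "b (p + 1) \<in> lie_P Q ` gpiece Q d (v - 1 + of_int (p + 1) + 1)"
      using Suc.prems(1) by (intro Suc.IH b) simp
    then have 1: "b (p + 1) \<in> lie_P Q ` gpiece Q d (v + of_int p + 1)"
      by (simp add: algebra_simps)
    have "a (p + 1) \<in> gpiece Q d (v + of_int p + 1)"
      using hom_conformal_gpiece[OF Suc.prems(2), of "p + 1"] by (simp add: algebra_simps)
    then have 2: "lie_P Q (a (p + 1)) \<in> lie_P Q ` gpiece Q d (v + of_int p + 1)"
      by (rule imageI)
    have "fscale (1 / of_int (height Q d)) (lie_P Q (a (p + 1)) - b (p + 1)) = a p"
      using h by (simp add: b_def P_defect_def)
    then show ?case
      using free.subspace_scale[OF sub free.subspace_diff[OF sub 2 1], of "1 / of_int (height Q d)"] by simp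
  qed
  show ?thesis
  proof (rule gpiece_subsetI)
    fix a p w' assume a: "right_normed Q d w' a" "w = w' + of_int p"
    obtain m where "w' - w0 < of_nat m" using reals_Archimedean2[of "w' - w0"] by blast
    then show "a p \<in> lie_P Q ` gpiece Q d (w + 1)"
      unfolding a(2) using a(1) by (intro *[of _ m] hom_conformal_right_normed) auto
  qed (rule sub)
qed

lemma weight_word_shift:
  "t \<in> words Q \<Longrightarrow> finite (verts Q) \<Longrightarrow> weight Q (word_shift t) = weight Q t + of_int (height Q (ldeg t))"
  by (induction t) (auto simp: height_add height_basis_vec)

lemma shift_surjective:
  assumes fin: "finite (verts Q)"
  shows "gpiece Q d (w + of_int (height Q d)) \<subseteq> lie_map Q shift ` gpiece Q d w"
proof -
  have sub: "free.subspace (lie_map Q shift ` gpiece Q d w)"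
    by (rule fpair.linear_subspace_image[OF flinear_lie_map[OF flinear_shift] subspace_piece])
  show ?thesis
    unfolding piece_eq[of Q "grade Q d (w + of_int (height Q d))"]
  proof (rule free.span_minimal, safe)
    fix t assume t: "t \<in> grade Q d (w + of_int (height Q d))" "t \<in> words Q"
    define t' where "t' = map_magma (\<lambda>x. (fst x, snd x + 1)) t"
    have tt: "word_shift t' = t"
      by (simp add: t'_def magma.map_comp o_def) (simp add: magma.map_ident)
    have t': "t' \<in> words Q" "ldeg t' = ldeg t"
      using t(2) word_shift_words[of t' Q] ldeg_word_shift[of t'] by (simp_all add: tt)
    have "t' \<in> grade Q d w"
      using weight_word_shift[OF t'(1) fin] t(1) t'(2) by (auto simp: tt grade_def)
    then have "quotient_map Q (fbasis t') \<in> gpiece Q d w"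
      using t'(1) by (rule piece_base)
    moreover have "lie_map Q shift (quotient_map Q (fbasis t')) = quotient_map Q (shift (fbasis t'))"
      by (rule lie_map_quotient_map[OF flinear_shift shift_lie_ideal])
    ultimately show "quotient_map Q (fbasis t) \<in> lie_map Q shift ` gpiece Q d w"
      by (intro image_eqI[of _ _ "quotient_map Q (fbasis t')"]) (simp_all add: tt)
  qed (rule sub)
qed

text \<open>Surjectivity of \<open>P\<close> makes the dimension nondecreasing along unit steps of
  the weight, while the shift forbids growth over \<open>|d|\<close> steps; so every step is an
  equality.\<close>

lemma dim_gpiece_periodic:
  assumes fin: "finite (verts Q)"
  shows "free.dim (gpiece Q d (w + 1)) = free.dim (gpiece Q d w)"
proof (cases "height Q d \<ge> 1")
  case True
  obtain h where h: "height Q d = int (Suc h)"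
    using True by (metis Suc_le_D nat_int zero_le_imp_eq_int One_nat_def of_nat_le_iff of_nat_1 order_trans zero_le_one)
  have up: "free.dim (gpiece Q d w) \<le> free.dim (gpiece Q d (w + 1))" for w
  proof -
    obtain F where F: "finite F" "gpiece Q d (w + 1) \<subseteq> free.span F" by (rule gpiece_finite[OF fin])
    have "gpiece Q d w \<subseteq> lie_P Q ` gpiece Q d (w + 1)"
      by (rule lie_P_surjective[OF fin True])
    then show ?thesis
      by (rule fpair.dim_image_le_finite[OF flinear_lie_P F])
  qed
  have ups: "free.dim (gpiece Q d w) \<le> free.dim (gpiece Q d (w + of_nat n))" for w n
  proof (induction n)
    case (Suc n)
    have e: "w + of_nat (Suc n) = w + of_nat n + 1" by simp
    show ?case unfolding e using Suc up[of "w + of_nat n"] by simp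
  qed simp
  have "free.dim (gpiece Q d (w + of_int (height Q d))) \<le> free.dim (gpiece Q d w)"
  proof -
    obtain F where F: "finite F" "gpiece Q d w \<subseteq> free.span F" by (rule gpiece_finite[OF fin])
    show ?thesis
      by (rule fpair.dim_image_le_finite[OF flinear_lie_map[OF flinear_shift] F shift_surjective[OF fin, of d w]])
  qed
  \<comment> \<open>\<open>h = |d| - 1\<close> is the number of steps left from \<open>w + 1\<close>
    to \<open>w + |d|\<close>.\<close>
  moreover have "w + of_int (height Q d) = w + 1 + of_nat h" by (simp add: h)
  ultimately show ?thesis
    using ups[of "w + 1" h] up[of w] by simp
next
  case False
  then have "gpiece Q d v = {0}" for v
    using word_height[OF _ fin] by (intro gpiece_trivial) auto
  then show ?thesis by simp
qed

section \<open>From dimensions of components to the Poincare series\<close>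

lemma Lie_component_eq: "Lie_component Q d k = gpiece Q d (- of_int k / 2)"
proof -
  have "{t \<in> words Q. ldeg t = d \<and> of_int k = - 2 * weight Q t} = grade Q d (- of_int k / 2) \<inter> words Q"
    by (auto simp: grade_def field_simps)
  then show ?thesis by (simp add: Lie_component_def piece_def)
qed

lemma dim_gpiece_split:
  assumes fin: "finite (verts Q)"
  shows "free.dim (gpiece Q d w) =
    free.dim (Lie_plus Q \<inter> gpiece Q d w) + free.dim (Lie_minus Q \<inter> gpiece Q d w)"
proof -
  obtain F where F: "finite F" "gpiece Q d w \<subseteq> free.span F" by (rule gpiece_finite[OF fin])
  show ?thesis
    using Lie_plus_Int_Lie_minus[OF fin, of d w] gpiece_decomp[of _ Q d w]
    by (intro free.dim_direct_sum[OF _ _ _ F] free.subspace_inter subspace_Lie_plus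
        subspace_Lie_minus subspace_piece) auto
qed

lemma free_dim_0: "free.dim {0} = 0"
  using free.dim_span_eq_card_independent[of "{}"] free.independent_empty by (simp add: free.span_empty)

text \<open>The coefficient at \<open>n\<close> of the first series counts weight
  \<open>n / 2\<close>. That of the second counts the dual of weight \<open>- n / 2\<close>, hence
  the arguments \<open>- n\<close> below, where \<open>h\<close> belongs to the whole Lie algebra
  and \<open>e\<close> to its negative half.\<close>

lemma poincare_q_pair:
  fixes Q :: "('i, 'a) pre_digraph"
  assumes fin: "finite (verts Q)"
  shows "\<exists>F. q_pair F (poincare Q fscale (Lie_minus_graded Q) d)
      (poincare Q dscale (graded_dual fscale (Lie_plus_graded Q)) d)
    \<and> (F \<noteq> 0 \<longrightarrow> d \<in> lattice Q \<and> (\<forall>i. d i \<ge> 0))"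
proof -
  define c where "c w = free.dim (gpiece Q d w)" for w
  define e where "e n = poincare Q fscale (Lie_minus_graded Q) d n" for n
  define h where "h n = (if d \<in> lattice Q then euler_sign Q d d * of_nat (c (of_int n / 2)) else 0)" for n
  have e: "e n = (if d \<in> lattice Q then euler_sign Q d d *
      of_nat (free.dim (Lie_minus Q \<inter> gpiece Q d (of_int n / 2))) else 0)" for n
    by (simp add: e_def poincare_def Lie_minus_graded_def Lie_component_eq)
  have g: "poincare Q dscale (graded_dual fscale (Lie_plus_graded Q)) d n = h (- n) - e (- n)" for n
  proof -
    let ?V = "Lie_plus Q \<inter> gpiece Q d (- of_int n / 2)"
    obtain F where "finite F" "gpiece Q d (- of_int n / 2) \<subseteq> free.span F" by (rule gpiece_finite[OF fin])
    then have "dual.dim (dual_space fscale ?V) = free.dim ?V"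
      by (intro dual_space_dim(1)[of _ _ F] free.vector_space_axioms free.subspace_inter
          subspace_Lie_plus subspace_piece) auto
    then show ?thesis
      using dim_gpiece_split[OF fin, of d "- of_int n / 2"]
      by (simp add: poincare_def graded_dual_def Lie_plus_graded_def Lie_component_eq e h_def c_def algebra_simps)
  qed
  \<comment> \<open>Period 1 in the weight is period 2 in the power of
    \<open>q_half\<close>.\<close>
  have per: "h (n + 2) = h n" for n
    using dim_gpiece_periodic[OF fin, of d "of_int n / 2"] by (simp add: h_def c_def add_divide_distrib)
  obtain w0 where w0: "\<forall>w<w0. gpiece Q d w \<subseteq> Lie_plus Q"
    by (rule gpiece_low[OF fin])
  obtain w1 where w1: "\<forall>w>w1. gpiece Q d w \<subseteq> Lie_minus Q"
    by (rule gpiece_high[OF fin])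
  have low: "e n = 0" if "n < floor (2 * w0)" for n
  proof -
    have "of_int n / 2 < w0" using that by (simp add: less_floor_iff) 
    then have "Lie_minus Q \<inter> gpiece Q d (of_int n / 2) = {0}"
      using w0[rule_format, of "of_int n / 2"] Lie_plus_Int_Lie_minus[OF fin, of d "of_int n / 2"]
        free.subspace_0[OF subspace_Lie_minus] free.subspace_0[OF subspace_piece] by blast
    then show ?thesis by (simp add: e free_dim_0)
  qed
  have high: "e n = h n" if "n \<ge> ceiling (2 * w1) + 1" for n
  proof -
    have "of_int n / 2 > w1" using that by linarith
    then have "Lie_minus Q \<inter> gpiece Q d (of_int n / 2) = gpiece Q d (of_int n / 2)"
      using w1[rule_format, of "of_int n / 2"] by blast
    then show ?thesis by (simp add: e h_def c_def)
  qed
  have ge: "poincare Q dscale (graded_dual fscale (Lie_plus_graded Q)) d = (\<lambda>n. h (- n) - e (- n))"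
    by (rule ext) (rule g)
  have ee: "poincare Q fscale (Lie_minus_graded Q) d = e"
    by (simp add: e_def fun_eq_iff)
  obtain F where F: "q_pair F e (\<lambda>n. h (- n) - e (- n))"
    using q_pair_exists[of "floor (2 * w0)" e "ceiling (2 * w1) + 1" h, OF low high per] by blast
  show ?thesis
  proof (cases "d \<in> lattice Q \<and> (\<forall>i. d i \<ge> 0)")
    case True
    then show ?thesis unfolding ge ee using F by blast
  next
    \<comment> \<open>Off the lattice both series are 0 by definition; on it, a negative entry of
      \<open>d\<close> excludes every monomial. So \<open>F = 0\<close> serves, which gives the
      support required of a power series.\<close>
    case False
    have "h n = 0 \<and> e n = 0" for n
    proof (cases "d \<in> lattice Q")
      case True
      with False obtain i where "\<not> d i \<ge> 0" by blast
      then have "ldeg t \<noteq> d" for t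
        using ldeg_nonneg[of t i] by auto
      then have "gpiece Q d w = {0}" for w
        by (intro gpiece_trivial)
      then show ?thesis
        using free.subspace_0[OF subspace_Lie_minus[of Q]]
        by (simp add: h_def e c_def free_dim_0 Int_insert_right)
    qed (simp add: h_def e)
    then have "e = (\<lambda>_. 0)" "(\<lambda>n. h (- n) - e (- n)) = (\<lambda>_. 0)"
      by (simp_all add: fun_eq_iff)
    then show ?thesis unfolding ge ee using q_pair_0 by (intro exI[of _ 0]) simp
  qed
qed

theorem theorem6p6:
  fixes Q :: "('i, 'a) pre_digraph"
  assumes "fin_digraph Q" and "symmetric_quiver Q"
  shows "fin_dim_components fscale (Lie_minus_graded Q)
    \<and> fin_dim_components dscale (graded_dual fscale (Lie_plus_graded Q))
    \<and> (\<exists>F G. is_series Q (poincare Q fscale (Lie_minus_graded Q)) F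
        \<and> is_series Q (poincare Q dscale (graded_dual fscale (Lie_plus_graded Q))) G
        \<and> (\<forall>d. invert_q (F d) = - G d))"
proof -
  have fin: "finite (verts Q)"
    using assms(1) by (rule fin_digraph.finite_verts)
  have "fin_dim_components fscale (Lie_minus_graded Q)"
    unfolding fin_dim_components_def Lie_minus_graded_def Lie_component_eq
    by (metis gpiece_finite[OF fin] inf.coboundedI2)
  moreover have "fin_dim_components dscale (graded_dual fscale (Lie_plus_graded Q))"
    unfolding fin_dim_components_def graded_dual_def Lie_plus_graded_def Lie_component_eq
  proof (intro allI)
    fix d and k :: int
    obtain F where "finite F" "gpiece Q d (- of_int (- k) / 2) \<subseteq> free.span F" by (rule gpiece_finite[OF fin])
    then show "\<exists>B. finite B \<and> dual_space fscale (Lie_plus Q \<inter> gpiece Q d (- of_int (- k) / 2)) \<subseteq> dual.span B"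
      by (intro dual_space_dim(2)[of _ _ F] free.vector_space_axioms free.subspace_inter
          subspace_Lie_plus subspace_piece) auto
  qed
  moreover have "\<exists>F G. is_series Q (poincare Q fscale (Lie_minus_graded Q)) F
        \<and> is_series Q (poincare Q dscale (graded_dual fscale (Lie_plus_graded Q))) G
        \<and> (\<forall>d. invert_q (F d) = - G d)"
  proof -
    obtain F where F: "\<And>d. q_pair (F d) (poincare Q fscale (Lie_minus_graded Q) d)
        (poincare Q dscale (graded_dual fscale (Lie_plus_graded Q)) d)"
      "\<And>d. F d \<noteq> 0 \<Longrightarrow> d \<in> lattice Q \<and> (\<forall>i. d i \<ge> 0)"
      using poincare_q_pair[OF fin] by metis
    show ?thesis
    proof (intro exI conjI allI)
      show "is_series Q (poincare Q fscale (Lie_minus_graded Q)) F"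
        using F by (auto simp: is_series_def power_series_def q_pair_def)
      \<comment> \<open>Inversion of \<open>q\<close> maps 0 to 0, so the second series inherits its
        support from \<open>F\<close>.\<close>
      have "F d \<noteq> 0" if "- invert_q (F d) \<noteq> 0" for d
        using that by auto
      then show "is_series Q (poincare Q dscale (graded_dual fscale (Lie_plus_graded Q))) (\<lambda>d. - invert_q (F d))"
        using F by (auto simp: is_series_def power_series_def q_pair_def)
    qed simp
  qed
  ultimately show ?thesis by blast
qed

end
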